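(* Fix an integer $p \geq 2$ and a real number $\alpha \geq 1$. The following are equivalent: (1) If $\Lambda$ is a one-sided Pólya frequency function, then $\mathcal{B}\{\Lambda\}^\alpha$ is the (bilateral) Laplace transform of a $\mathrm{TN}_p$ function. (2) For the Pólya frequency function $\lambda_1 : \mathbb{R} \to \mathbb{R}$ with $\lambda_1(x) = e^{-x}$ for $x \geq 0$ and $\lambda_1(x) = 0$ for $x < 0$, the power $\mathcal{B}\{\lambda_1\}^\alpha$ is the (bilateral) Laplace transform of a $\mathrm{TN}_p$ function. (3) $\alpha \in \mathbb{Z}_{>0} \cup (p-1, \infty)$.
   Context: $\mathbb{Z}_{>0} = \{1,2,3,\ldots\}$. A function $\Lambda : \mathbb{R} \to \mathbb{R}$ is $\mathrm{TN}_p$ if for every $1 \leq n \leq p$ and all reals $x_1 < \cdots < x_n$, $y_1 < \cdots < y_n$ one has $\det(\Lambda(x_i - y_j))_{i,j=1}^n \geq 0$; it is totally non-negative if it is $\mathrm{TN}_p$ for all $p \geq 1$. A Pólya frequency function is a totally non-negative function that is Lebesgue integrable and non-zero at two or more points. Such a function is one-sided if it vanishes on a semi-axis, that is, vanishes identically on $(-\infty,x_0)$ or on $(x_0,\infty)$ for some $x_0 \in \mathbb{R}$. The bilateral Laplace transform of $\Lambda$ is $\mathcal{B}\{\Lambda\}(s) = \int_{\mathbb{R}} e^{-xs} \Lambda(x)\,dx$. For a Pólya frequency function it converges in an open vertical strip containing the imaginary axis, where it is holomorphic, non-vanishing, and positive at real $s$; the power $\mathcal{B}\{\Lambda\}^\alpha$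 is the holomorphic branch on this strip that is positive at real $s$. *)

theory Defs
  imports "HOL-Complex_Analysis.Complex_Analysis" "Jordan_Normal_Form.Determinant"
begin

(* The determinant is qualified because HOL-Analysis also has a constant det. *)
definition TN :: "nat \<Rightarrow> (real \<Rightarrow> real) \<Rightarrow> bool" where
  "TN p \<Lambda> \<longleftrightarrow>
     (\<forall>n\<in>{1..p}. \<forall>x y. strict_mono_on {..<n} x \<longrightarrow> strict_mono_on {..<n} y \<longrightarrow>
        0 \<le> Determinant.det (Matrix.mat n n (\<lambda>(i, j). \<Lambda> (x i - y j))))"

definition totally_nonneg :: "(real \<Rightarrow> real) \<Rightarrow> bool" where
  "totally_nonneg \<Lambda> \<longleftrightarrow> (\<forall>p\<ge>1. TN p \<Lambda>)"

definition polya_frequency :: "(real \<Rightarrow> real) \<Rightarrow> bool" where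
  "polya_frequency \<Lambda> \<longleftrightarrow>
     totally_nonneg \<Lambda> \<and> integrable lebesgue \<Lambda> \<and> (\<exists>x y. x \<noteq> y \<and> \<Lambda> x \<noteq> 0 \<and> \<Lambda> y \<noteq> 0)"

definition one_sided :: "(real \<Rightarrow> real) \<Rightarrow> bool" where
  "one_sided \<Lambda> \<longleftrightarrow> (\<exists>x0. (\<forall>x<x0. \<Lambda> x = 0) \<or> (\<forall>x>x0. \<Lambda> x = 0))"

definition laplace_converges :: "(real \<Rightarrow> real) \<Rightarrow> complex \<Rightarrow> bool" where
  "laplace_converges \<Lambda> s \<longleftrightarrow>
     integrable lebesgue (\<lambda>x. exp (- (of_real x * s)) * of_real (\<Lambda> x))"

definition bilateral_laplace :: "(real \<Rightarrow> real) \<Rightarrow> complex \<Rightarrow> complex" where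
  "bilateral_laplace \<Lambda> s = (LINT x|lebesgue. exp (- (of_real x * s)) * of_real (\<Lambda> x))"

(* Absolute convergence at s depends only on Re s, and the admissible values of Re s form an
   interval, so this is the largest open vertical strip of convergence. *)
definition laplace_strip :: "(real \<Rightarrow> real) \<Rightarrow> complex set" where
  "laplace_strip \<Lambda> = interior {s. laplace_converges \<Lambda> s}"

(* G is a holomorphic branch exp (\<alpha> log F) on S that is positive at the real points of S. On a
   vertical strip this determines G: branches of log F differ by a multiple of 2 \<pi> i, hence
   branches of the power by a unimodular constant, which positivity forces to be 1. *)
definition positive_power_on ::
    "complex set \<Rightarrow> (complex \<Rightarrow> complex) \<Rightarrow> real \<Rightarrow> (complex \<Rightarrow> complex) \<Rightarrow> bool" where
  "positive_power_on S F \<alpha> G \<longleftrightarrow>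
     (\<exists>L. L holomorphic_on S \<and>
          (\<forall>s\<in>S. exp (L s) = F s \<and> G s = exp (of_real \<alpha> * L s))) \<and>
     (\<forall>r::real. of_real r \<in> S \<longrightarrow> (\<exists>c::real. 0 < c \<and> G (of_real r) = of_real c))"

definition laplace_transform_of_on ::
    "complex set \<Rightarrow> (complex \<Rightarrow> complex) \<Rightarrow> (real \<Rightarrow> real) \<Rightarrow> bool" where
  "laplace_transform_of_on S G M \<longleftrightarrow>
     (\<forall>s\<in>S. laplace_converges M s \<and> bilateral_laplace M s = G s)"

definition power_is_TN_laplace :: "nat \<Rightarrow> real \<Rightarrow> (real \<Rightarrow> real) \<Rightarrow> bool" where
  "power_is_TN_laplace p \<alpha> \<Lambda> \<longleftrightarrow>
     (\<exists>G M. positive_power_on (laplace_strip \<Lambda>) (bilateral_laplace \<Lambda>) \<alpha> G \<and>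
            TN p M \<and> laplace_transform_of_on (laplace_strip \<Lambda>) G M)"

definition lambda1 :: "real \<Rightarrow> real" where
  "lambda1 x = (if x \<ge> 0 then exp (- x) else 0)"

end

theory Submission
  imports Defs "HOL-Probability.Levy" "HOL-Computational_Algebra.Fundamental_Theorem_Algebra"
begin

text \<open>The nontrivial implications are from the third condition to the first and from the second
  to the third.

  Let \<open>f\<close> be a Polya frequency function of total mass 1. Expanding \<open>1 / B{f}\<close> at 0 defines
  Appell polynomials \<open>A_n\<close> with \<open>f * A_n = x^n\<close>. Convolution with \<open>f\<close> does not increase the number
  of sign changes, so \<open>A_n\<close> is real-rooted, and \<open>(s/n)^n A_n(n/s)\<close> is a product of \<open>n\<close> real linear
  factors \<open>1 + \<beta> s\<close> that tends to \<open>1 / B{f}\<close> locally uniformly. Hence \<open>B{f}^\<alpha>\<close> is the limit of the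
  products of the \<open>(1 + \<beta> s)^(-\<alpha>)\<close>, which are the transforms of convolutions of rescaled gamma
  densities of shape \<open>\<alpha>\<close>; these are \<open>TN_p\<close> if \<open>\<alpha> > p - 1\<close>, and Fourier inversion carries the
  limit over to the functions. For an integer \<open>\<alpha>\<close> the \<open>\<alpha>\<close>-fold convolution of \<open>f\<close> is enough.

  Conversely, a \<open>TN_p\<close> function with transform \<open>(1 + s)^(-\<alpha>)\<close> is the gamma density
  \<open>x^(\<alpha>-1) e^(-x) / \<Gamma>(\<alpha>)\<close> almost everywhere, and \<open>max(x, 0)^\<beta>\<close> with \<open>k < \<beta> < k + 1\<close> has a negative
  determinant of order \<open>k + 3\<close>, since the product of the first \<open>k + 3\<close> binomial coefficients of
  \<open>\<beta>\<close> is negative.\<close>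

section \<open>Determinants of functions of two indices\<close>

text \<open>A transform determines a function only almost everywhere, while \<open>TN p\<close>
  constrains every value. The limit argument and the converse therefore both end in a continuous
  representative, to which nonnegative minors are carried by moving the points slightly. The
  condition \<alpha> > p - 1 comes from an induction on minors of truncated powers: normalizing the
  first column and applying the mean value theorem row by row lowers order and exponent together by
  one. All uniformity in the limit comes from the first two coefficients of the products of the
  \<open>1 + \<beta> s\<close>, which fix the sums of the \<beta> and of their squares. The upper
  bound on the latter bounds the products on discs, so that \<open>1 / B{f}\<close> is entire. The
  sums of squares tend to the variance of \<open>f\<close>; its positivity gives decay along
  vertical lines that is integrable for \<alpha> > 1. Convergence of the products does not by itself
  give convergence of noninteger powers, since a sum of principal logarithms may leave the principal
  branch; this is excluded by following the segment from 0 to the point considered.\<close>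

definition fdet :: "nat \<Rightarrow> (nat \<Rightarrow> nat \<Rightarrow> 'a) \<Rightarrow> 'a :: comm_ring_1" where
  "fdet n A = Determinant.det (Matrix.mat n n (\<lambda>(i, j). A i j))"

lemma fdet_leibniz:
  "fdet n A = (\<Sum>p | p permutes {..<n}. of_int (sign p) * (\<Prod>i<n. A i (p i)))"
proof -
  have "fdet n A = (\<Sum>p | p permutes {0..<n}. of_int (sign p) *
      (\<Prod>i = 0..<n. Matrix.mat n n (\<lambda>(i, j). A i j) $$ (i, p i)))"
    unfolding fdet_def by (rule det_def') simp
  also have "\<dots> = (\<Sum>p | p permutes {..<n}. of_int (sign p) * (\<Prod>i<n. A i (p i)))"
    by (intro sum.cong arg_cong2[where f = "(*)"] prod.cong refl)
       (auto simp: atLeast0LessThan dest: permutes_in_image[of _ "{0..<n}"])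
  finally show ?thesis .
qed

lemma fdet_cong:
  "n = m \<Longrightarrow> (\<And>i j. i < m \<Longrightarrow> j < m \<Longrightarrow> A i j = B i j) \<Longrightarrow> fdet n A = fdet m B"
  unfolding fdet_def by (auto intro!: arg_cong[where f = Determinant.det] eq_matI)

lemma fdet_0 [simp]: "fdet 0 A = 1"
  by (simp add: fdet_leibniz)

lemma fdet_1 [simp]: "fdet (Suc 0) A = A 0 0"
  unfolding fdet_def by (subst det_single) auto

lemma fdet_permute_rows:
  assumes "p permutes {..<n}"
  shows "fdet n (\<lambda>i. A (p i)) = of_int (sign p) * fdet n A"
proof -
  let ?A = "Matrix.mat n n (\<lambda>(i, j). A i j)"
  have "fdet n (\<lambda>i. A (p i)) = Determinant.det (Matrix.mat n n (\<lambda>(i, j). ?A $$ (p i, j)))"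
    unfolding fdet_def using permutes_in_image[OF assms]
    by (intro arg_cong[where f = Determinant.det] eq_matI) auto
  also have "\<dots> = of_int (sign p) * fdet n A"
    unfolding fdet_def using assms by (intro det_permute_rows) (auto simp: atLeast0LessThan)
  finally show ?thesis .
qed

lemma fdet_transpose: "fdet n (\<lambda>i j. A j i) = fdet n A"
proof -
  have "Determinant.det (transpose_mat (Matrix.mat n n (\<lambda>(i, j). A i j))) = fdet n A"
    unfolding fdet_def by (rule Determinant.det_transpose[where n = n]) simp
  moreover have "transpose_mat (Matrix.mat n n (\<lambda>(i, j). A i j)) = Matrix.mat n n (\<lambda>(i, j). A j i)"
    by (intro eq_matI) auto
  ultimately show ?thesis by (simp add: fdet_def)
qed

lemma fdet_permute_cols:
  assumes "p permutes {..<n}"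
  shows "fdet n (\<lambda>i j. A i (p j)) = of_int (sign p) * fdet n A"
proof -
  have "fdet n (\<lambda>i j. A i (p j)) = fdet n (\<lambda>i j. A j (p i))"
    by (rule fdet_transpose[symmetric])
  also have "\<dots> = of_int (sign p) * fdet n (\<lambda>i j. A j i)"
    by (rule fdet_permute_rows[OF assms])
  also have "fdet n (\<lambda>i j. A j i) = fdet n A"
    by (rule fdet_transpose)
  finally show ?thesis .
qed

lemma fdet_scale:
  "fdet n (\<lambda>i j. r i * c j * A i j) = (\<Prod>i<n. r i) * (\<Prod>j<n. c j) * fdet n A"
proof -
  have "(\<Prod>i<n. r i * c (p i) * A i (p i)) = (\<Prod>i<n. r i) * (\<Prod>j<n. c j) * (\<Prod>i<n. A i (p i))"
    if "p permutes {..<n}" for p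
    using prod.permute[OF that, of c] by (simp add: prod.distrib o_def)
  then show ?thesis
    unfolding fdet_leibniz sum_distrib_left by (intro sum.cong refl) (simp add: ac_simps)
qed

lemma fdet_mult:
  "fdet n (\<lambda>i j. \<Sum>k<n. A i k * B k j) = fdet n A * fdet n B"
proof -
  have "Matrix.mat n n (\<lambda>(i, j). A i j) * Matrix.mat n n (\<lambda>(i, j). B i j)
      = Matrix.mat n n (\<lambda>(i, j). \<Sum>k<n. A i k * B k j)"
    by (intro eq_matI) (auto simp: scalar_prod_def atLeast0LessThan)
  then show ?thesis
    unfolding fdet_def by (metis Determinant.det_mult mat_carrier)
qed

lemma fdet_diag: "fdet n (\<lambda>i j. if i = j then d i else 0) = (\<Prod>i<n. d i)"
proof -
  have "fdet n (\<lambda>i j. if i = j then d i else 0)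
      = prod_list (diag_mat (Matrix.mat n n (\<lambda>(i, j). if i = j then d i else 0)))"
    unfolding fdet_def by (intro det_upper_triangular[of _ n]) auto
  then show ?thesis
    by (simp add: prod_list_diag_prod atLeast0LessThan)
qed

lemma fdet_zero_row:
  assumes "i < n" "\<And>j. j < n \<Longrightarrow> A i j = 0"
  shows "fdet n A = 0"
  unfolding fdet_leibniz
proof (intro sum.neutral ballI)
  fix p assume p: "p \<in> {p. p permutes {..<n}}"
  then have "p i < n" using permutes_in_image[of p "{..<n}" i] assms(1) by simp
  then have "A i (p i) = 0" using assms by simp
  then show "of_int (sign p) * (\<Prod>i<n. A i (p i)) = 0"
    using assms(1) by (subst prod_zero) auto
qed

lemma fdet_identical_rows:
  assumes "i \<noteq> k" "i < n" "k < n" "\<And>j. j < n \<Longrightarrow> A i j = A k j"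
  shows "fdet n A = 0"
  unfolding fdet_def using assms
  by (intro det_identical_rows[of _ n i k]) (auto intro!: eq_vecI)

lemma fdet_identical_cols:
  assumes "i \<noteq> k" "i < n" "k < n" "\<And>j. j < n \<Longrightarrow> A j i = A j k"
  shows "fdet n A = 0"
  using fdet_identical_rows[of i k n "\<lambda>i j. A j i"] assms fdet_transpose[of n A] by simp

lemma fdet_eq_0_iff:
  fixes A :: "nat \<Rightarrow> nat \<Rightarrow> 'a :: field"
  shows "fdet n A = 0 \<longleftrightarrow> (\<exists>v. (\<exists>j<n. v j \<noteq> 0) \<and> (\<forall>i<n. (\<Sum>j<n. A i j * v j) = 0))"
proof -
  let ?A = "Matrix.mat n n (\<lambda>(i, j). A i j)"
  have "fdet n A = 0 \<longleftrightarrow> (\<exists>v. v \<in> carrier_vec n \<and> v \<noteq> 0\<^sub>v n \<and> ?A *\<^sub>v v = 0\<^sub>v n)"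
    unfolding fdet_def by (rule det_0_iff_vec_prod_zero_field) simp
  also have "\<dots> \<longleftrightarrow> (\<exists>v. (\<exists>j<n. v j \<noteq> 0) \<and> (\<forall>i<n. (\<Sum>j<n. A i j * v j) = 0))" (is "?L = ?R")
  proof
    assume ?L
    then obtain v where v: "v \<in> carrier_vec n" "v \<noteq> 0\<^sub>v n" "?A *\<^sub>v v = 0\<^sub>v n" by blast
    have "\<exists>j<n. vec_index v j \<noteq> 0" using v(1,2) by (auto simp: Matrix.vec_eq_iff)
    moreover have "(\<Sum>j<n. A i j * vec_index v j) = 0" if "i < n" for i
    proof -
      have "vec_index (?A *\<^sub>v v) i = 0" using v that by simp
      then show ?thesis using v(1) that by (simp add: scalar_prod_def atLeast0LessThan)
    qed
    ultimately show ?R by blast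
  next
    assume ?R
    then obtain v where v: "\<exists>j<n. v j \<noteq> 0" "\<And>i. i < n \<Longrightarrow> (\<Sum>j<n. A i j * v j) = 0" by blast
    have "Matrix.vec n v \<noteq> 0\<^sub>v n" using v(1) by (auto simp: Matrix.vec_eq_iff)
    moreover have "?A *\<^sub>v Matrix.vec n v = 0\<^sub>v n"
      using v(2) by (intro eq_vecI) (auto simp: scalar_prod_def atLeast0LessThan)
    ultimately show ?L by (intro exI[of _ "Matrix.vec n v"]) simp
  qed
  finally show ?thesis .
qed

text \<open>The increasing enumeration of the indices other than \<open>l\<close>; composing with it
  deletes a row or a column.\<close>

definition skip :: "nat \<Rightarrow> nat \<Rightarrow> nat" where
  "skip l i = (if i < l then i else Suc i)"

lemma fdet_expand_col:
  assumes "j \<le> n"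
  shows "fdet (Suc n) A = (\<Sum>i\<le>n. (-1)^(i + j) * A i j * fdet n (\<lambda>r c. A (skip i r) (skip j c)))"
proof -
  let ?A = "Matrix.mat (Suc n) (Suc n) (\<lambda>(i, j). A i j)"
  have "fdet (Suc n) A = (\<Sum>i<Suc n. ?A $$ (i, j) * cofactor ?A i j)"
    unfolding fdet_def by (rule laplace_expansion_column) (use assms in auto)
  also have "\<dots> = (\<Sum>i\<le>n. (-1)^(i + j) * A i j * fdet n (\<lambda>r c. A (skip i r) (skip j c)))"
    unfolding lessThan_Suc_atMost
  proof (intro sum.cong refl)
    fix i assume i: "i \<in> {..n}"
    have "mat_delete ?A i j = Matrix.mat n n (\<lambda>(r, c). A (skip i r) (skip j c))"
      unfolding mat_delete_def skip_def by (intro eq_matI) auto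
    then show "?A $$ (i, j) * cofactor ?A i j
        = (-1)^(i + j) * A i j * fdet n (\<lambda>r c. A (skip i r) (skip j c))"
      using i assms by (simp add: cofactor_def fdet_def)
  qed
  finally show ?thesis .
qed

lemma fdet_expand_first_row_unit:
  assumes "\<And>j. j < n \<Longrightarrow> A 0 (Suc j) = 0"
  shows "fdet (Suc n) A = A 0 0 * fdet n (\<lambda>i j. A (Suc i) (Suc j))"
proof -
  have "fdet (Suc n) A = fdet (Suc n) (\<lambda>i j. A j i)" by (rule fdet_transpose[symmetric])
  also have "\<dots> = (\<Sum>i\<le>n. (-1)^(i + 0) * A 0 i * fdet n (\<lambda>r c. A (skip 0 c) (skip i r)))"
    by (rule fdet_expand_col) simp
  also have "\<dots> = (\<Sum>i\<in>{0}. (-1)^(i + 0) * A 0 i * fdet n (\<lambda>r c. A (skip 0 c) (skip i r)))"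
  proof (intro sum.mono_neutral_right ballI)
    fix i assume "i \<in> {..n} - {0}"
    then have "A 0 i = 0" using assms[of "i - 1"] by (cases i) auto
    then show "(-1)^(i + 0) * A 0 i * fdet n (\<lambda>r c. A (skip 0 c) (skip i r)) = 0" by simp
  qed auto
  also have "\<dots> = A 0 0 * fdet n (\<lambda>r c. A (Suc c) (Suc r))"
    by (simp add: skip_def)
  also have "fdet n (\<lambda>r c. A (Suc c) (Suc r)) = fdet n (\<lambda>i j. A (Suc i) (Suc j))"
    by (rule fdet_transpose)
  finally show ?thesis .
qed

lemma fdet_tendsto [tendsto_intros]:
  fixes A :: "'b \<Rightarrow> nat \<Rightarrow> nat \<Rightarrow> 'a :: {real_normed_field}"
  assumes "\<And>i j. i < n \<Longrightarrow> j < n \<Longrightarrow> ((\<lambda>t. A t i j) \<longlongrightarrow> B i j) F"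
  shows "((\<lambda>t. fdet n (A t)) \<longlongrightarrow> fdet n B) F"
  unfolding fdet_leibniz
proof (intro tendsto_sum tendsto_mult tendsto_prod tendsto_const)
  fix p i assume "p \<in> {p. p permutes {..<n}}" "i \<in> {..<n}"
  then show "((\<lambda>t. A t i (p i)) \<longlongrightarrow> B i (p i)) F"
    using permutes_in_image[of p "{..<n}" i] by (intro assms) auto
qed

lemma strict_mono_on_skip: "strict_mono_on A (skip l)"
  by (auto simp: strict_mono_on_def skip_def)

text \<open>The column span of a totally nonnegative matrix with \<open>M\<close> columns contains no vector
  with \<open>M + 1\<close> strictly alternating entries: bordering the matrix with the vector gives a
  vanishing determinant whose expansion has terms of one sign. If the leading minor vanishes, one
  column is redundant.\<close>

lemma totally_nonneg_span_no_alternation: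
  fixes A :: "nat \<Rightarrow> nat \<Rightarrow> real"
  assumes "\<And>(k :: nat) r c. strict_mono_on {..<k} r \<Longrightarrow> strict_mono_on {..<k} c \<Longrightarrow>
             (\<And>i. i < k \<Longrightarrow> r i \<le> M \<and> c i < M) \<Longrightarrow> 0 \<le> fdet k (\<lambda>i j. A (r i) (c j))"
    and "\<And>i. i \<le> M \<Longrightarrow> y i = (\<Sum>j<M. x j * A i j)"
    and "\<And>i. i \<le> M \<Longrightarrow> 0 < (-1)^i * y i"
  shows False
  using assms
proof (induction M arbitrary: A x)
  case 0
  from 0(2,3)[of 0] show ?case by simp
next
  case (Suc M)
  note TN = Suc.prems(1) and span = Suc.prems(2) and alt = Suc.prems(3)
  show False
  proof (cases "fdet (Suc M) A = 0")
    case True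
    then obtain v l where v: "l < Suc M" "v l \<noteq> 0"
      "\<And>i. i < Suc M \<Longrightarrow> (\<Sum>j<Suc M. A i j * v j) = 0"
      unfolding fdet_eq_0_iff by blast
    \<comment> \<open>Subtracting a multiple of the kernel vector \<open>v\<close> removes the
      coefficient of column \<open>l\<close> without changing the combination in the rows up to
      \<open>M\<close>. The last row, where \<open>v\<close> need not give zero, is given up along
      with the column.\<close>
    define x' where "x' j = x j - x l * v j / v l" for j
    have bij: "bij_betw (skip l) {..<M} ({..<Suc M} - {l})"
      unfolding bij_betw_def
    proof
      show "inj_on (skip l) {..<M}" by (auto simp: inj_on_def skip_def split: if_splits)
      show "skip l ` {..<M} = {..<Suc M} - {l}"
      proof (intro equalityI subsetI)
        fix j assume j: "j \<in> {..<Suc M} - {l}"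
        show "j \<in> skip l ` {..<M}"
        proof (cases "j < l")
          case True
          then show ?thesis using j v(1) by (intro image_eqI[of _ _ j]) (auto simp: skip_def)
        next
          case False
          then show ?thesis using j by (intro image_eqI[of _ _ "j - 1"]) (auto simp: skip_def)
        qed
      qed (auto simp: skip_def split: if_splits)
    qed
    show False
    proof (rule Suc.IH[where A = "\<lambda>i j. A i (skip l j)" and x = "\<lambda>j. x' (skip l j)"])
      fix k :: nat and r c assume rc: "strict_mono_on {..<k} r" "strict_mono_on {..<k} c"
        "\<And>i. i < k \<Longrightarrow> r i \<le> M \<and> c i < M"
      have "strict_mono_on {..<k} (\<lambda>j. skip l (c j))"
        using rc(2) by (auto simp: strict_mono_on_def skip_def) (metis Suc_lessD less_trans not_less_eq)+
      then show "0 \<le> fdet k (\<lambda>i j. A (r i) (skip l (c j)))"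
        using rc by (intro TN[of k r "\<lambda>j. skip l (c j)"]) (auto simp: skip_def le_SucI less_SucI)
    next
      fix i assume i: "i \<le> M"
      have "y i = (\<Sum>j<Suc M. x j * A i j) - x l / v l * (\<Sum>j<Suc M. A i j * v j)"
        using span[of i] v(3)[of i] i by simp
      also have "\<dots> = (\<Sum>j<Suc M. x' j * A i j)"
        unfolding sum_distrib_left sum_subtractf[symmetric] x'_def
        by (intro sum.cong refl) (simp add: field_simps)
      also have "\<dots> = (\<Sum>j\<in>{..<Suc M} - {l}. x' j * A i j)"
        using v by (intro sum.mono_neutral_right) (auto simp: x'_def)
      also have "\<dots> = (\<Sum>j<M. x' (skip l j) * A i (skip l j))"
        by (rule sum.reindex_bij_betw[OF bij, symmetric])
      finally show "y i = \<dots>" .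
    next
      fix i assume "i \<le> M"
      then show "0 < (-1)^i * y i" by (intro alt) simp
    qed
  next
    case False
    define B where "B i j = (if j < Suc M then A i j else y i)" for i j
    have "(\<Sum>j<Suc (Suc M). B i j * (if j < Suc M then x j else -1)) = 0" if "i < Suc (Suc M)" for i
      using span[of i] that by (simp add: B_def mult.commute)
    then have "fdet (Suc (Suc M)) B = 0"
      unfolding fdet_eq_0_iff
      by (intro exI[of _ "\<lambda>j. if j < Suc M then x j else -1"]) auto
    moreover have "fdet (Suc (Suc M)) B = (\<Sum>i\<le>Suc M. (-1)^(i + Suc M) * B i (Suc M) *
        fdet (Suc M) (\<lambda>r c. B (skip i r) (skip (Suc M) c)))"
      by (rule fdet_expand_col) simp
    moreover have "\<dots> = (-1)^(Suc M) * (\<Sum>i\<le>Suc M. (-1)^i * y i * fdet (Suc M) (\<lambda>r. A (skip i r)))"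
      unfolding sum_distrib_left
    proof (intro sum.cong refl)
      fix i assume "i \<in> {..Suc M}"
      have "fdet (Suc M) (\<lambda>r c. B (skip i r) (skip (Suc M) c)) = fdet (Suc M) (\<lambda>r. A (skip i r))"
        by (rule fdet_cong) (auto simp: B_def skip_def)
      then show "(-1)^(i + Suc M) * B i (Suc M) * fdet (Suc M) (\<lambda>r c. B (skip i r) (skip (Suc M) c))
          = (-1)^(Suc M) * ((-1)^i * y i * fdet (Suc M) (\<lambda>r. A (skip i r)))"
        by (simp add: B_def power_add)
    qed
    ultimately have 0: "(\<Sum>i\<le>Suc M. (-1)^i * y i * fdet (Suc M) (\<lambda>r. A (skip i r))) = 0"
      by simp
    have nonneg: "0 \<le> fdet (Suc M) (\<lambda>r. A (skip i r))" if "i \<le> Suc M" for i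
      using TN[of "Suc M" "skip i" "\<lambda>j. j"] strict_mono_on_skip that
      by (auto simp: skip_def strict_mono_on_def)
    \<comment> \<open>All terms of the vanishing sum are nonnegative, so the last one vanishes too,
      although both of its factors, the leading minor and \<open>y (Suc M)\<close>, are
      nonzero.\<close>
    have "(-1)^(Suc M) * y (Suc M) * fdet (Suc M) (\<lambda>r. A (skip (Suc M) r)) = 0"
      using 0 by (subst (asm) sum_nonneg_eq_0_iff)
        (auto intro!: mult_nonneg_nonneg[OF less_imp_le[OF alt] nonneg] simp del: mult_eq_0_iff)
    moreover have "fdet (Suc M) (\<lambda>r. A (skip (Suc M) r)) = fdet (Suc M) A"
      by (rule fdet_cong) (auto simp: skip_def)
    ultimately show False
      using False alt[of "Suc M"] by simp
  qed
qed

section \<open>Andreief's identity and compositions of kernels\<close>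

text \<open>Expanding both determinants over permutations \<open>p\<close>, \<open>q\<close> and
  integrating coordinate by coordinate turns each term into a product of entries
  \<open>C (p k) (q k)\<close>. Summing over \<open>q\<close> gives the determinant with rows
  permuted by \<open>p\<close>; the two signs of \<open>p\<close> cancel, so each of the n!
  permutations contributes the same value.\<close>

lemma andreief:
  fixes a b :: "nat \<Rightarrow> 'a \<Rightarrow> real"
  assumes "sigma_finite_measure M"
    and int: "\<And>i j. i < n \<Longrightarrow> j < n \<Longrightarrow> integrable M (\<lambda>z. a i z * b j z)"
  shows "fact n * fdet n (\<lambda>i j. LINT z|M. a i z * b j z) =
    (LINT z|PiM {..<n} (\<lambda>_. M). fdet n (\<lambda>k i. a i (z k)) * fdet n (\<lambda>k j. b j (z k)))"
proof -
  interpret sigma_finite_measure M by fact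
  interpret product_sigma_finite "\<lambda>_ :: nat. M" by unfold_locales
  let ?P = "{p. p permutes {..<n}}"
  define C where "C i j = (LINT z|M. a i z * b j z)" for i j
  have lt: "p k < n" if "p \<in> ?P" "k < n" for p k
    using that permutes_in_image[of p "{..<n}" k] by simp
  have integrable: "integrable (PiM {..<n} (\<lambda>_. M)) (\<lambda>z. \<Prod>k<n. a (p k) (z k) * b (q k) (z k))"
    if "p \<in> ?P" "q \<in> ?P" for p q
  proof (rule product_integrable_prod)
    fix k assume "k \<in> {..<n}"
    then show "integrable M (\<lambda>z. a (p k) z * b (q k) z)"
      using lt[OF that(1), of k] lt[OF that(2), of k] by (intro int) auto
  qed auto
  have integral: "(LINT z|PiM {..<n} (\<lambda>_. M). (\<Prod>k<n. a (p k) (z k) * b (q k) (z k)))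
      = (\<Prod>k<n. C (p k) (q k))" if "p \<in> ?P" "q \<in> ?P" for p q
    unfolding C_def
  proof (rule product_integral_prod)
    fix k assume "k \<in> {..<n}"
    then show "integrable M (\<lambda>z. a (p k) z * b (q k) z)"
      using lt[OF that(1), of k] lt[OF that(2), of k] by (intro int) auto
  qed auto
  have "fdet n (\<lambda>k i. a i (z k)) * fdet n (\<lambda>k j. b j (z k)) =
      (\<Sum>p\<in>?P. \<Sum>q\<in>?P. of_int (sign p) * of_int (sign q) * (\<Prod>k<n. a (p k) (z k) * b (q k) (z k)))" for z
    unfolding fdet_leibniz sum_product by (simp add: prod.distrib mult_ac)
  then have "(LINT z|PiM {..<n} (\<lambda>_. M). fdet n (\<lambda>k i. a i (z k)) * fdet n (\<lambda>k j. b j (z k))) =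
      (\<Sum>p\<in>?P. \<Sum>q\<in>?P. of_int (sign p) * of_int (sign q) * (\<Prod>k<n. C (p k) (q k)))"
  proof (subst Bochner_Integration.integral_cong[OF refl], assumption)
    have "(LINT z|PiM {..<n} (\<lambda>_. M). (\<Sum>p\<in>?P. \<Sum>q\<in>?P. of_int (sign p) * of_int (sign q) *
          (\<Prod>k<n. a (p k) (z k) * b (q k) (z k)))) =
        (\<Sum>p\<in>?P. LINT z|PiM {..<n} (\<lambda>_. M). (\<Sum>q\<in>?P. of_int (sign p) * of_int (sign q) *
          (\<Prod>k<n. a (p k) (z k) * b (q k) (z k))))"
      by (intro Bochner_Integration.integral_sum Bochner_Integration.integrable_sum
          integrable_mult_right integrable)
    also have "\<dots> = (\<Sum>p\<in>?P. \<Sum>q\<in>?P. LINT z|PiM {..<n} (\<lambda>_. M). of_int (sign p) * of_int (sign q) *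
          (\<Prod>k<n. a (p k) (z k) * b (q k) (z k)))"
      by (intro sum.cong refl Bochner_Integration.integral_sum integrable_mult_right integrable)
    also have "\<dots> = (\<Sum>p\<in>?P. \<Sum>q\<in>?P. of_int (sign p) * of_int (sign q) * (\<Prod>k<n. C (p k) (q k)))"
      by (intro sum.cong refl) (simp add: integral)
    finally show "(LINT z|PiM {..<n} (\<lambda>_. M). (\<Sum>p\<in>?P. \<Sum>q\<in>?P. of_int (sign p) * of_int (sign q) *
          (\<Prod>k<n. a (p k) (z k) * b (q k) (z k)))) = \<dots>" .
  qed
  also have "\<dots> = (\<Sum>p\<in>?P. of_int (sign p) * fdet n (\<lambda>k. C (p k)))"
    unfolding fdet_leibniz sum_distrib_left by (simp add: mult_ac)
  also have "\<dots> = (\<Sum>p\<in>?P. fdet n C)"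
  proof (intro sum.cong refl)
    fix p assume "p \<in> ?P"
    then show "of_int (sign p) * fdet n (\<lambda>k. C (p k)) = fdet n C"
      using fdet_permute_rows[of p n C] by (simp add: sign_def)
  qed
  also have "\<dots> = fact n * fdet n C"
    by (simp add: card_permutations[of _ n])
  finally show ?thesis by (simp add: C_def[abs_def])
qed

lemma ex_sorting_permutation:
  fixes z :: "nat \<Rightarrow> 'a :: linorder"
  assumes "inj_on z {..<n}"
  shows "\<exists>p. p permutes {..<n} \<and> strict_mono_on {..<n} (z \<circ> p)"
proof -
  define xs where "xs = sort (map z [0..<n])"
  have "mset xs = mset (map z [0..<n])" by (simp add: xs_def)
  then obtain p where p: "p permutes {..<length (map z [0..<n])}" "permute_list p (map z [0..<n]) = xs"
    by (rule mset_eq_permutation)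
  have len: "length xs = n" by (simp add: xs_def)
  have nth: "xs ! i = z (p i)" if "i < n" for i
    using p that permutes_in_image[OF p(1), of i] by (auto simp flip: p(2) simp: permute_list_nth)
  have "distinct (map z [0..<n])" using assms by (simp add: distinct_map atLeast0LessThan)
  then have "distinct xs" by (simp add: xs_def)
  moreover have "sorted xs" by (simp add: xs_def)
  ultimately have "sorted_wrt (<) xs" by (simp add: strict_sorted_iff)
  then have "strict_mono_on {..<n} (z \<circ> p)"
    unfolding strict_mono_on_def sorted_wrt_iff_nth_less len using nth by fastforce
  moreover have "p permutes {..<n}" using p(1) by simp
  ultimately show ?thesis by blast
qed

text \<open>Sorting the points multiplies both determinants by the same sign, and coinciding points
  annihilate them, so the integrand of Andreief's identity need only be examined at ordered points.
  This is the continuous Cauchy-Binet argument for composing totally nonnegative kernels.\<close>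

lemma andreief_nonneg:
  fixes a b :: "nat \<Rightarrow> 'a :: linorder \<Rightarrow> real"
  assumes "sigma_finite_measure M"
    and "\<And>i j. i < n \<Longrightarrow> j < n \<Longrightarrow> integrable M (\<lambda>z. a i z * b j z)"
    and nonneg: "\<And>z. strict_mono_on {..<n} z \<Longrightarrow>
           0 \<le> fdet n (\<lambda>k i. a i (z k)) * fdet n (\<lambda>k j. b j (z k))"
  shows "0 \<le> fdet n (\<lambda>i j. LINT z|M. a i z * b j z)"
proof -
  have "0 \<le> fdet n (\<lambda>k i. a i (z k)) * fdet n (\<lambda>k j. b j (z k))" for z
  proof (cases "inj_on z {..<n}")
    case True
    then obtain p where p: "p permutes {..<n}" "strict_mono_on {..<n} (z \<circ> p)"
      using ex_sorting_permutation by blast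
    have "0 \<le> fdet n (\<lambda>k i. a i ((z \<circ> p) k)) * fdet n (\<lambda>k j. b j ((z \<circ> p) k))"
      by (rule nonneg[OF p(2)])
    also have "\<dots> = (of_int (sign p) * fdet n (\<lambda>k i. a i (z k))) * (of_int (sign p) * fdet n (\<lambda>k j. b j (z k)))"
      using fdet_permute_rows[OF p(1), of "\<lambda>k i. a i (z k)"] fdet_permute_rows[OF p(1), of "\<lambda>k i. b i (z k)"]
      by simp
    also have "\<dots> = fdet n (\<lambda>k i. a i (z k)) * fdet n (\<lambda>k j. b j (z k))"
      by (simp add: sign_def)
    finally show ?thesis .
  next
    case False
    then obtain i j where ij: "i < n" "j < n" "i \<noteq> j" "z i = z j" by (auto simp: inj_on_def)
    then have "fdet n (\<lambda>k i. a i (z k)) = 0" by (intro fdet_identical_rows[of i j]) auto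
    then show ?thesis by simp
  qed
  then have "0 \<le> (LINT z|PiM {..<n} (\<lambda>_. M). fdet n (\<lambda>k i. a i (z k)) * fdet n (\<lambda>k j. b j (z k)))"
    by (rule Bochner_Integration.integral_nonneg)
  then have "0 \<le> fact n * fdet n (\<lambda>i j. LINT z|M. a i z * b j z)"
    using andreief[of M n a b] assms(1,2) by simp
  then show ?thesis using fact_gt_zero[of n, where ?'a = real] by (simp only: zero_le_mult_iff) linarith
qed

section \<open>Mean values, row differences and staircase determinants\<close>

lemma fdet_2: "fdet 2 A = A 0 0 * A 1 1 - A 0 1 * A 1 0"
proof -
  have "fdet (Suc 1) A = A 0 0 * A 1 1 - A 0 1 * A 1 0"
    by (subst fdet_expand_col[of 0]) (auto simp: skip_def)
  then show ?thesis by (simp add: numeral_2_eq_2)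
qed

text \<open>The coefficients \<open>c\<close> come from the other rows only, so a determinant whose
  row \<open>m\<close> moves along a curve is a scalar function of the parameter.\<close>

lemma fdet_row_functional:
  assumes "m < n"
  shows "\<exists>c. \<forall>r. fdet n (\<lambda>i j. if i = m then r j else A i j) = (\<Sum>j<n. r j * c j)"
proof -
  obtain k where k: "n = Suc k" using assms by (cases n) auto
  have "fdet n (\<lambda>i j. if i = m then r j else A i j) =
      (\<Sum>j<n. r j * ((-1)^(j + m) * fdet k (\<lambda>a b. A (skip m b) (skip j a))))" for r
  proof -
    have "fdet (Suc k) (\<lambda>i j. if i = m then r j else A i j) = fdet (Suc k) (\<lambda>j i. if i = m then r j else A i j)"
      by (rule fdet_transpose[symmetric])
    also have "\<dots> = (\<Sum>j\<le>k. (-1)^(j + m) * (if m = m then r j else A m j) *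
        fdet k (\<lambda>a b. if skip m b = m then r (skip j a) else A (skip m b) (skip j a)))"
      by (rule fdet_expand_col) (use assms k in simp)
    also have "\<dots> = (\<Sum>j<Suc k. r j * ((-1)^(j + m) * fdet k (\<lambda>a b. A (skip m b) (skip j a))))"
    proof -
      have "skip m b \<noteq> m" for b by (simp add: skip_def)
      then show ?thesis by (simp add: mult_ac lessThan_Suc_atMost)
    qed
    finally show ?thesis unfolding k .
  qed
  then show ?thesis
    by (intro exI[of _ "\<lambda>j. (-1)^(j + m) * fdet k (\<lambda>a b. A (skip m b) (skip j a))"]) blast
qed

text \<open>The scalar mean value theorem is applied to one row at a time, the other rows being
  frozen. The intermediate point of a row may depend on those chosen before it.\<close>

lemma fdet_row_mvt:
  fixes K K' :: "real \<Rightarrow> nat \<Rightarrow> real"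
  assumes less: "\<And>i. i < n \<Longrightarrow> u i < v i"
    and deriv: "\<And>i j t. i < n \<Longrightarrow> j < n \<Longrightarrow> u i \<le> t \<Longrightarrow> t \<le> v i \<Longrightarrow>
                  ((\<lambda>t. K t j) has_real_derivative K' t j) (at t)"
  shows "\<exists>\<zeta>. (\<forall>i<n. u i < \<zeta> i \<and> \<zeta> i < v i) \<and>
    fdet n (\<lambda>i j. K (v i) j - K (u i) j) = (\<Prod>i<n. v i - u i) * fdet n (\<lambda>i j. K' (\<zeta> i) j)"
proof -
  define D where "D i j = K (v i) j - K (u i) j" for i j
  have "\<exists>\<zeta>. (\<forall>i<m. u i < \<zeta> i \<and> \<zeta> i < v i) \<and>
      fdet n D = (\<Prod>i<m. v i - u i) * fdet n (\<lambda>i j. if i < m then K' (\<zeta> i) j else D i j)"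
    if "m \<le> n" for m
    using that
  proof (induction m)
    case (Suc m)
    then obtain \<zeta> where \<zeta>: "\<And>i. i < m \<Longrightarrow> u i < \<zeta> i \<and> \<zeta> i < v i"
      "fdet n D = (\<Prod>i<m. v i - u i) * fdet n (\<lambda>i j. if i < m then K' (\<zeta> i) j else D i j)"
      by (auto simp: Suc_le_eq)
    have m: "m < n" using Suc by simp
    obtain c where c: "\<And>r. fdet n (\<lambda>i j. if i = m then r j else if i < m then K' (\<zeta> i) j else D i j)
        = (\<Sum>j<n. r j * c j)"
      using fdet_row_functional[OF m, of "\<lambda>i j. if i < m then K' (\<zeta> i) j else D i j"] by blast
    have "\<exists>t. u m < t \<and> t < v m \<and> (\<Sum>j<n. K (v m) j * c j) - (\<Sum>j<n. K (u m) j * c j)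
        = (v m - u m) * (\<Sum>j<n. K' t j * c j)"
      using less[OF m] by (intro MVT2) (auto intro!: derivative_eq_intros deriv[OF m] sum.cong)
    then obtain t where t: "u m < t" "t < v m"
      "(\<Sum>j<n. K (v m) j * c j) - (\<Sum>j<n. K (u m) j * c j) = (v m - u m) * (\<Sum>j<n. K' t j * c j)"
      by blast
    have "fdet n (\<lambda>i j. if i < m then K' (\<zeta> i) j else D i j) = (\<Sum>j<n. D m j * c j)"
      unfolding c[symmetric] by (intro fdet_cong) auto
    also have "\<dots> = (v m - u m) * (\<Sum>j<n. K' t j * c j)"
      using t(3) by (simp add: D_def left_diff_distrib sum_subtractf)
    also have "(\<Sum>j<n. K' t j * c j) = fdet n (\<lambda>i j. if i < Suc m then K' ((\<zeta>(m := t)) i) j else D i j)"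
      unfolding c[symmetric] by (intro fdet_cong) auto
    finally show ?case
      using \<zeta> t(1,2) by (intro exI[of _ "\<zeta>(m := t)"]) (auto simp: less_Suc_eq)
  qed simp
  from this[of n] show ?thesis
    by (auto simp: D_def[abs_def] cong: fdet_cong)
qed

text \<open>Multiplication by this matrix from the left subtracts from each row its
  predecessor.\<close>

lemma fdet_bidiagonal:
  "fdet n (\<lambda>i k. if k = i then 1 else if Suc k = i then -1 else 0 :: 'a :: comm_ring_1) = 1"
proof -
  have "fdet n (\<lambda>i k. if k = i then 1 else if Suc k = i then -1 else 0 :: 'a)
      = prod_list (diag_mat (Matrix.mat n n (\<lambda>(i, k). if k = i then 1 else if Suc k = i then -1 else 0)))"
    unfolding fdet_def by (intro det_lower_triangular[of n]) auto
  then show ?thesis by (simp add: prod_list_diag_prod atLeast0LessThan)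
qed

lemma fdet_first_col_one:
  assumes "\<And>i. i \<le> n \<Longrightarrow> A i 0 = 1"
  shows "fdet (Suc n) A = fdet n (\<lambda>i j. A (Suc i) (Suc j) - A i (Suc j))"
proof -
  define L where "L i k = (if k = i then 1 else if Suc k = i then -1 else 0 :: 'a)" for i k :: nat
  define B where "B i j = (\<Sum>k<Suc n. L i k * A k j)" for i j
  have B0: "B 0 j = A 0 j" for j
    unfolding B_def L_def by (subst sum.mono_neutral_right[of _ "{0}"]) auto
  have BS: "B (Suc i) j = A (Suc i) j - A i j" if "i < n" for i j
    unfolding B_def L_def using that by (subst sum.mono_neutral_right[of _ "{i, Suc i}"]) auto
  have "fdet (Suc n) A = fdet (Suc n) L * fdet (Suc n) A"
    unfolding L_def fdet_bidiagonal by simp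
  also have "\<dots> = fdet (Suc n) B"
    unfolding B_def by (rule fdet_mult[symmetric])
  also have "\<dots> = fdet (Suc n) (\<lambda>i j. B j i)"
    by (rule fdet_transpose[symmetric])
  also have "\<dots> = B 0 0 * fdet n (\<lambda>i j. B (Suc j) (Suc i))"
    using assms by (intro fdet_expand_first_row_unit) (simp add: BS)
  also have "fdet n (\<lambda>i j. B (Suc j) (Suc i)) = fdet n (\<lambda>i j. B (Suc i) (Suc j))"
    by (rule fdet_transpose)
  also have "\<dots> = fdet n (\<lambda>i j. A (Suc i) (Suc j) - A i (Suc j))"
    by (intro fdet_cong) (auto simp: BS)
  finally show ?thesis using assms[of 0] by (simp add: B0)
qed

text \<open>Beyond order 1, comparing \<open>x 0\<close> with \<open>y 0\<close> and
  \<open>y 1\<close> leaves three possibilities: the first row vanishes, the first two columns both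
  consist of ones, or the first row is a unit vector and the induction continues with the
  complementary minor.\<close>

lemma fdet_staircase_nonneg:
  fixes x y :: "nat \<Rightarrow> real"
  assumes "strict_mono_on {..<n} x" "strict_mono_on {..<n} y"
  shows "0 \<le> fdet n (\<lambda>i j. if y j \<le> x i then 1 else 0 :: real)"
  using assms
proof (induction n arbitrary: x y)
  case (Suc n)
  let ?A = "\<lambda>i j. if y j \<le> x i then 1 else 0 :: real"
  have mono: "x i < x j" "y i < y j" if "i < j" "j < Suc n" for i j
    using Suc.prems that by (auto simp: strict_mono_on_def)
  consider "x 0 < y 0" | "n = 0" | "y 1 \<le> x 0" "n > 0" | "x 0 < y 1" "y 0 \<le> x 0" "n > 0" by linarith
  then show ?case
  proof cases
    case 1
    then have "\<not> y j \<le> x 0" if "j < Suc n" for j using mono(2)[of 0 j] that by (cases "j = 0") auto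
    then have "fdet (Suc n) ?A = 0" by (intro fdet_zero_row[of 0]) auto
    then show ?thesis by simp
  next
    case 2
    then show ?thesis by simp
  next
    case 3
    have "y 0 \<le> x i \<and> y 1 \<le> x i" if "i < Suc n" for i
      using 3 mono(1)[of 0 i] mono(2)[of 0 1] that by (cases "i = 0") auto
    then have "fdet (Suc n) ?A = 0" using 3 by (intro fdet_identical_cols[of 0 1]) auto
    then show ?thesis by simp
  next
    case 4
    have "\<not> y (Suc j) \<le> x 0" if "j < n" for j
      using 4 mono(2)[of 1 "Suc j"] that by (cases j) auto
    then have "fdet (Suc n) ?A = ?A 0 0 * fdet n (\<lambda>i j. if y (Suc j) \<le> x (Suc i) then 1 else 0)"
      by (intro fdet_expand_first_row_unit) auto
    also have "0 \<le> \<dots>"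
      using Suc.prems by (intro mult_nonneg_nonneg Suc.IH) (auto simp: strict_mono_on_def)
    finally show ?thesis .
  qed
qed simp

section \<open>Truncated powers\<close>

text \<open>The value at 0 is 0 even for exponent 0, so \<open>gamma_density 1\<close> differs from
  \<open>lambda1\<close> at that point.\<close>

definition trunc_pow :: "real \<Rightarrow> real \<Rightarrow> real" where
  "trunc_pow \<beta> x = (if 0 < x then x powr \<beta> else 0)"

lemma trunc_pow_nonneg: "0 \<le> trunc_pow \<beta> x"
  by (simp add: trunc_pow_def)

lemma trunc_pow_mult: "0 < c \<Longrightarrow> trunc_pow \<beta> (c * x) = c powr \<beta> * trunc_pow \<beta> x"
  by (simp add: trunc_pow_def powr_mult zero_less_mult_iff)

lemma trunc_pow_has_derivative:
  assumes "\<beta> > 1"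
  shows "(trunc_pow \<beta> has_real_derivative \<beta> * trunc_pow (\<beta> - 1) x) (at x)"
proof -
  consider "x > 0" | "x < 0" | "x = 0" by linarith
  then show ?thesis
  proof cases
    case 1
    have "((\<lambda>x. x powr \<beta>) has_real_derivative \<beta> * trunc_pow (\<beta> - 1) x) (at x)"
      using 1 by (auto intro!: derivative_eq_intros simp: trunc_pow_def)
    then show ?thesis
      by (rule has_field_derivative_transform_within_open[of _ _ _ "{0<..}"])
        (use 1 in \<open>auto simp: trunc_pow_def\<close>)
  next
    case 2
    have "((\<lambda>x. 0) has_real_derivative \<beta> * trunc_pow (\<beta> - 1) x) (at x)"
      using 2 by (auto simp: trunc_pow_def)
    then show ?thesis
      by (rule has_field_derivative_transform_within_open[of _ _ _ "{..<0}"])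
        (use 2 in \<open>auto simp: trunc_pow_def\<close>)
  next
    case 3
    \<comment> \<open>At 0 the difference quotient of \<open>trunc_pow \<beta>\<close> is
      \<open>trunc_pow (\<beta> - 1)\<close> itself, and \<beta> > 1 makes it tend to 0.\<close>
    have "((\<lambda>h. trunc_pow (\<beta> - 1) h) \<longlongrightarrow> 0) (at 0)"
    proof (rule Lim_null_comparison)
      show "\<forall>\<^sub>F h in at 0. norm (trunc_pow (\<beta> - 1) h) \<le> \<bar>h\<bar> powr (\<beta> - 1)"
        by (auto simp: trunc_pow_def)
      show "((\<lambda>h::real. \<bar>h\<bar> powr (\<beta> - 1)) \<longlongrightarrow> 0) (at 0)"
        by (rule tendsto_eq_intros refl | use assms in simp)+
    qed
    moreover have "trunc_pow (\<beta> - 1) h = (trunc_pow \<beta> (0 + h) - trunc_pow \<beta> 0) / h" for h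
      by (auto simp: trunc_pow_def powr_diff)
    ultimately show ?thesis
      unfolding DERIV_def 3 by (simp add: trunc_pow_def)
  qed
qed

text \<open>Extracting \<open>(x i - y 0) powr \<beta>\<close> from row \<open>i\<close> turns the
  first column into ones and the entries into truncated powers of \<open>1 - d j * z i\<close>.
  Differences of consecutive rows and the mean value theorem then leave a determinant of the same
  shape, with order and exponent both lowered by one. At order 2 only monotonicity of the power is
  used, which is why order n + 2 goes with \<beta> > n.\<close>

lemma trunc_pow_TN_aux:
  assumes "\<beta> > real n" "strict_mono_on {..<n + 2} x" "strict_mono_on {..<n + 2} y"
  shows "0 \<le> fdet (n + 2) (\<lambda>i j. trunc_pow \<beta> (x i - y j))"
  using assms
proof (induction n arbitrary: \<beta> x y)
  case 0
  have xy: "x 0 < x 1" "y 0 < y 1" using 0 by (auto simp: strict_mono_on_def)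
  have "trunc_pow \<beta> (x 0 - y 1) * trunc_pow \<beta> (x 1 - y 0)
      \<le> trunc_pow \<beta> (x 0 - y 0) * trunc_pow \<beta> (x 1 - y 1)"
  proof (cases "x 0 - y 1 > 0")
    case True
    have "(x 0 - y 1) * (x 1 - y 0) \<le> (x 0 - y 0) * (x 1 - y 1)"
      using mult_pos_pos[of "x 1 - x 0" "y 1 - y 0"] xy by (simp add: algebra_simps)
    then have "((x 0 - y 1) * (x 1 - y 0)) powr \<beta> \<le> ((x 0 - y 0) * (x 1 - y 1)) powr \<beta>"
      using True xy 0 by (intro powr_mono2) auto
    then show ?thesis using True xy by (simp add: trunc_pow_def powr_mult)
  next
    case False
    then show ?thesis by (simp add: trunc_pow_def)
  qed
  then show ?case using fdet_2[of "\<lambda>i j. trunc_pow \<beta> (x i - y j)"] by (simp add: numeral_2_eq_2)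
next
  case (Suc n)
  define k where "k = n + 2"
  have k: "Suc n + 2 = Suc k" by (simp add: k_def)
  have mono: "x i < x j" "y i < y j" if "i < j" "j \<le> k" for i j
    using Suc.prems that by (auto simp: strict_mono_on_def k_def)
  show ?case
  proof (cases "x 0 \<le> y 0")
    case True
    have "trunc_pow \<beta> (x 0 - y j) = 0" if "j \<le> k" for j
      using True mono(2)[of 0 j] that by (cases "j = 0") (auto simp: trunc_pow_def)
    then have "fdet (Suc k) (\<lambda>i j. trunc_pow \<beta> (x i - y j)) = 0"
      by (intro fdet_zero_row[of 0]) auto
    then show ?thesis unfolding k by simp
  next
    case False
    define d where "d j = y j - y 0" for j
    define z where "z i = 1 / (x i - y 0)" for i
    have pos: "x i - y 0 > 0" if "i \<le> k" for i
      using False mono(1)[of 0 i] that by (cases "i = 0") auto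
    have z: "z (Suc i) < z i" "0 < z (Suc i)" if "i < k" for i
      using pos[of i] pos[of "Suc i"] mono(1)[of i "Suc i"] that
      by (auto simp: z_def intro!: divide_strict_left_mono)
    have d: "0 < d (Suc j)" if "j < k" for j using mono(2)[of 0 "Suc j"] that by (simp add: d_def)
    have eq: "trunc_pow \<beta> (x i - y j) = (x i - y 0) powr \<beta> * 1 * trunc_pow \<beta> (1 - d j * z i)"
      if "i \<le> k" for i j
      using pos[OF that]
      by (subst mult_1_right, subst trunc_pow_mult[symmetric])
         (auto simp: d_def z_def field_simps intro!: arg_cong[where f = "trunc_pow \<beta>"])
    \<comment> \<open>As \<open>z\<close> decreases, the mean value theorem is applied from
      \<open>z (Suc i)\<close> up to \<open>z i\<close>; the minus sign makes up for the reversed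
      direction of the row difference.\<close>
    define K where "K t j = - trunc_pow \<beta> (1 - d (Suc j) * t)" for t j
    define K' where "K' t j = \<beta> * d (Suc j) * trunc_pow (\<beta> - 1) (1 - d (Suc j) * t)" for t j
    have "((\<lambda>t. K t j) has_real_derivative K' t j) (at t)" for t j
    proof -
      have "((\<lambda>t. - trunc_pow \<beta> (1 - d (Suc j) * t)) has_real_derivative
          - (\<beta> * trunc_pow (\<beta> - 1) (1 - d (Suc j) * t) * (- d (Suc j)))) (at t)"
        using Suc.prems(1)
        by (intro DERIV_minus DERIV_chain2[OF trunc_pow_has_derivative]) (auto intro!: derivative_eq_intros)
      then show ?thesis by (simp add: K_def K'_def mult_ac)
    qed
    then obtain \<zeta> where \<zeta>: "\<And>i. i < k \<Longrightarrow> z (Suc i) < \<zeta> i \<and> \<zeta> i < z i"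
      "fdet k (\<lambda>i j. K (z i) j - K (z (Suc i)) j)
        = (\<Prod>i<k. z i - z (Suc i)) * fdet k (\<lambda>i j. K' (\<zeta> i) j)"
      using fdet_row_mvt[of k "\<lambda>i. z (Suc i)" z K K'] z(1) by blast
    have \<zeta>0: "0 < \<zeta> i" if "i < k" for i using \<zeta>(1)[OF that] z(2)[OF that] by linarith
    \<comment> \<open>The mean value points lie in disjoint intervals between consecutive terms of
      the decreasing sequence \<open>z\<close>, so their reciprocals increase and can serve as the
      new points.\<close>
    have \<zeta>_less: "\<zeta> j < \<zeta> i" if "i < j" "j < k" for i j
    proof -
      have "z j \<le> z (Suc i)"
        using that mono(1)[of "Suc i" j] pos[of "Suc i"] unfolding z_def
        by (cases "j = Suc i") (auto intro!: divide_left_mono mult_pos_pos)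
      then show ?thesis using \<zeta>(1)[of i] \<zeta>(1)[of j] that by linarith
    qed
    have "fdet (Suc k) (\<lambda>i j. trunc_pow \<beta> (x i - y j)) =
        fdet (Suc k) (\<lambda>i j. (x i - y 0) powr \<beta> * 1 * trunc_pow \<beta> (1 - d j * z i))"
      by (intro fdet_cong refl eq) simp
    also have "\<dots> = (\<Prod>i<Suc k. (x i - y 0) powr \<beta>) * (\<Prod>i<Suc k. 1) *
        fdet (Suc k) (\<lambda>i j. trunc_pow \<beta> (1 - d j * z i))"
      by (rule fdet_scale)
    also have "fdet (Suc k) (\<lambda>i j. trunc_pow \<beta> (1 - d j * z i)) =
        fdet k (\<lambda>i j. trunc_pow \<beta> (1 - d (Suc j) * z (Suc i)) - trunc_pow \<beta> (1 - d (Suc j) * z i))"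
      by (rule fdet_first_col_one) (simp add: d_def trunc_pow_def)
    also have "\<dots> = fdet k (\<lambda>i j. K (z i) j - K (z (Suc i)) j)"
      by (simp add: K_def)
    also have "\<dots> = (\<Prod>i<k. z i - z (Suc i)) * fdet k (\<lambda>i j. K' (\<zeta> i) j)" by (rule \<zeta>(2))
    also have "fdet k (\<lambda>i j. K' (\<zeta> i) j) =
        fdet k (\<lambda>i j. \<zeta> i powr (\<beta> - 1) * (\<beta> * d (Suc j)) * trunc_pow (\<beta> - 1) (1 / \<zeta> i - d (Suc j)))"
    proof (intro fdet_cong refl)
      fix i j assume "i < k"
      have "1 - d (Suc j) * \<zeta> i = \<zeta> i * (1 / \<zeta> i - d (Suc j))"
        using \<zeta>0[OF \<open>i < k\<close>] by (simp add: field_simps)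
      then show "K' (\<zeta> i) j = \<zeta> i powr (\<beta> - 1) * (\<beta> * d (Suc j)) * trunc_pow (\<beta> - 1) (1 / \<zeta> i - d (Suc j))"
        by (simp add: K'_def trunc_pow_mult \<zeta>0[OF \<open>i < k\<close>])
    qed
    also have "\<dots> = (\<Prod>i<k. \<zeta> i powr (\<beta> - 1)) * (\<Prod>j<k. \<beta> * d (Suc j)) *
        fdet k (\<lambda>i j. trunc_pow (\<beta> - 1) (1 / \<zeta> i - d (Suc j)))"
      by (rule fdet_scale)
    finally have *: "fdet (Suc k) (\<lambda>i j. trunc_pow \<beta> (x i - y j)) =
        (\<Prod>i<Suc k. (x i - y 0) powr \<beta>) * (\<Prod>i<Suc k. 1) *
        ((\<Prod>i<k. z i - z (Suc i)) * ((\<Prod>i<k. \<zeta> i powr (\<beta> - 1)) * (\<Prod>j<k. \<beta> * d (Suc j)) *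
        fdet k (\<lambda>i j. trunc_pow (\<beta> - 1) (1 / \<zeta> i - d (Suc j)))))" .
    have "0 \<le> fdet (n + 2) (\<lambda>i j. trunc_pow (\<beta> - 1) (1 / \<zeta> i - d (Suc j)))"
    proof (rule Suc.IH)
      show "strict_mono_on {..<n + 2} (\<lambda>i. 1 / \<zeta> i)"
        using \<zeta>_less \<zeta>0 by (auto simp: strict_mono_on_def k_def intro!: divide_strict_left_mono)
      show "strict_mono_on {..<n + 2} (\<lambda>j. d (Suc j))"
        using mono(2) by (auto simp: strict_mono_on_def k_def d_def)
    qed (use Suc.prems(1) in simp)
    then have "0 \<le> fdet k (\<lambda>i j. trunc_pow (\<beta> - 1) (1 / \<zeta> i - d (Suc j)))" by (simp add: k_def)
    moreover have "0 \<le> \<beta>" using Suc.prems(1) by simp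
    ultimately show ?thesis
      unfolding k * using z(1) d
      by (intro mult_nonneg_nonneg prod_nonneg) (auto intro: less_imp_le)
  qed
qed

lemma binomial_remainder_tendsto:
  fixes \<beta> :: real
  shows "((\<lambda>z. ((1 - z) powr \<beta> - (\<Sum>k<n. (-1)^k * (\<beta> gchoose k) * z^k)) / z^n)
    \<longlongrightarrow> (-1)^n * (\<beta> gchoose n)) (at 0)"
proof -
  define a where "a m = (-1)^(m + n) * (\<beta> gchoose (m + n))" for m
  define f where "f z = ((1 - z) powr \<beta> - (\<Sum>k<n. (-1)^k * (\<beta> gchoose k) * z^k)) / z^n" for z
  have "(f \<longlongrightarrow> a 0) (at 0)"
  proof (rule powser_limit_0_strong[of 1])
    fix z :: real assume z: "z \<noteq> 0" "norm z < 1"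
    have "(\<lambda>m. (\<beta> gchoose m) * (-z)^m) sums (1 + - z) powr \<beta>"
      using z by (intro gen_binomial_real) auto
    then have "(\<lambda>m. (\<beta> gchoose (m + n)) * (-z)^(m + n)) sums
        ((1 + - z) powr \<beta> - (\<Sum>k<n. (\<beta> gchoose k) * (-z)^k))"
      by (subst sums_iff_shift) simp
    then have "(\<lambda>m. (\<beta> gchoose (m + n)) * (-z)^(m + n) / z^n) sums
        (((1 + - z) powr \<beta> - (\<Sum>k<n. (\<beta> gchoose k) * (-z)^k)) / z^n)"
      by (rule sums_divide)
    moreover have "(\<beta> gchoose (m + n)) * (-z)^(m + n) / z^n = a m * z^m" for m
      using z(1) by (subst power_minus) (simp add: a_def power_add field_simps)
    moreover have "((1 + - z) powr \<beta> - (\<Sum>k<n. (\<beta> gchoose k) * (-z)^k)) / z^n = f z"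
      unfolding f_def by (subst power_minus) (simp add: mult_ac)
    ultimately show "(\<lambda>m. a m * z^m) sums f z" by simp
  qed simp
  then show ?thesis by (simp add: a_def f_def[abs_def])
qed

text \<open>Vandermonde's determinant: a kernel vector would consist of the coefficients of a
  nonzero polynomial of degree below \<open>n\<close> with \<open>n\<close> distinct roots.\<close>

lemma fdet_powers_nonzero:
  fixes u :: "nat \<Rightarrow> real"
  assumes "inj_on u {..<n}"
  shows "fdet n (\<lambda>i k. u i ^ k) \<noteq> 0"
proof
  assume "fdet n (\<lambda>i k. u i ^ k) = 0"
  then obtain v l where v: "l < n" "v l \<noteq> 0" "\<And>i. i < n \<Longrightarrow> (\<Sum>j<n. u i ^ j * v j) = 0"
    unfolding fdet_eq_0_iff by blast
  define q where "q = (\<Sum>j<n. Polynomial.monom (v j) j)"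
  have coeff: "poly.coeff q j = (if j < n then v j else 0)" for j
    by (simp add: q_def coeff_sum)
  have "q \<noteq> 0" using v(1,2) coeff[of l] by auto
  have "u ` {..<n} \<subseteq> {x. poly q x = 0}"
    using v(3) by (auto simp: q_def poly_sum poly_monom mult.commute)
  then have "card (u ` {..<n}) \<le> card {x. poly q x = 0}"
    using poly_roots_finite[OF \<open>q \<noteq> 0\<close>] by (rule card_mono[rotated])
  also have "\<dots> \<le> degree q" by (rule card_poly_roots_bound[OF \<open>q \<noteq> 0\<close>])
  also have "degree q < n"
    using v(1) coeff by (intro degree_lessI) auto
  finally show False using assms by (simp add: card_image)
qed

lemma fdet_left_inverse:
  fixes A :: "nat \<Rightarrow> nat \<Rightarrow> 'a :: field"
  assumes "fdet n A \<noteq> 0"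
  shows "\<exists>B. \<forall>l<n. \<forall>k<n. (\<Sum>i<n. B l i * A i k) = (if l = k then 1 else 0)"
proof -
  let ?A = "Matrix.mat n n (\<lambda>(i, j). A i j)"
  have adj: "adj_mat ?A \<in> carrier_mat n n" "adj_mat ?A * ?A = Determinant.det ?A \<cdot>\<^sub>m 1\<^sub>m n"
    by (rule adj_mat[of _ n]; simp)+
  have "(\<Sum>i<n. adj_mat ?A $$ (l, i) / fdet n A * A i k) = (if l = k then 1 else 0)"
    if "l < n" "k < n" for l k
  proof -
    have "(\<Sum>i<n. adj_mat ?A $$ (l, i) * A i k) = (adj_mat ?A * ?A) $$ (l, k)"
      using that adj(1) by (simp add: scalar_prod_def atLeast0LessThan)
    also have "\<dots> = (if l = k then fdet n A else 0)"
      unfolding adj(2) using that by (simp add: fdet_def)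
    finally show ?thesis
      using assms by (simp add: sum_divide_distrib[symmetric])
  qed
  then show ?thesis by (intro exI[of _ "\<lambda>l i. adj_mat ?A $$ (l, i) / fdet n A"]) blast
qed

text \<open>Multiplying by the inverse \<open>B\<close> of the Vandermonde matrix of
  \<open>u\<close> isolates in row \<open>l\<close> the term of degree \<open>l\<close> of the
  binomial series. Row \<open>l\<close> then has order \<open>\<epsilon>^l\<close>, which the
  denominator cancels, and the determinant of \<open>B\<close> is compensated by
  \<open>U\<close>.\<close>

lemma binomial_kernel_fdet_tendsto:
  fixes u v :: "nat \<Rightarrow> real"
  assumes inj: "inj_on u {..<n}" and u: "\<And>i. i < n \<Longrightarrow> 0 < u i" and v: "\<And>j. j < n \<Longrightarrow> 0 < v j"
  shows "((\<lambda>\<epsilon>. fdet n (\<lambda>i j. (1 - \<epsilon> * u i * v j) powr \<beta>) / (\<Prod>l<n. \<epsilon>^l)) \<longlongrightarrow>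
    fdet n (\<lambda>i k. u i ^ k) * ((\<Prod>l<n. (-1)^l * (\<beta> gchoose l)) * fdet n (\<lambda>l j. v j ^ l))) (at_right 0)"
proof -
  define c where "c l = (-1)^l * (\<beta> gchoose l)" for l
  define g where "g z = ((1 - z) powr \<beta> - (\<Sum>k<n. c k * z^k)) / z^n" for z
  have g: "(g \<longlongrightarrow> c n) (at 0)"
    using binomial_remainder_tendsto[of \<beta> n] unfolding g_def[abs_def] c_def by simp
  define U where "U = fdet n (\<lambda>i k. u i ^ k)"
  have "U \<noteq> 0" unfolding U_def by (rule fdet_powers_nonzero[OF inj])
  then obtain B where B: "\<And>l k. l < n \<Longrightarrow> k < n \<Longrightarrow> (\<Sum>i<n. B l i * u i ^ k) = (if l = k then 1 else 0)"
    using fdet_left_inverse[of n "\<lambda>i k. u i ^ k"] unfolding U_def by blast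
  have BU: "U * fdet n B = 1"
  proof -
    have "fdet n B * U = fdet n (\<lambda>l k. \<Sum>i<n. B l i * u i ^ k)"
      unfolding U_def by (rule fdet_mult[symmetric])
    also have "\<dots> = fdet n (\<lambda>l k. if l = k then 1 else 0)"
      by (intro fdet_cong refl B)
    also have "\<dots> = 1" by (simp add: fdet_diag)
    finally show ?thesis by (simp add: mult.commute)
  qed
  \<comment> \<open>The factor \<open>\<epsilon>^l\<close> is already taken out; the remainder of
    order \<open>n\<close> keeps the power \<open>\<epsilon>^(n - l)\<close>, whose exponent is
    positive, and so disappears in the limit.\<close>
  define W where "W \<epsilon> l j = c l * v j ^ l + \<epsilon>^(n - l) * (\<Sum>i<n. B l i * ((u i * v j)^n * g (\<epsilon> * u i * v j)))"
    for \<epsilon> l j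
  have eq: "fdet n (\<lambda>i j. (1 - \<epsilon> * u i * v j) powr \<beta>) / (\<Prod>l<n. \<epsilon>^l) = U * fdet n (W \<epsilon>)"
    if "\<epsilon> > 0" for \<epsilon>
  proof -
    have expand: "(1 - \<epsilon> * u i * v j) powr \<beta> = (\<Sum>k<n. c k * (\<epsilon> * u i * v j)^k) +
        (\<epsilon> * u i * v j)^n * g (\<epsilon> * u i * v j)" if "i < n" "j < n" for i j
      using u[OF that(1)] v[OF that(2)] \<open>\<epsilon> > 0\<close> by (simp add: g_def)
    have "(\<Sum>i<n. B l i * (1 - \<epsilon> * u i * v j) powr \<beta>) = \<epsilon>^l * 1 * W \<epsilon> l j" if "l < n" "j < n" for l j
    proof -
      have "(\<Sum>i<n. B l i * (1 - \<epsilon> * u i * v j) powr \<beta>) =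
          (\<Sum>i<n. \<Sum>k<n. c k * (\<epsilon> * v j)^k * (B l i * u i ^ k)) +
          (\<Sum>i<n. \<epsilon>^n * (B l i * ((u i * v j)^n * g (\<epsilon> * u i * v j))))"
        unfolding sum.distrib[symmetric]
      proof (intro sum.cong refl)
        fix i assume "i \<in> {..<n}"
        then have "B l i * (1 - \<epsilon> * u i * v j) powr \<beta> = B l i * ((\<Sum>k<n. c k * (\<epsilon> * u i * v j)^k) +
            (\<epsilon> * u i * v j)^n * g (\<epsilon> * u i * v j))"
          using that(2) by (subst expand) auto
        then show "B l i * (1 - \<epsilon> * u i * v j) powr \<beta> = (\<Sum>k<n. c k * (\<epsilon> * v j)^k * (B l i * u i ^ k)) +
            \<epsilon>^n * (B l i * ((u i * v j)^n * g (\<epsilon> * u i * v j)))"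
          by (simp add: distrib_left sum_distrib_left power_mult_distrib mult_ac)
      qed
      also have "(\<Sum>i<n. \<Sum>k<n. c k * (\<epsilon> * v j)^k * (B l i * u i ^ k)) =
          (\<Sum>k<n. c k * (\<epsilon> * v j)^k * (\<Sum>i<n. B l i * u i ^ k))"
        unfolding sum_distrib_left by (rule sum.swap)
      also have "\<dots> = (\<Sum>k<n. if l = k then c k * (\<epsilon> * v j)^k else 0)"
        using that by (intro sum.cong refl) (simp add: B)
      also have "\<dots> = c l * (\<epsilon> * v j)^l" using that by simp
      also have "(\<Sum>i<n. \<epsilon>^n * (B l i * ((u i * v j)^n * g (\<epsilon> * u i * v j)))) =
          \<epsilon>^l * (\<epsilon>^(n - l) * (\<Sum>i<n. B l i * ((u i * v j)^n * g (\<epsilon> * u i * v j))))"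
        using that by (simp add: sum_distrib_left mult.assoc[symmetric] power_add[symmetric])
      finally show ?thesis by (simp add: W_def power_mult_distrib algebra_simps)
    qed
    then have "fdet n (\<lambda>l j. \<Sum>i<n. B l i * (1 - \<epsilon> * u i * v j) powr \<beta>) = fdet n (\<lambda>l j. \<epsilon>^l * 1 * W \<epsilon> l j)"
      by (intro fdet_cong refl)
    also have "\<dots> = (\<Prod>l<n. \<epsilon>^l) * (\<Prod>j<n. 1) * fdet n (W \<epsilon>)" by (rule fdet_scale)
    finally have "fdet n B * fdet n (\<lambda>i j. (1 - \<epsilon> * u i * v j) powr \<beta>) = (\<Prod>l<n. \<epsilon>^l) * fdet n (W \<epsilon>)"
      by (simp add: fdet_mult)
    then have "U * fdet n B * fdet n (\<lambda>i j. (1 - \<epsilon> * u i * v j) powr \<beta>) = (\<Prod>l<n. \<epsilon>^l) * (U * fdet n (W \<epsilon>))"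
      by (simp add: mult_ac)
    moreover have "(\<Prod>l<n. \<epsilon>^l) \<noteq> 0" using that by simp
    ultimately show ?thesis unfolding BU using that by (simp add: field_simps)
  qed
  have W: "((\<lambda>\<epsilon>. W \<epsilon> l j) \<longlongrightarrow> c l * v j ^ l) (at_right 0)" if "l < n" "j < n" for l j
  proof -
    have "((\<lambda>\<epsilon>. g (\<epsilon> * u i * v j)) \<longlongrightarrow> c n) (at_right 0)" if "i < n" for i
    proof (rule filterlim_compose[OF g])
      have "((\<lambda>\<epsilon>. \<epsilon> * u i * v j) \<longlongrightarrow> 0 * u i * v j) (at_right 0)" by (intro tendsto_intros)
      moreover have "\<forall>\<^sub>F \<epsilon> in at_right 0. \<epsilon> * u i * v j \<noteq> 0"
        using u[OF that] v[OF \<open>j < n\<close>] eventually_at_right_less[of "0::real"] by (auto elim!: eventually_mono)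
      ultimately show "filterlim (\<lambda>\<epsilon>. \<epsilon> * u i * v j) (at 0) (at_right 0)"
        by (simp add: filterlim_at)
    qed
    then have "((\<lambda>\<epsilon>. W \<epsilon> l j) \<longlongrightarrow> c l * v j ^ l + 0^(n - l) * (\<Sum>i<n. B l i * ((u i * v j)^n * c n))) (at_right 0)"
      unfolding W_def by (intro tendsto_intros) auto
    moreover have "(0 :: real)^(n - l) = 0" using that by simp
    ultimately show ?thesis by simp
  qed
  have "((\<lambda>\<epsilon>. U * fdet n (W \<epsilon>)) \<longlongrightarrow> U * fdet n (\<lambda>l j. c l * v j ^ l)) (at_right 0)"
    by (intro tendsto_intros W)
  also have "fdet n (\<lambda>l j. c l * v j ^ l) = (\<Prod>l<n. c l) * fdet n (\<lambda>l j. v j ^ l)"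
    using fdet_scale[of n c "\<lambda>_. 1" "\<lambda>l j. v j ^ l"] by simp
  finally show ?thesis
    unfolding U_def[symmetric] c_def[symmetric]
    by (rule Lim_transform_eventually)
       (use eventually_at_right_less[of "0::real"] eq in \<open>auto elim!: eventually_mono simp: c_def\<close>)
qed

text \<open>Scaling the points \<open>y j\<close> down to zero leaves the product of the first \<open>n\<close> binomial
  coefficients as the leading coefficient; its sign is compared with that for a large exponent.\<close>

lemma trunc_pow_not_TN:
  assumes "real k < \<beta>" "\<beta> < real k + 1"
  shows "\<exists>x y. strict_mono_on {..<k + 3} x \<and> strict_mono_on {..<k + 3} y \<and>
    fdet (k + 3) (\<lambda>i j. trunc_pow \<beta> (x i - y j)) < 0"
proof (rule ccontr)
  assume "\<not> ?thesis"
  then have nonneg: "0 \<le> fdet (k + 3) (\<lambda>i j. trunc_pow \<beta> (x i - y j))"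
    if "strict_mono_on {..<k + 3} x" "strict_mono_on {..<k + 3} y" for x y
    using that by (auto simp: not_less)
  define n where "n = k + 3"
  \<comment> \<open>The points will be i + 1 and \<open>\<epsilon> * v j\<close>; taking the power
    of i + 1 out of row \<open>i\<close> leaves the binomial kernel, with \<open>u i\<close> the
    reciprocal of i + 1.\<close>
  define u v :: "nat \<Rightarrow> real" where "u i = 1 / (real i + 1)" and "v j = real j + 1" for i j
  \<comment> \<open>\<open>D\<close> collects what does not depend on the exponent. Its sign is
    found below from the exponent \<open>n\<close>, for which the minors of order \<open>n\<close>
    are nonnegative and all the binomial coefficients positive.\<close>
  define D where "D = fdet n (\<lambda>i k. u i ^ k) * fdet n (\<lambda>l j. v j ^ l) * (\<Prod>l<n. (-1)^l)"
  have limit: "0 \<le> D * (\<Prod>l<n. b gchoose l)"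
    if TN: "\<And>x y. strict_mono_on {..<n} x \<Longrightarrow> strict_mono_on {..<n} y \<Longrightarrow>
              0 \<le> fdet n (\<lambda>i j. trunc_pow b (x i - y j))" for b
  proof -
    have "0 \<le> fdet n (\<lambda>i k. u i ^ k) * ((\<Prod>l<n. (-1)^l * (b gchoose l)) * fdet n (\<lambda>l j. v j ^ l))"
    proof (rule tendsto_lowerbound[OF binomial_kernel_fdet_tendsto])
      show "inj_on u {..<n}" by (auto simp: inj_on_def u_def)
      show "\<forall>\<^sub>F \<epsilon> in at_right 0. 0 \<le> fdet n (\<lambda>i j. (1 - \<epsilon> * u i * v j) powr b) / (\<Prod>l<n. \<epsilon>^l)"
      proof (rule eventually_mono[OF eventually_at_right_real[of 0 "1 / real n"]])
        fix \<epsilon> assume "\<epsilon> \<in> {0<..<1 / real n}"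
        then have \<epsilon>: "0 < \<epsilon>" "\<epsilon> * n < 1" by (auto simp: n_def field_simps)
        have eq: "trunc_pow b ((real i + 1) - \<epsilon> * v j) = (real i + 1) powr b * 1 * (1 - \<epsilon> * u i * v j) powr b"
          if "j < n" for i j
        proof -
          have "\<epsilon> * v j \<le> \<epsilon> * n" using that \<epsilon>(1) by (intro mult_left_mono) (auto simp: v_def)
          then have "\<epsilon> * v j < 1" using \<epsilon>(2) by (rule le_less_trans)
          moreover have "\<epsilon> * u i * v j \<le> \<epsilon> * v j" using \<epsilon>(1) by (simp add: u_def v_def field_simps)
          ultimately have pos: "1 - \<epsilon> * u i * v j > 0" by simp
          have "(real i + 1) - \<epsilon> * v j = (real i + 1) * (1 - \<epsilon> * u i * v j)"
            by (simp add: u_def field_simps)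
          then show ?thesis using pos by (simp add: trunc_pow_mult) (simp add: trunc_pow_def)
        qed
        have "0 \<le> fdet n (\<lambda>i j. trunc_pow b ((real i + 1) - \<epsilon> * v j))"
          using \<epsilon>(1) by (intro TN) (auto simp: strict_mono_on_def v_def)
        also have "\<dots> = fdet n (\<lambda>i j. (real i + 1) powr b * 1 * (1 - \<epsilon> * u i * v j) powr b)"
          by (intro fdet_cong refl eq)
        also have "\<dots> = (\<Prod>i<n. (real i + 1) powr b) * (\<Prod>j<n. 1) * fdet n (\<lambda>i j. (1 - \<epsilon> * u i * v j) powr b)"
          by (rule fdet_scale)
        finally have "0 \<le> (\<Prod>i<n. (real i + 1) powr b) * fdet n (\<lambda>i j. (1 - \<epsilon> * u i * v j) powr b)"
          by simp
        moreover have "(\<Prod>i<n. (real i + 1) powr b) > 0" by (intro prod_pos) auto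
        ultimately show "0 \<le> fdet n (\<lambda>i j. (1 - \<epsilon> * u i * v j) powr b) / (\<Prod>l<n. \<epsilon>^l)"
          using \<epsilon>(1) by (intro divide_nonneg_nonneg prod_nonneg) (auto simp: zero_le_mult_iff)
      qed (simp add: n_def)
    qed (auto simp: u_def v_def)
    then show ?thesis by (simp add: D_def prod.distrib mult_ac)
  qed
  have "0 \<le> D * (\<Prod>l<n. real n gchoose l)"
  proof (rule limit)
    fix x y :: "nat \<Rightarrow> real" assume "strict_mono_on {..<n} x" "strict_mono_on {..<n} y"
    then show "0 \<le> fdet n (\<lambda>i j. trunc_pow (real n) (x i - y j))"
      using trunc_pow_TN_aux[of "k + 1" "real n" x y] by (simp add: n_def numeral_eq_Suc)
  qed
  moreover have "(\<Prod>l<n. real n gchoose l) > 0"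
    by (intro prod_pos) (auto simp: binomial_gbinomial[symmetric])
  ultimately have "0 \<le> D" by (simp add: zero_le_mult_iff)
  moreover have "D \<noteq> 0"
  proof -
    have "fdet n (\<lambda>i k. u i ^ k) \<noteq> 0" by (rule fdet_powers_nonzero) (auto simp: inj_on_def u_def)
    moreover have "fdet n (\<lambda>i k. v i ^ k) \<noteq> 0" by (rule fdet_powers_nonzero) (auto simp: inj_on_def v_def)
    ultimately show ?thesis
      unfolding D_def using fdet_transpose[of n "\<lambda>i k. v i ^ k"] by simp
  qed
  ultimately have "D > 0" by simp
  have "0 \<le> D * (\<Prod>l<n. \<beta> gchoose l)"
    by (rule limit) (simp add: n_def nonneg)
  then have "0 \<le> (\<Prod>l<n. \<beta> gchoose l)" using \<open>D > 0\<close> by (simp add: zero_le_mult_iff)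
  moreover have "(\<Prod>l<n. \<beta> gchoose l) < 0"
  proof -
    \<comment> \<open>With k < \<beta> < k + 1 the numerators \<beta> - i are positive for i \<le> k
      and negative for i = k + 1, which enters only the last coefficient, l = k + 2.\<close>
    have "\<beta> gchoose l > 0" if "l < k + 2" for l
      unfolding gbinomial_prod_rev using that assms by (intro divide_pos_pos prod_pos) auto
    then have "(\<Prod>l<k + 2. \<beta> gchoose l) > 0" by (intro prod_pos) auto
    moreover have "\<beta> gchoose (k + 2) < 0"
    proof -
      have "(\<Prod>i = 0..<k + 1. \<beta> - real i) > 0" using assms by (intro prod_pos) auto
      moreover have "\<beta> - real (k + 1) < 0" using assms by simp
      ultimately have "(\<Prod>i = 0..<Suc (k + 1). \<beta> - real i) < 0"
        unfolding prod.atLeast0_lessThan_Suc by (rule mult_pos_neg)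
      then have "(\<Prod>i = 0..<Suc (k + 1). \<beta> - real i) / fact (k + 2) < 0"
        by (rule divide_neg_pos) simp
      then show ?thesis unfolding gbinomial_prod_rev by simp
    qed
    moreover have "(\<Prod>l<n. \<beta> gchoose l) = (\<Prod>l<k + 2. \<beta> gchoose l) * (\<beta> gchoose (k + 2))"
      by (simp add: n_def numeral_eq_Suc)
    ultimately show ?thesis by (simp add: mult_pos_neg)
  qed
  ultimately show False by simp
qed

section \<open>Totally nonnegative functions and convolution\<close>

lemma TN_iff_fdet:
  "TN p f \<longleftrightarrow> (\<forall>n\<in>{1..p}. \<forall>x y. strict_mono_on {..<n} x \<longrightarrow> strict_mono_on {..<n} y \<longrightarrow>
     0 \<le> fdet n (\<lambda>i j. f (x i - y j)))"
  unfolding TN_def fdet_def by simp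

lemma TN_fdet:
  assumes "TN p f" "n \<le> p" "strict_mono_on {..<n} x" "strict_mono_on {..<n} y"
  shows "0 \<le> fdet n (\<lambda>i j. f (x i - y j))"
  using assms by (cases "n = 0") (auto simp: TN_iff_fdet)

lemma TN_mono: "TN p f \<Longrightarrow> q \<le> p \<Longrightarrow> TN q f"
  by (auto simp: TN_iff_fdet)

lemma TN_nonneg:
  assumes "TN p f" "p \<ge> 1"
  shows "0 \<le> f t"
proof -
  have "strict_mono_on {..<1 :: nat} (\<lambda>_. c)" for c :: real by (auto simp: strict_mono_on_def)
  from TN_fdet[OF assms this[of t] this[of 0]] show ?thesis by simp
qed

text \<open>Log-concavity: the minor with rows s + h, t and columns 0, h shows that moving two
  points inwards by the same amount does not lower the product. For the extreme values of
  \<open>h\<close> the rows or the columns would coincide, but then both products are the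
  same.\<close>

lemma TN_2_interchange:
  assumes "TN p f" "p \<ge> 2" "0 \<le> h" "h \<le> t - s"
  shows "f s * f t \<le> f (s + h) * f (t - h)"
proof -
  consider "h = 0" | "h = t - s" | "0 < h" "h < t - s" using assms by linarith
  then show ?thesis
  proof cases
    case 3
    define x y where "x = (\<lambda>i :: nat. if i = 0 then s + h else t)" and "y = (\<lambda>i :: nat. if i = 0 then 0 else h)"
    have "0 \<le> fdet 2 (\<lambda>i j. f (x i - y j))"
      using 3 assms by (intro TN_fdet[OF assms(1,2)]) (auto simp: strict_mono_on_def x_def y_def)
    then show ?thesis by (simp add: fdet_2 x_def y_def mult.commute)
  qed (auto simp: mult.commute)
qed

text \<open>Rows and columns undergo the same reversal, so its sign enters squared. This serves
  reflections, which reverse the order of the points.\<close>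

lemma fdet_reverse:
  "fdet n (\<lambda>i j. A (n - 1 - i) (n - 1 - j)) = fdet n A"
proof -
  define r where "r i = (if i < n then n - 1 - i else i)" for i
  have r: "r permutes {..<n}"
    by (intro bij_imp_permutes bij_betwI[of _ _ _ r]) (auto simp: r_def)
  have "fdet n (\<lambda>i j. A (n - 1 - i) (n - 1 - j)) = fdet n (\<lambda>i j. A (r i) (r j))"
    by (intro fdet_cong) (auto simp: r_def)
  also have "\<dots> = of_int (sign r) * (of_int (sign r) * fdet n A)"
    using fdet_permute_rows[OF r, of "\<lambda>i j. A i (r j)"] fdet_permute_cols[OF r, of A] by simp
  also have "\<dots> = fdet n A" by (simp add: sign_def)
  finally show ?thesis .
qed

lemma TN_rescale:
  assumes "TN p f" "0 \<le> k" "c \<noteq> 0"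
  shows "TN p (\<lambda>x. k * f (x / c))"
  unfolding TN_iff_fdet
proof (intro ballI allI impI)
  fix n and x y :: "nat \<Rightarrow> real"
  assume n: "n \<in> {1..p}" and xy: "strict_mono_on {..<n} x" "strict_mono_on {..<n} y"
  have "0 \<le> fdet n (\<lambda>i j. f (x i / c - y j / c))"
  proof (cases "c > 0")
    case True
    then show ?thesis
      using n xy by (intro TN_fdet[OF assms(1)]) (auto simp: strict_mono_on_def divide_strict_right_mono)
  next
    case False
    then have "c < 0" using assms by simp
    then have "0 \<le> fdet n (\<lambda>i j. f (x (n - 1 - i) / c - y (n - 1 - j) / c))"
      using n xy by (intro TN_fdet[OF assms(1)])
        (auto simp: strict_mono_on_def intro!: divide_strict_right_mono_neg)
    then show ?thesis using fdet_reverse[of n "\<lambda>i j. f (x i / c - y j / c)"] by simp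
  qed
  moreover have "fdet n (\<lambda>i j. k * f ((x i - y j) / c)) = k ^ n * fdet n (\<lambda>i j. f (x i / c - y j / c))"
    using fdet_scale[of n "\<lambda>_. k" "\<lambda>_. 1" "\<lambda>i j. f (x i / c - y j / c)"] by (simp add: diff_divide_distrib)
  ultimately show "0 \<le> fdet n (\<lambda>i j. k * f ((x i - y j) / c))" using assms by simp
qed

lemma TN_mult_exp:
  assumes "TN p f"
  shows "TN p (\<lambda>x. exp (c * x) * f x)"
  unfolding TN_iff_fdet
proof (intro ballI allI impI)
  fix n and x y :: "nat \<Rightarrow> real"
  assume n: "n \<in> {1..p}" and xy: "strict_mono_on {..<n} x" "strict_mono_on {..<n} y"
  have "fdet n (\<lambda>i j. exp (c * (x i - y j)) * f (x i - y j)) =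
      fdet n (\<lambda>i j. exp (c * x i) * exp (- (c * y j)) * f (x i - y j))"
    by (simp add: exp_add[symmetric] algebra_simps)
  also have "\<dots> = (\<Prod>i<n. exp (c * x i)) * (\<Prod>j<n. exp (- (c * y j))) * fdet n (\<lambda>i j. f (x i - y j))"
    by (rule fdet_scale)
  also have "0 \<le> \<dots>"
    using n xy by (intro mult_nonneg_nonneg prod_nonneg TN_fdet[OF assms]) auto
  finally show "0 \<le> fdet n (\<lambda>i j. exp (c * (x i - y j)) * f (x i - y j))" .
qed

lemma TN_trunc_pow:
  assumes "\<beta> > real p - 2"
  shows "TN p (trunc_pow \<beta>)"
  unfolding TN_iff_fdet
proof (intro ballI allI impI)
  fix n and x y :: "nat \<Rightarrow> real"
  assume n: "n \<in> {1..p}" and xy: "strict_mono_on {..<n} x" "strict_mono_on {..<n} y"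
  consider "n = 1" | m where "n = m + 2" using n by (metis Nat.le_imp_diff_is_add Suc_1 atLeastAtMost_iff le_SucE le_antisym not_less_eq_eq One_nat_def)
  then show "0 \<le> fdet n (\<lambda>i j. trunc_pow \<beta> (x i - y j))"
  proof cases
    case 2
    then show ?thesis using trunc_pow_TN_aux[of m \<beta> x y] n xy assms by simp
  qed (simp add: trunc_pow_nonneg)
qed

lemma totally_nonneg_lambda1: "TN p lambda1"
  unfolding TN_iff_fdet
proof (intro ballI allI impI)
  fix n and x y :: "nat \<Rightarrow> real"
  assume n: "n \<in> {1..p}" and xy: "strict_mono_on {..<n} x" "strict_mono_on {..<n} y"
  have "fdet n (\<lambda>i j. lambda1 (x i - y j)) =
      fdet n (\<lambda>i j. exp (- x i) * exp (y j) * (if y j \<le> x i then 1 else 0))"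
    by (intro fdet_cong refl) (auto simp: lambda1_def exp_add[symmetric])
  also have "\<dots> = (\<Prod>i<n. exp (- x i)) * (\<Prod>j<n. exp (y j)) * fdet n (\<lambda>i j. if y j \<le> x i then 1 else 0)"
    by (rule fdet_scale)
  also have "0 \<le> \<dots>"
    using xy by (intro mult_nonneg_nonneg prod_nonneg fdet_staircase_nonneg) auto
  finally show "0 \<le> fdet n (\<lambda>i j. lambda1 (x i - y j))" .
qed

section \<open>Almost everywhere limits and convolutions\<close>

lemma ex_AE_in_interval:
  fixes a b :: real
  assumes "AE x in lborel. P x" "a < b"
  shows "\<exists>x. a < x \<and> x < b \<and> P x"
proof (rule ccontr)
  assume "\<not> ?thesis"
  then have "{a<..<b} \<subseteq> {x. \<not> P x}" by auto
  moreover obtain N where "{x \<in> space lborel. \<not> P x} \<subseteq> N" "N \<in> null_sets lborel"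
    by (rule AE_E[OF assms(1)]) (auto simp: null_sets_def)
  ultimately have "{a<..<b} \<in> null_sets lborel"
    by (intro null_sets_subset[of N lborel "{a<..<b}"]) auto
  then show False using assms(2) by (simp add: null_sets_def)
qed

lemma AE_lborel_translate:
  assumes "AE x in lborel. P (x :: real)"
  shows "AE x in lborel. P (x + c)"
proof -
  obtain N where N: "{x \<in> space lborel. \<not> P x} \<subseteq> N" "N \<in> null_sets lborel"
    by (rule AE_E[OF assms]) (auto simp: null_sets_def)
  have "AE x in lborel. c + 1 * x \<notin> N"
    using N(2) by (intro AE_borel_affine) (auto intro: AE_not_in)
  then show ?thesis
    by (rule eventually_mono) (use N(1) in \<open>auto simp: add.commute\<close>)
qed

text \<open>Almost every point avoids the exceptional sets of all translates by \<open>y j\<close>.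
  Hence each \<open>x i\<close> is approached from the right by points where all entries of its row
  converge; the minors are nonnegative there, and continuity of \<open>g\<close> removes the
  perturbation.\<close>

lemma TN_AE_limit:
  assumes TN: "\<And>m. TN p (f m)" and AE: "AE x in lborel. (\<lambda>m. f m x) \<longlonglongrightarrow> g x"
    and cont: "\<And>x. isCont g x"
  shows "TN p g"
  unfolding TN_iff_fdet
proof (intro ballI allI impI)
  fix n and x y :: "nat \<Rightarrow> real"
  assume n: "n \<in> {1..p}" and xy: "strict_mono_on {..<n} x" "strict_mono_on {..<n} y"
  have "\<exists>t. x i < t \<and> t < x i + 1 / real (Suc k) \<and> (\<forall>j\<in>{..<n}. (\<lambda>m. f m (t - y j)) \<longlonglongrightarrow> g (t - y j))" for i k
  proof (intro ex_AE_in_interval)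
    show "AE t in lborel. \<forall>j\<in>{..<n}. (\<lambda>m. f m (t - y j)) \<longlonglongrightarrow> g (t - y j)"
    proof (rule AE_ball_countable')
      fix j
      show "AE t in lborel. (\<lambda>m. f m (t - y j)) \<longlonglongrightarrow> g (t - y j)"
        using AE_lborel_translate[OF AE, of "- y j"] by simp
    qed auto
  qed simp
  then obtain X where X: "\<And>i k. x i < X i k" "\<And>i k. X i k < x i + 1 / real (Suc k)"
    "\<And>i k j. j < n \<Longrightarrow> (\<lambda>m. f m (X i k - y j)) \<longlonglongrightarrow> g (X i k - y j)"
    by (metis lessThan_iff)
  have lim: "X i \<longlonglongrightarrow> x i" for i
  proof (rule tendsto_sandwich[of "\<lambda>_. x i" _ _ "\<lambda>k. x i + 1 / real (Suc k)"])
    show "(\<lambda>k. x i + 1 / real (Suc k)) \<longlonglongrightarrow> x i"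
      using tendsto_add[OF tendsto_const[of "x i"] LIMSEQ_inverse_real_of_nat] by (simp add: inverse_eq_divide)
  qed (auto intro!: always_eventually less_imp_le X(1,2) simp del: of_nat_Suc)
  have "\<forall>\<^sub>F k in sequentially. \<forall>i\<in>{..<n}. \<forall>j\<in>{..<n}. i < j \<longrightarrow> X i k < X j k"
  proof (intro eventually_ball_finite ballI finite_lessThan)
    fix i j assume ij: "i \<in> {..<n}" "j \<in> {..<n}"
    show "\<forall>\<^sub>F k in sequentially. i < j \<longrightarrow> X i k < X j k"
    proof (cases "i < j")
      case True
      then have "x i < x j" using xy(1) ij by (auto simp: strict_mono_on_def)
      then obtain c where c: "x i < c" "c < x j" using dense by blast
      have "\<forall>\<^sub>F k in sequentially. X i k < c" "\<forall>\<^sub>F k in sequentially. c < X j k"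
        using c lim by (auto intro: order_tendstoD)
      then show ?thesis by eventually_elim auto
    qed simp
  qed
  then have "\<forall>\<^sub>F k in sequentially. 0 \<le> fdet n (\<lambda>i j. g (X i k - y j))"
  proof (rule eventually_mono)
    fix k assume "\<forall>i\<in>{..<n}. \<forall>j\<in>{..<n}. i < j \<longrightarrow> X i k < X j k"
    then have "strict_mono_on {..<n} (\<lambda>i. X i k)" by (auto simp: strict_mono_on_def)
    then have "0 \<le> fdet n (\<lambda>i j. f m (X i k - y j))" for m
      using n xy(2) by (intro TN_fdet[OF TN]) auto
    moreover have "(\<lambda>m. fdet n (\<lambda>i j. f m (X i k - y j))) \<longlonglongrightarrow> fdet n (\<lambda>i j. g (X i k - y j))"
      by (intro fdet_tendsto X(3))
    ultimately show "0 \<le> fdet n (\<lambda>i j. g (X i k - y j))"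
      by (intro LIMSEQ_le_const) auto
  qed
  moreover have "(\<lambda>k. fdet n (\<lambda>i j. g (X i k - y j))) \<longlonglongrightarrow> fdet n (\<lambda>i j. g (x i - y j))"
    by (intro fdet_tendsto isCont_tendsto_compose[OF cont] tendsto_intros lim)
  ultimately show "0 \<le> fdet n (\<lambda>i j. g (x i - y j))"
    by (intro tendsto_lowerbound[OF _ _ sequentially_bot])
qed

lemma sigma_finite_lebesgue: "sigma_finite_measure (lebesgue :: real measure)"
proof
  obtain A :: "real set set" where A: "countable A" "A \<subseteq> sets lborel" "\<Union>A = space lborel"
      "\<forall>a\<in>A. emeasure lborel a \<noteq> \<infinity>"
    using lborel.sigma_finite_countable by blast
  then have "emeasure lebesgue a \<noteq> \<infinity>" if "a \<in> A" for a
    using that by (subst emeasure_completion) auto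
  then show "\<exists>A :: real set set. countable A \<and> A \<subseteq> sets lebesgue \<and> \<Union>A = space lebesgue \<and>
      (\<forall>a\<in>A. emeasure lebesgue a \<noteq> \<infinity>)"
    using A by (intro exI[of _ A]) (auto intro: sets_completionI_sets)
qed

definition convolve :: "(real \<Rightarrow> real) \<Rightarrow> (real \<Rightarrow> real) \<Rightarrow> real \<Rightarrow> real" where
  "convolve f g x = (LINT z|lebesgue. f (x - z) * g z)"

lemma integrable_lebesgue_reflect:
  "integrable lebesgue f \<Longrightarrow> integrable lebesgue (\<lambda>z. f (x - z))" for f :: "real \<Rightarrow> 'a :: euclidean_space"
  using lebesgue_integrable_real_affine[of f "-1" x] by simp

lemma integrable_lebesgue_translate:
  "integrable lebesgue f \<Longrightarrow> integrable lebesgue (\<lambda>z. f (z - y))" for f :: "real \<Rightarrow> 'a :: euclidean_space"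
  using lebesgue_integrable_real_affine[of f 1 "- y"] by simp

lemma integrable_mult_bounded:
  fixes f g :: "real \<Rightarrow> real"
  assumes "integrable lebesgue f" "integrable lebesgue g" "\<And>x. \<bar>f x\<bar> \<le> C"
  shows "integrable lebesgue (\<lambda>z. f z * g z)"
proof (rule Bochner_Integration.integrable_bound[of _ "\<lambda>z. C * \<bar>g z\<bar>"])
  show "AE z in lebesgue. norm (f z * g z) \<le> norm (C * \<bar>g z\<bar>)"
    using assms(3) order_trans[OF abs_ge_zero assms(3)]
    by (auto simp: abs_mult intro!: mult_right_mono)
qed (use assms in \<open>auto intro: borel_measurable_integrable\<close>)

text \<open>The substitution that moves \<open>y j\<close> into the second factor exhibits the
  kernel as a composition of two kernels, to which Andreief's identity applies. Boundedness of
  \<open>f\<close> makes the integrand integrable at every point rather than at almost every one, as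
  a statement about all minors requires.\<close>

lemma TN_convolve:
  assumes f: "TN p f" "integrable lebesgue f" "\<And>x. \<bar>f x\<bar> \<le> C"
    and g: "TN p g" "integrable lebesgue g"
  shows "TN p (convolve f g)"
  unfolding TN_iff_fdet
proof (intro ballI allI impI)
  fix n and x y :: "nat \<Rightarrow> real"
  assume n: "n \<in> {1..p}" and xy: "strict_mono_on {..<n} x" "strict_mono_on {..<n} y"
  have "convolve f g (x i - y j) = (LINT z|lebesgue. f (x i - z) * g (z - y j))" for i j
    unfolding convolve_def
    by (subst lebesgue_integral_real_affine[of 1 _ "- y j"]) (simp_all add: algebra_simps)
  then have "fdet n (\<lambda>i j. convolve f g (x i - y j)) =
      fdet n (\<lambda>i j. LINT z|lebesgue. f (x i - z) * g (z - y j))" by simp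
  also have "0 \<le> \<dots>"
  proof (rule andreief_nonneg[OF sigma_finite_lebesgue])
    fix z :: "nat \<Rightarrow> real" assume z: "strict_mono_on {..<n} z"
    have "0 \<le> fdet n (\<lambda>i k. f (x i - z k))" using n xy z by (intro TN_fdet[OF f(1)]) auto
    then have "0 \<le> fdet n (\<lambda>k i. f (x i - z k))"
      using fdet_transpose[of n "\<lambda>i k. f (x i - z k)"] by simp
    moreover have "0 \<le> fdet n (\<lambda>k j. g (z k - y j))" using n xy z by (intro TN_fdet[OF g(1)]) auto
    ultimately show "0 \<le> fdet n (\<lambda>k i. f (x i - z k)) * fdet n (\<lambda>k j. g (z k - y j))" by simp
  next
    fix i j
    show "integrable lebesgue (\<lambda>z. f (x i - z) * g (z - y j))"
      by (rule integrable_mult_bounded[OF integrable_lebesgue_reflect[OF f(2)]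
            integrable_lebesgue_translate[OF g(2)]]) (rule f(3))
  qed
  finally show "0 \<le> fdet n (\<lambda>i j. convolve f g (x i - y j))" .
qed

lemma convolve_bounded:
  assumes "\<And>x. \<bar>f x\<bar> \<le> C" "integrable lebesgue f" "integrable lebesgue g"
  shows "\<bar>convolve f g x\<bar> \<le> C * (LINT z|lebesgue. \<bar>g z\<bar>)"
proof -
  have "\<bar>convolve f g x\<bar> \<le> (LINT z|lebesgue. \<bar>f (x - z) * g z\<bar>)"
    unfolding convolve_def using integral_norm_bound[of lebesgue "\<lambda>z. f (x - z) * g z"] by simp
  also have "\<dots> \<le> (LINT z|lebesgue. C * \<bar>g z\<bar>)"
    using assms by (intro integral_mono integrable_abs integrable_mult_right
        integrable_mult_bounded[OF integrable_lebesgue_reflect])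
      (auto simp: abs_mult intro!: mult_right_mono)
  finally show ?thesis by simp
qed

section \<open>The bilateral Laplace transform\<close>

lemma borel_measurable_lebesgue_continuous:
  "continuous_on UNIV f \<Longrightarrow> f \<in> borel_measurable lebesgue" for f :: "real \<Rightarrow> complex"
  by (intro measurable_completion) (simp add: borel_measurable_continuous_onI)

lemma laplace_converges_0_iff: "laplace_converges f 0 \<longleftrightarrow> integrable lebesgue f"
  by (simp add: laplace_converges_def complex_of_real_integrable_eq)

lemma norm_laplace_integrand:
  "norm (exp (- (complex_of_real x * s)) * complex_of_real c) = exp (- (x * Re s)) * \<bar>c\<bar>"
  by (simp add: norm_mult)

lemma laplace_integrand_measurable:
  assumes "laplace_converges f s"
  shows "(\<lambda>x. exp (- (complex_of_real x * t)) * complex_of_real (f x)) \<in> borel_measurable lebesgue"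
proof -
  have "(\<lambda>x. exp (complex_of_real x * (s - t)) * (exp (- (complex_of_real x * s)) * complex_of_real (f x)))
      \<in> borel_measurable lebesgue"
    using assms unfolding laplace_converges_def
    by (intro borel_measurable_times borel_measurable_lebesgue_continuous continuous_intros
        borel_measurable_integrable)
  then show ?thesis by (simp add: algebra_simps exp_add[symmetric] mult.assoc[symmetric])
qed

text \<open>For x \<ge> 0 the exponential at \<open>u\<close> is dominated by the one at
  \<open>s\<close>, otherwise by the one at \<open>t\<close>.\<close>

lemma laplace_converges_between:
  assumes "laplace_converges f s" "laplace_converges f t" "Re s \<le> Re u" "Re u \<le> Re t"
  shows "laplace_converges f u"
  unfolding laplace_converges_def
proof (rule Bochner_Integration.integrable_bound)
  let ?F = "\<lambda>s x. exp (- (complex_of_real x * s)) * complex_of_real (f x)"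
  show "integrable lebesgue (\<lambda>x. norm (?F s x) + norm (?F t x))"
    using assms(1,2) unfolding laplace_converges_def by auto
  show "?F u \<in> borel_measurable lebesgue" by (rule laplace_integrand_measurable[OF assms(1)])
  show "AE x in lebesgue. norm (?F u x) \<le> norm (norm (?F s x) + norm (?F t x))"
  proof (intro always_eventually allI)
    fix x
    have "exp (- (x * Re u)) \<le> exp (- (x * Re s)) + exp (- (x * Re t))"
    proof (cases "x \<ge> 0")
      case True
      then have "x * Re s \<le> x * Re u" using assms by (intro mult_left_mono)
      then have "exp (- (x * Re u)) \<le> exp (- (x * Re s))" by simp
      then show ?thesis using exp_ge_zero[of "- (x * Re t)"] by linarith
    next
      case False
      then have "x * Re t \<le> x * Re u" using assms by (intro mult_left_mono_neg) auto
      then have "exp (- (x * Re u)) \<le> exp (- (x * Re t))" by simp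
      then show ?thesis using exp_ge_zero[of "- (x * Re s)"] by linarith
    qed
    then have "exp (- (x * Re u)) * \<bar>f x\<bar> \<le> (exp (- (x * Re s)) + exp (- (x * Re t))) * \<bar>f x\<bar>"
      by (rule mult_right_mono) simp
    then show "norm (?F u x) \<le> norm (norm (?F s x) + norm (?F t x))"
      unfolding norm_laplace_integrand by (simp add: distrib_right)
  qed
qed

lemma laplace_converges_Re_cong:
  "laplace_converges f s \<Longrightarrow> Re s = Re t \<Longrightarrow> laplace_converges f t"
  by (rule laplace_converges_between) auto

lemma convex_laplace_converges: "convex {s. laplace_converges f s}"
proof (rule convexI, clarify)
  fix s t :: complex and u v :: real
  assume st: "laplace_converges f s" "laplace_converges f t" and uv: "0 \<le> u" "0 \<le> v" "u + v = 1"
  have Re: "Re (u *\<^sub>R s + v *\<^sub>R t) = u * Re s + v * Re t" by simp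
  show "laplace_converges f (u *\<^sub>R s + v *\<^sub>R t)"
  proof (cases "Re s \<le> Re t")
    case True
    show ?thesis
    proof (rule laplace_converges_between[OF st])
      show "Re s \<le> Re (u *\<^sub>R s + v *\<^sub>R t)" "Re (u *\<^sub>R s + v *\<^sub>R t) \<le> Re t"
        unfolding Re using convex_bound_le[of "Re s" "Re t" "Re t" u v] True uv
          convex_bound_le[of "- Re s" "- Re s" "- Re t" u v] by auto
    qed
  next
    case False
    show ?thesis
    proof (rule laplace_converges_between[OF st(2,1)])
      show "Re t \<le> Re (u *\<^sub>R s + v *\<^sub>R t)" "Re (u *\<^sub>R s + v *\<^sub>R t) \<le> Re s"
        unfolding Re using convex_bound_le[of "Re s" "Re s" "Re t" u v] False uv
          convex_bound_le[of "- Re s" "- Re t" "- Re t" u v] by auto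
    qed
  qed
qed

lemma open_laplace_strip: "open (laplace_strip f)"
  by (simp add: laplace_strip_def)

lemma convex_laplace_strip: "convex (laplace_strip f)"
  unfolding laplace_strip_def by (intro convex_interior convex_laplace_converges)

lemma laplace_strip_converges: "s \<in> laplace_strip f \<Longrightarrow> laplace_converges f s"
  unfolding laplace_strip_def using interior_subset by blast

lemma laplace_strip_obtain:
  assumes "s \<in> laplace_strip f"
  obtains \<epsilon> where "\<epsilon> > 0" "\<And>w. \<bar>Re w - Re s\<bar> \<le> \<epsilon> \<Longrightarrow> laplace_converges f w"
proof -
  obtain e where e: "e > 0" "ball s e \<subseteq> {s. laplace_converges f s}"
    using assms unfolding laplace_strip_def mem_interior by blast
  show thesis
  proof (rule that[of "e / 2"])
    fix w assume w: "\<bar>Re w - Re s\<bar> \<le> e / 2"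
    have "norm (of_real (e / 2) :: complex) < e" using e(1) by (simp only: norm_of_real)
    then have "s - of_real (e / 2) \<in> ball s e" "s + of_real (e / 2) \<in> ball s e"
      by (simp_all only: mem_ball dist_norm) simp_all
    then have "laplace_converges f (s - of_real (e / 2))" "laplace_converges f (s + of_real (e / 2))"
      using e(2) by blast+
    then show "laplace_converges f w" by (rule laplace_converges_between) (use w in \<open>(simp, arith)+\<close>)
  qed (use e in simp)
qed

lemma laplace_stripI:
  assumes "\<epsilon> > 0" "\<And>w. \<bar>Re w - Re s\<bar> \<le> \<epsilon> \<Longrightarrow> laplace_converges f w"
  shows "s \<in> laplace_strip f"
proof -
  have "\<bar>Re w - Re s\<bar> \<le> \<epsilon>" if "w \<in> ball s \<epsilon>" for w
    using that abs_Re_le_cmod[of "w - s"] by (simp add: dist_norm norm_minus_commute)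
  then show ?thesis
    unfolding laplace_strip_def mem_interior using assms by (intro exI[of _ \<epsilon>]) auto
qed

lemma laplace_strip_Re_cong:
  assumes "s \<in> laplace_strip f" "Re s = Re t"
  shows "t \<in> laplace_strip f"
  using laplace_strip_obtain[OF assms(1)] laplace_stripI[of _ t f] assms(2) by metis

text \<open>Inside the strip this is the \<open>n\<close>-th derivative of the transform at
  \<open>s\<close>.\<close>

definition laplace_moment :: "(real \<Rightarrow> real) \<Rightarrow> complex \<Rightarrow> nat \<Rightarrow> complex" where
  "laplace_moment f s n = (LINT x|lebesgue. (- of_real x)^n * exp (- (of_real x * s)) * of_real (f x))"

text \<open>Both facts rest on one majorant: \<open>exp (\<epsilon> * \<bar>x\<bar>)\<close> times
  the norm of the integrand at \<open>s\<close> is at most \<open>h\<close>, the sum of the norms at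
  \<open>s - \<epsilon>\<close> and \<open>s + \<epsilon>\<close>. It dominates the integrand times
  any power of \<open>x\<close>, up to a constant, as well as times all partial sums of the
  exponential series in \<open>w\<close>.\<close>

lemma
  assumes \<epsilon>: "\<epsilon> > 0" "\<And>w. \<bar>Re w - Re s\<bar> \<le> \<epsilon> \<Longrightarrow> laplace_converges f w"
  shows laplace_moment_integrable:
      "integrable lebesgue (\<lambda>x. (- complex_of_real x)^n * exp (- (of_real x * s)) * of_real (f x))"
    and laplace_power_series:
      "norm w < \<epsilon> \<Longrightarrow> (\<lambda>n. laplace_moment f s n / fact n * w^n) sums bilateral_laplace f (s + w)"
proof -
  let ?F = "\<lambda>s x. exp (- (complex_of_real x * s)) * complex_of_real (f x)"
  define h where "h x = norm (?F (s - of_real \<epsilon>) x) + norm (?F (s + of_real \<epsilon>) x)" for x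
  have conv: "laplace_converges f (s - of_real \<epsilon>)" "laplace_converges f (s + of_real \<epsilon>)" "laplace_converges f s"
    using \<epsilon>(1) by (auto intro!: \<epsilon>(2))
  have h_int: "integrable lebesgue h"
    using conv unfolding h_def laplace_converges_def by auto
  have bound: "exp (\<epsilon> * \<bar>x\<bar>) * norm (?F s x) \<le> h x" for x
  proof -
    have "exp (\<epsilon> * \<bar>x\<bar>) * exp (- (x * Re s)) \<le> exp (- (x * (Re s - \<epsilon>))) + exp (- (x * (Re s + \<epsilon>)))"
      by (cases "x \<ge> 0") (auto simp: exp_add[symmetric] algebra_simps)
    then have "exp (\<epsilon> * \<bar>x\<bar>) * exp (- (x * Re s)) * \<bar>f x\<bar> \<le>
        (exp (- (x * (Re s - \<epsilon>))) + exp (- (x * (Re s + \<epsilon>)))) * \<bar>f x\<bar>"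
      by (rule mult_right_mono) simp
    then show ?thesis unfolding h_def norm_laplace_integrand by (simp add: algebra_simps)
  qed
  have pow_meas: "(\<lambda>x. (- complex_of_real x)^n) \<in> borel_measurable lebesgue" for n
    by (intro borel_measurable_lebesgue_continuous continuous_intros)
  have F_meas: "?F s \<in> borel_measurable lebesgue"
    by (rule laplace_integrand_measurable[OF conv(3)])
  have pow_le: "(\<Sum>k<n. (\<epsilon> * \<bar>x\<bar>)^k / fact k) \<le> exp (\<epsilon> * \<bar>x\<bar>)" for n x
    using exp_converges[of "\<epsilon> * \<bar>x\<bar>"] \<epsilon>(1) unfolding exp_def
    by (auto simp: divide_inverse mult.commute sums_iff intro!: sum_le_suminf)
  have int: "integrable lebesgue (\<lambda>x. (- complex_of_real x)^n * ?F s x)" for n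
  proof (rule Bochner_Integration.integrable_bound)
    show "integrable lebesgue (\<lambda>x. fact n / \<epsilon>^n * h x)" using h_int by auto
    show "AE x in lebesgue. norm ((- complex_of_real x)^n * ?F s x) \<le> norm (fact n / \<epsilon>^n * h x)"
    proof (intro always_eventually allI)
      fix x
      have "(\<epsilon> * \<bar>x\<bar>)^n / fact n \<le> (\<Sum>k<Suc n. (\<epsilon> * \<bar>x\<bar>)^k / fact k)"
        using \<epsilon>(1) by (intro member_le_sum) auto
      also note pow_le
      finally have "\<bar>x\<bar>^n \<le> fact n / \<epsilon>^n * exp (\<epsilon> * \<bar>x\<bar>)"
        using \<epsilon>(1) by (simp add: field_simps power_mult_distrib)
      then have "\<bar>x\<bar>^n * norm (?F s x) \<le> fact n / \<epsilon>^n * exp (\<epsilon> * \<bar>x\<bar>) * norm (?F s x)"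
        by (rule mult_right_mono) simp
      also have "\<dots> \<le> fact n / \<epsilon>^n * h x"
        using mult_left_mono[OF bound[of x], of "fact n / \<epsilon>^n"] \<epsilon>(1) by (simp add: mult.assoc)
      also have "\<dots> \<le> norm (fact n / \<epsilon>^n * h x)" by (simp only: real_norm_def abs_ge_self)
      finally show "norm ((- complex_of_real x)^n * ?F s x) \<le> norm (fact n / \<epsilon>^n * h x)"
        by (simp only: norm_mult[of "_ ^ n"] norm_power norm_minus_cancel norm_of_real)
    qed
  qed (intro borel_measurable_times pow_meas F_meas)
  then show "integrable lebesgue (\<lambda>x. (- complex_of_real x)^n * exp (- (of_real x * s)) * of_real (f x))"
    by (simp add: mult.assoc)
  assume w: "norm w < \<epsilon>"
  define S where "S n x = (\<Sum>k<n. (- complex_of_real x * w)^k / fact k) * ?F s x" for n x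
  have "(\<lambda>n. integral\<^sup>L lebesgue (S n)) \<longlonglongrightarrow> integral\<^sup>L lebesgue (?F (s + w))"
  proof (rule integral_dominated_convergence[where w = h])
    show "?F (s + w) \<in> borel_measurable lebesgue"
      by (rule laplace_integrand_measurable[OF conv(3)])
    show "S n \<in> borel_measurable lebesgue" for n
      unfolding S_def by (intro borel_measurable_times F_meas borel_measurable_lebesgue_continuous continuous_intros) auto
    show "AE x in lebesgue. (\<lambda>n. S n x) \<longlonglongrightarrow> ?F (s + w) x"
    proof (intro always_eventually allI)
      fix x
      have "(\<lambda>n. (- complex_of_real x * w)^n / fact n) sums exp (- complex_of_real x * w)"
        using exp_converges[of "- complex_of_real x * w"] by (simp add: scaleR_conv_of_real field_simps)
      then have "(\<lambda>n. S n x) \<longlonglongrightarrow> exp (- complex_of_real x * w) * ?F s x"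
        unfolding S_def sums_def by (intro tendsto_mult_right)
      also have "exp (- complex_of_real x * w) * ?F s x = ?F (s + w) x"
        by (simp add: distrib_left exp_add exp_minus exp_diff inverse_mult_distrib divide_inverse mult_ac)
      finally show "(\<lambda>n. S n x) \<longlonglongrightarrow> ?F (s + w) x" .
    qed
    show "AE x in lebesgue. norm (S n x) \<le> h x" for n
    proof (intro always_eventually allI)
      fix x
      have "norm (\<Sum>k<n. (- complex_of_real x * w)^k / fact k) \<le> (\<Sum>k<n. (\<epsilon> * \<bar>x\<bar>)^k / fact k)"
      proof (rule sum_norm_le)
        fix k
        have "(\<bar>x\<bar> * norm w)^k \<le> (\<epsilon> * \<bar>x\<bar>)^k"
        proof (rule power_mono)
          show "\<bar>x\<bar> * norm w \<le> \<epsilon> * \<bar>x\<bar>"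
            unfolding mult.commute[of \<epsilon>] by (rule mult_left_mono) (use w in auto)
        qed simp
        moreover have "norm ((- complex_of_real x * w)^k / fact k) = (\<bar>x\<bar> * norm w)^k / fact k"
          unfolding norm_divide norm_power norm_mult norm_minus_cancel norm_of_real norm_fact ..
        ultimately show "norm ((- complex_of_real x * w)^k / fact k) \<le> (\<epsilon> * \<bar>x\<bar>)^k / fact k"
          by (simp only: divide_right_mono fact_ge_zero)
      qed
      also note pow_le
      finally have "norm (S n x) \<le> exp (\<epsilon> * \<bar>x\<bar>) * norm (?F s x)"
        unfolding S_def norm_mult[of "sum _ _"] by (rule mult_right_mono) simp
      also note bound
      finally show "norm (S n x) \<le> h x" .
    qed
  qed (rule h_int)
  moreover have "integral\<^sup>L lebesgue (S n) = (\<Sum>k<n. laplace_moment f s k / fact k * w^k)" for n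
  proof -
    have S: "S n = (\<lambda>x. \<Sum>k<n. w^k / fact k * ((- complex_of_real x)^k * ?F s x))"
      unfolding S_def sum_distrib_right
      by (intro ext sum.cong refl) (simp only: power_mult_distrib, simp)
    have "integral\<^sup>L lebesgue (S n) =
        (\<Sum>k<n. LINT x|lebesgue. w^k / fact k * ((- complex_of_real x)^k * ?F s x))"
      unfolding S by (intro Bochner_Integration.integral_sum integrable_mult_right int)
    also have "\<dots> = (\<Sum>k<n. w^k / fact k * (LINT x|lebesgue. (- complex_of_real x)^k * ?F s x))"
      by (simp only: integral_mult_right_zero)
    finally have "integral\<^sup>L lebesgue (S n) = \<dots>" .
    moreover have "w^k / fact k * (LINT x|lebesgue. (- complex_of_real x)^k * ?F s x)
        = laplace_moment f s k / fact k * w^k" for k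
      unfolding laplace_moment_def mult.assoc by simp
    ultimately show ?thesis by (simp only:)
  qed
  ultimately show "(\<lambda>n. laplace_moment f s n / fact n * w^n) sums bilateral_laplace f (s + w)"
    unfolding sums_def bilateral_laplace_def by simp
qed

lemma bilateral_laplace_holomorphic: "bilateral_laplace f holomorphic_on laplace_strip f"
proof -
  have ex: "\<exists>e>0. bilateral_laplace f holomorphic_on ball s e" if s: "s \<in> laplace_strip f" for s
  proof -
    obtain e where e: "e > 0" "\<And>w. \<bar>Re w - Re s\<bar> \<le> e \<Longrightarrow> laplace_converges f w"
      using laplace_strip_obtain[OF s] by blast
    have "bilateral_laplace f holomorphic_on ball s e"
    proof (rule power_series_holomorphic)
      fix w assume "w \<in> ball s e"
      then have "norm (w - s) < e" by (simp add: dist_norm norm_minus_commute)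
      from laplace_power_series[of e s f, OF e this]
      show "(\<lambda>n. laplace_moment f s n / fact n * (w - s)^n) sums bilateral_laplace f w" by simp
    qed
    then show ?thesis using e(1) by blast
  qed
  show "bilateral_laplace f holomorphic_on laplace_strip f"
    unfolding holomorphic_on_def
  proof
    fix s assume s: "s \<in> laplace_strip f"
    obtain e where "e > 0" "bilateral_laplace f holomorphic_on ball s e" using ex[OF s] by blast
    then have "bilateral_laplace f field_differentiable at s"
      by (auto simp: holomorphic_on_open field_differentiable_def)
    then show "bilateral_laplace f field_differentiable at s within laplace_strip f"
      by (rule field_differentiable_at_within)
  qed
qed

section \<open>Borel versions and the convolution theorem\<close>

lemma obtain_borel_version:
  fixes f :: "real \<Rightarrow> real"
  assumes "f \<in> borel_measurable lebesgue"
  obtains f' where "f' \<in> borel_measurable borel" "AE x in lebesgue. f x = f' x" "AE x in lborel. f x = f' x"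
  using completion_ex_borel_measurable_real[OF assms] by (auto simp: AE_completion_iff)

lemma laplace_cong_AE:
  assumes "AE x in lebesgue. f x = g x" "f \<in> borel_measurable lebesgue" "g \<in> borel_measurable lebesgue"
  shows "laplace_converges f s \<longleftrightarrow> laplace_converges g s" "bilateral_laplace f s = bilateral_laplace g s"
proof -
  have *: "(\<lambda>x. exp (- (complex_of_real x * s))) \<in> borel_measurable lebesgue"
    by (intro borel_measurable_lebesgue_continuous continuous_intros)
  show "laplace_converges f s \<longleftrightarrow> laplace_converges g s"
    unfolding laplace_converges_def using assms *
    by (intro integrable_cong_AE borel_measurable_times) auto
  show "bilateral_laplace f s = bilateral_laplace g s"
    unfolding bilateral_laplace_def using assms *
    by (intro integral_cong_AE borel_measurable_times) auto
qed

lemma borel_laplace_integrand: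
  assumes "f \<in> borel_measurable borel"
  shows "(\<lambda>x. exp (- (complex_of_real x * s)) * complex_of_real (f x)) \<in> borel_measurable borel"
proof -
  have "(\<lambda>x. exp (- (complex_of_real x * s))) \<in> borel_measurable borel"
    by (intro borel_measurable_continuous_onI continuous_intros)
  then show ?thesis using assms by measurable
qed

lemma laplace_lborel:
  assumes "f \<in> borel_measurable borel"
  shows "laplace_converges f s \<longleftrightarrow> integrable lborel (\<lambda>x. exp (- (complex_of_real x * s)) * complex_of_real (f x))"
    "bilateral_laplace f s = (LINT x|lborel. exp (- (complex_of_real x * s)) * complex_of_real (f x))"
  unfolding laplace_converges_def bilateral_laplace_def
  using borel_laplace_integrand[OF assms, of s] by (simp_all add: integrable_completion integral_completion)

lemma lborel_convolution:
  fixes F G :: "real \<Rightarrow> complex"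
  assumes F: "integrable lborel F" and G: "integrable lborel G"
  shows "integrable lborel (\<lambda>x. LINT z|lborel. F (x - z) * G z)"
    and "(LINT x|lborel. LINT z|lborel. F (x - z) * G z) = (LINT x|lborel. F x) * (LINT x|lborel. G x)"
proof -
  have [measurable]: "F \<in> borel_measurable borel" "G \<in> borel_measurable borel"
    using F G by (auto dest: borel_measurable_integrable)
  have shift: "integrable lborel (\<lambda>x. F (x - z))" "(LINT x|lborel. F (x - z)) = (LINT x|lborel. F x)"
    "(LINT x|lborel. norm (F (x - z))) = (LINT x|lborel. norm (F x))" for z
    using lborel_integrable_real_affine[OF F, of 1 "- z"] lborel_integral_real_affine[of 1 F "- z"]
      lborel_integral_real_affine[of 1 "\<lambda>x. norm (F x)" "- z"] by auto
  have int: "integrable (lborel \<Otimes>\<^sub>M lborel) (\<lambda>(z, x). F (x - z) * G z)"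
  proof (rule lborel_pair.Fubini_integrable)
    show "integrable lborel (\<lambda>z. LINT x|lborel. norm (case (z, x) of (z, x) \<Rightarrow> F (x - z) * G z))"
      using G by (simp add: norm_mult shift)
    show "AE z in lborel. integrable lborel (\<lambda>x. case (z, x) of (z, x) \<Rightarrow> F (x - z) * G z)"
      using shift(1) by auto
  qed measurable
  show "integrable lborel (\<lambda>x. LINT z|lborel. F (x - z) * G z)"
    using lborel_pair.integrable_snd[OF int] by simp
  have "(LINT x|lborel. LINT z|lborel. F (x - z) * G z) = (LINT z|lborel. LINT x|lborel. F (x - z) * G z)"
    using lborel_pair.Fubini_integral[OF int] by simp
  also have "\<dots> = (LINT x|lborel. F x) * (LINT x|lborel. G x)"
    by (simp add: shift)
  finally show "(LINT x|lborel. LINT z|lborel. F (x - z) * G z) = (LINT x|lborel. F x) * (LINT x|lborel. G x)" .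
qed

lemma laplace_converges_measurable:
  assumes "laplace_converges f s"
  shows "f \<in> borel_measurable lebesgue"
proof -
  have [measurable]: "(\<lambda>x. exp (- (complex_of_real x * 0)) * complex_of_real (f x)) \<in> borel_measurable lebesgue"
    by (rule laplace_integrand_measurable[OF assms])
  have "(\<lambda>x. Re (exp (- (complex_of_real x * 0)) * complex_of_real (f x))) \<in> borel_measurable lebesgue"
    by measurable
  then show ?thesis by simp
qed

text \<open>Fubini's theorem is applied to Borel functions, so both factors are replaced by Borel
  versions. Null sets remain null under the reflection of z to x - z, so the equality holds at every
  \<open>x\<close>.\<close>

lemma convolve_eq_lborel:
  assumes f': "f' \<in> borel_measurable borel" "AE x in lborel. f x = f' x"
    and g': "g' \<in> borel_measurable borel" "AE x in lborel. g x = g' x"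
    and meas: "f \<in> borel_measurable lebesgue" "g \<in> borel_measurable lebesgue"
  shows "convolve f g x = (LINT z|lborel. f' (x - z) * g' z)"
proof -
  obtain N where N: "{x \<in> space lborel. f x \<noteq> f' x} \<subseteq> N" "N \<in> null_sets lborel"
    by (rule AE_E[OF f'(2)]) (auto simp: null_sets_def)
  have "AE z in lborel. x + (- 1) * z \<notin> N"
    using N(2) by (intro AE_borel_affine) (auto intro: AE_not_in)
  then have "AE z in lborel. f (x - z) = f' (x - z)"
    by (rule eventually_mono) (use N(1) in auto)
  then have "AE z in lebesgue. f (x - z) = f' (x - z)" by (simp add: AE_completion_iff)
  moreover have "AE z in lebesgue. g z = g' z" using g'(2) by (simp add: AE_completion_iff)
  ultimately have AE: "AE z in lebesgue. f (x - z) * g z = f' (x - z) * g' z" by eventually_elim simp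
  have "(\<lambda>z. x + (- 1) * z) \<in> lebesgue \<rightarrow>\<^sub>M lebesgue"
    using lebesgue_affine_measurable[where c = "\<lambda>_ :: real. - 1 :: real" and t = x] by simp
  then have [measurable]: "(\<lambda>z. x - z) \<in> lebesgue \<rightarrow>\<^sub>M lebesgue" by simp
  have borel: "(\<lambda>z. f' (x - z) * g' z) \<in> borel_measurable borel" using f'(1) g'(1) by measurable
  have "(\<lambda>z. f (x - z)) \<in> borel_measurable lebesgue" using meas(1) by measurable
  then have "(\<lambda>z. f (x - z) * g z) \<in> borel_measurable lebesgue"
    using meas(2) by (intro borel_measurable_times)
  moreover have "(\<lambda>z. f' (x - z) * g' z) \<in> borel_measurable lebesgue"
    using borel by (intro measurable_completion) simp
  ultimately have "convolve f g x = (LINT z|lebesgue. f' (x - z) * g' z)"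
    unfolding convolve_def using AE by (intro integral_cong_AE)
  also have "\<dots> = (LINT z|lborel. f' (x - z) * g' z)"
    using borel by (simp add: integral_completion)
  finally show ?thesis .
qed

text \<open>The exponential weight at x is the product of the weights at x - z and z, so the
  weighted convolution is the convolution of the weighted functions, and Fubini's theorem factors
  its integral.\<close>

lemma laplace_convolve:
  assumes "laplace_converges f s" "laplace_converges g s"
  shows "laplace_converges (convolve f g) s"
    and "bilateral_laplace (convolve f g) s = bilateral_laplace f s * bilateral_laplace g s"
proof -
  have f: "f \<in> borel_measurable lebesgue" and g: "g \<in> borel_measurable lebesgue"
    by (rule laplace_converges_measurable, rule assms)+
  obtain f' where f': "f' \<in> borel_measurable borel" "AE x in lebesgue. f x = f' x" "AE x in lborel. f x = f' x"
    by (rule obtain_borel_version[OF f])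
  obtain g' where g': "g' \<in> borel_measurable borel" "AE x in lebesgue. g x = g' x" "AE x in lborel. g x = g' x"
    by (rule obtain_borel_version[OF g])
  have [measurable]: "f' \<in> borel_measurable borel" "g' \<in> borel_measurable borel" by fact+
  define F where "F x = exp (- (complex_of_real x * s)) * complex_of_real (f' x)" for x
  define G where "G x = exp (- (complex_of_real x * s)) * complex_of_real (g' x)" for x
  have "f' \<in> borel_measurable lebesgue" "g' \<in> borel_measurable lebesgue"
    using f'(1) g'(1) by (auto intro: measurable_completion)
  then have FG: "integrable lborel F" "integrable lborel G" "bilateral_laplace f s = (LINT x|lborel. F x)"
      "bilateral_laplace g s = (LINT x|lborel. G x)"
    unfolding F_def G_def using assms laplace_cong_AE[OF f'(2) f] laplace_cong_AE[OF g'(2) g]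
    by (simp_all add: laplace_lborel f'(1) g'(1))
  define h where "h x = (LINT z|lborel. f' (x - z) * g' z)" for x
  have h: "convolve f g = h"
    unfolding h_def by (intro ext convolve_eq_lborel f' g' f g)
  have h_meas: "h \<in> borel_measurable borel" unfolding h_def by measurable
  have *: "exp (- (complex_of_real x * s)) * complex_of_real (h x) = (LINT z|lborel. F (x - z) * G z)" for x
  proof -
    have "(LINT z|lborel. F (x - z) * G z) =
        (LINT z|lborel. exp (- (complex_of_real x * s)) * complex_of_real (f' (x - z) * g' z))"
      unfolding F_def G_def
      by (intro Bochner_Integration.integral_cong refl)
         (simp add: exp_add[symmetric] exp_diff[symmetric] algebra_simps mult_exp_exp)
    then show ?thesis unfolding h_def by (simp only: integral_mult_right_zero integral_complex_of_real)
  qed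
  show "laplace_converges (convolve f g) s"
    unfolding h laplace_lborel[OF h_meas] * by (rule lborel_convolution[OF FG(1,2)])
  show "bilateral_laplace (convolve f g) s = bilateral_laplace f s * bilateral_laplace g s"
    unfolding h laplace_lborel[OF h_meas] * FG(3,4) by (rule lborel_convolution[OF FG(1,2)])
qed

section \<open>Fourier and Laplace inversion\<close>

text \<open>Serves to show that the inversion integral, known only through its integrals over
  intervals, is real and nonnegative at every point.\<close>

lemma continuous_nonneg_if_interval_integrals_nonneg:
  fixes g :: "real \<Rightarrow> real"
  assumes cont: "\<And>x. isCont g x"
    and int: "\<And>a b. a < b \<Longrightarrow> 0 \<le> (LINT x|lborel. indicator {a..b} x *\<^sub>R g x)"
  shows "0 \<le> g x"
proof (rule ccontr)
  assume "\<not> 0 \<le> g x"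
  then have neg: "g x < 0" by simp
  then obtain d where d: "d > 0" "\<And>y. dist y x < d \<Longrightarrow> dist (g y) (g x) < - g x / 2"
    using cont[of x] unfolding continuous_at_eps_delta by (metis half_gt_zero neg_0_less_iff_less)
  have le: "g y \<le> g x / 2" if "y \<in> {x..x + d / 2}" for y
    using d(2)[of y] d(1) that by (auto simp: dist_real_def abs_less_iff)
  have "(LINT y|lborel. indicator {x..x + d / 2} y *\<^sub>R g y) \<le>
      (LINT y|lborel. indicator {x..x + d / 2} y *\<^sub>R (g x / 2))"
  proof (rule integral_mono)
    show "integrable lborel (\<lambda>y. indicator {x..x + d / 2} y *\<^sub>R g y)"
      using borel_integrable_atLeastAtMost'[of x "x + d / 2" g] cont
      by (auto intro!: continuous_at_imp_continuous_on simp: set_integrable_def)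
    show "integrable lborel (\<lambda>y. indicator {x..x + d / 2} y *\<^sub>R (g x / 2))"
      by (intro integrable_scaleR_left integrable_real_indicator) (auto simp: emeasure_lborel_Icc_eq)
  qed (use le in \<open>auto simp: indicator_def\<close>)
  also have "\<dots> = d / 2 * (g x / 2)"
    using d(1) by (simp add: integral_indicator)
  also have "\<dots> < 0" using d(1) neg by (simp add: mult_pos_neg)
  finally show False using int[of x "x + d / 2"] d(1) by simp
qed

lemma isCont_fourier_integral:
  fixes F :: "real \<Rightarrow> complex"
  assumes "integrable lborel F"
  shows "isCont (\<lambda>x. LINT t|lborel. iexp (t * x) * F t) x"
  unfolding continuous_at_sequentially comp_def
proof (intro allI impI)
  fix X assume X: "X \<longlonglongrightarrow> x"
  have [measurable]: "F \<in> borel_measurable borel" using assms by (auto dest: borel_measurable_integrable)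
  show "(\<lambda>n. LINT t|lborel. iexp (t * X n) * F t) \<longlonglongrightarrow> (LINT t|lborel. iexp (t * x) * F t)"
  proof (rule integral_dominated_convergence[where w = "\<lambda>t. norm (F t)"])
    show "AE t in lborel. (\<lambda>n. iexp (t * X n) * F t) \<longlonglongrightarrow> iexp (t * x) * F t"
      by (intro always_eventually allI tendsto_intros X)
  qed (use assms in \<open>auto simp: norm_mult\<close>)
qed

text \<open>The half-open intervals form a generator stable under intersection. The closed interval
  on the right is harmless, since its left end point is null.\<close>

lemma density_interval_AE_eq:
  fixes f g :: "real \<Rightarrow> real"
  assumes f: "f \<in> borel_measurable borel" "\<And>x. 0 \<le> f x" "integrable lborel f"
    and g: "\<And>x. isCont g x" "\<And>x. 0 \<le> g x"
    and eq: "\<And>a b. a \<le> b \<Longrightarrow> measure (density lborel f) {a<..b} = (LINT x|lborel. indicator {a..b} x *\<^sub>R g x)"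
  shows "AE x in lborel. f x = g x"
proof -
  have g_meas: "g \<in> borel_measurable borel"
    using g(1) by (intro borel_measurable_continuous_onI continuous_at_imp_continuous_on) auto
  have f_meas: "f \<in> borel_measurable borel" by fact
  interpret F: finite_measure "density lborel f"
  proof
    have "emeasure (density lborel f) (space (density lborel f)) = (\<integral>\<^sup>+x. f x \<partial>lborel)"
      using f(1) by (subst emeasure_density) auto
    also have "\<dots> \<noteq> \<infinity>"
      using f by (simp add: nn_integral_eq_integral)
    finally show "emeasure (density lborel f) (space (density lborel f)) \<noteq> \<infinity>" .
  qed
  have "density lborel f = density lborel g"
  proof (rule measure_eqI_generator_eq[where \<Omega> = UNIV and E = "range (\<lambda>(a, b). {a<..b :: real})" and A = "\<lambda>n :: nat. {- real n<..real n}"])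
    show "Int_stable (range (\<lambda>(a, b). {a<..b :: real}))"
      by (auto simp: Int_stable_def)
    fix X assume "X \<in> range (\<lambda>(a, b). {a<..b :: real})"
    then obtain a b where X: "X = {a<..b}" by auto
    show "emeasure (density lborel f) X = emeasure (density lborel g) X"
    proof (cases "a \<le> b")
      case True
      have int: "integrable lborel (\<lambda>x. indicator {a..b} x *\<^sub>R g x)"
        using borel_integrable_atLeastAtMost'[of a b g] g(1)
        by (auto intro!: continuous_at_imp_continuous_on simp: set_integrable_def)
      have "emeasure (density lborel g) {a<..b} = (\<integral>\<^sup>+x. ennreal (g x) * indicator {a<..b} x \<partial>lborel)"
        using g_meas by (subst emeasure_density) auto
      also have "\<dots> = (\<integral>\<^sup>+x. ennreal (indicator {a..b} x *\<^sub>R g x) \<partial>lborel)"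
      proof (rule nn_integral_cong_AE)
        have "AE x in lborel. x \<noteq> a" by (rule AE_lborel_singleton)
        then show "AE x in lborel. ennreal (g x) * indicator {a<..b} x = ennreal (indicator {a..b} x *\<^sub>R g x)"
          by eventually_elim (auto simp: indicator_def)
      qed
      also have "\<dots> = ennreal (measure (density lborel f) {a<..b})"
        unfolding eq[OF True] by (rule nn_integral_eq_integral[OF int]) (use g(2) in \<open>auto simp: indicator_def\<close>)
      also have "\<dots> = emeasure (density lborel f) {a<..b}"
        by (rule F.emeasure_eq_measure[symmetric])
      finally show ?thesis by (simp add: X)
    qed (simp add: X)
  next
    show "(\<Union>i :: nat. {- real i<..real i}) = UNIV"
    proof (intro equalityI subsetI UNIV_I)
      fix x :: real
      obtain n :: nat where "\<bar>x\<bar> < real n" using reals_Archimedean2 by blast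
      then show "x \<in> (\<Union>i :: nat. {- real i<..real i})" by (intro UN_I[of n]) auto
    qed
  qed (auto simp: borel_sigma_sets_Ioc)
  then have "AE x in lborel. ennreal (f x) = ennreal (g x)"
    using f_meas g_meas by (subst (asm) sigma_finite_measure.density_unique_iff[OF lborel.sigma_finite_measure_axioms]) auto
  then show ?thesis
    by (rule eventually_mono) (use f(2) g(2) in auto)
qed

text \<open>Levy's formula expresses the mass of an interval as a limit of truncated integrals of
  \<open>K\<close> times the characteristic function. Integrability of the latter allows passing to
  the full integral and exchanging the order of integration, so the mass becomes the integral of
  \<open>H\<close> over the interval.\<close>

lemma fourier_inversion_AE:
  fixes f :: "real \<Rightarrow> real"
  assumes f: "f \<in> borel_measurable borel" "\<And>x. 0 \<le> f x" "integrable lborel f" "(LINT x|lborel. f x) = 1"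
    and int: "integrable lborel (\<lambda>t. bilateral_laplace f (\<i> * of_real t))"
  shows "AE x in lborel. of_real (f x) =
    1 / (2 * pi) * (LINT t|lborel. iexp (t * x) * bilateral_laplace f (\<i> * of_real t))"
proof -
  define M where "M = density lborel f"
  have prob: "prob_space M"
  proof (rule prob_spaceI)
    show "emeasure M (space M) = 1"
      unfolding M_def using f by (subst emeasure_density) (auto simp: nn_integral_eq_integral)
  qed
  interpret M: real_distribution M
    by (intro real_distribution.intro prob real_distribution_axioms.intro) (auto simp: M_def)
  have char: "char M t = bilateral_laplace f (\<i> * of_real (- t))" for t
  proof -
    have "char M t = (LINT x|lborel. f x *\<^sub>R iexp (t * x))"
      unfolding char_def M_def using f by (intro integral_density) auto
    also have "\<dots> = bilateral_laplace f (\<i> * of_real (- t))"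
      unfolding laplace_lborel(2)[OF f(1)]
      by (intro Bochner_Integration.integral_cong refl) (simp add: scaleR_conv_of_real mult_ac)
    finally show ?thesis .
  qed
  have char_int: "integrable lborel (char M)"
    using lborel_integrable_real_affine[OF int, of "-1" 0] by (simp add: char[abs_def])
  have singleton: "measure M {a} = 0" for a
  proof -
    have "emeasure M {a} = (\<integral>\<^sup>+x. ennreal (f x) * indicator {a} x \<partial>lborel)"
      unfolding M_def using f(1) by (subst emeasure_density) auto
    also have "\<dots> = 0" by (rule nn_integral_null_set) auto
    finally show ?thesis by (simp add: measure_def)
  qed
  define H where "H x = 1 / (2 * pi) * (LINT t|lborel. iexp (t * x) * bilateral_laplace f (\<i> * of_real t))" for x
  have H_char: "H x = 1 / (2 * pi) * (LINT t|lborel. iexp (- (t * x)) * char M t)" for x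
    unfolding H_def
    by (subst lborel_integral_real_affine[of "-1" _ 0]) (simp_all add: char)
  have H_cont: "isCont H x" for x
    unfolding H_def by (intro continuous_intros isCont_fourier_integral int)
  have key: "complex_of_real (measure M {a<..b}) = (LINT x|lborel. indicator {a..b} x *\<^sub>R H x)"
    if ab: "a \<le> b" for a b
  proof -
    \<comment> \<open>The quotient is the Fourier transform of the indicator of the interval. At t =
      0 it evaluates to 0 instead of b - a, which affects only a null set.\<close>
    define K where "K t = (iexp (- (t * a)) - iexp (- (t * b))) / (\<i> * complex_of_real t)" for t
    have K_bound: "norm (K t) \<le> b - a" for t
    proof (cases "t = 0")
      case False
      then show ?thesis using Levy_Inversion_aux2[of "- b" "- a" t] ab by (simp add: K_def)
    qed (use ab in \<open>simp add: K_def\<close>)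
    have K_meas [measurable]: "K \<in> borel_measurable borel" unfolding K_def by measurable
    have K_integral: "K t = (LINT x|lborel. indicator {a..b} x *\<^sub>R iexp (- (t * x)))" if "t \<noteq> 0" for t
    proof -
      have "(LINT x|lborel. indicator {a..b} x *\<^sub>R iexp (- (t * x))) =
          iexp (- (t * b)) / (- (\<i> * t)) - iexp (- (t * a)) / (- (\<i> * t))"
      proof (rule integral_FTC_Icc[OF ab])
        fix x
        have "((\<lambda>x. exp (\<i> * of_real (- (t * x))) / (- (\<i> * t))) has_vector_derivative iexp (- (t * x))) (at x)"
          using that
          by (auto intro!: derivative_eq_intros has_vector_derivative_real_field simp: field_simps)
        then show "((\<lambda>x. iexp (- (t * x)) / (- (\<i> * t))) has_vector_derivative iexp (- (t * x))) (at x within {a..b})"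
          by (rule has_vector_derivative_at_within)
      qed (intro continuous_intros)
      then show ?thesis using that by (simp add: K_def field_simps)
    qed
    have lim: "(\<lambda>n. 1 / (2 * pi) * (LINT t|lborel. indicator {- real n<..<real n} t *\<^sub>R (K t * char M t)))
        \<longlonglongrightarrow> complex_of_real (measure M {a<..b})"
      using M.Levy_Inversion[OF ab singleton singleton]
      by (simp add: interval_lebesgue_integral_le_eq set_lebesgue_integral_def K_def)
    have "(\<lambda>n. LINT t|lborel. indicator {- real n<..<real n} t *\<^sub>R (K t * char M t))
        \<longlonglongrightarrow> (LINT t|lborel. K t * char M t)"
    proof (rule integral_dominated_convergence[where w = "\<lambda>t. (b - a) * norm (char M t)"])
      show "AE t in lborel. (\<lambda>n. indicator {- real n<..<real n} t *\<^sub>R (K t * char M t)) \<longlonglongrightarrow> K t * char M t"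
      proof (rule AE_I2, rule tendsto_eventually)
        fix t :: real
        obtain n0 :: nat where "\<bar>t\<bar> < real n0" using reals_Archimedean2 by blast
        then have "t \<in> {- real n<..<real n}" if "n \<ge> n0" for n
          using that by auto
        then show "\<forall>\<^sub>F n in sequentially. indicator {- real n<..<real n} t *\<^sub>R (K t * char M t) = K t * char M t"
          unfolding eventually_sequentially by (intro exI[of _ n0]) auto
      qed
      show "AE t in lborel. norm (indicator {- real n<..<real n} t *\<^sub>R (K t * char M t)) \<le> (b - a) * norm (char M t)" for n
        using K_bound ab by (auto simp: indicator_def norm_mult intro!: mult_right_mono)
      show "integrable lborel (\<lambda>t. (b - a) * norm (char M t))"
        using char_int by auto
    qed measurable
    then have "(\<lambda>n. 1 / (2 * pi) * (LINT t|lborel. indicator {- real n<..<real n} t *\<^sub>R (K t * char M t)))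
        \<longlonglongrightarrow> 1 / (2 * pi) * (LINT t|lborel. K t * char M t)"
      by (intro tendsto_intros)
    with lim have "complex_of_real (measure M {a<..b}) = 1 / (2 * pi) * (LINT t|lborel. K t * char M t)"
      by (rule LIMSEQ_unique)
    also have "(LINT t|lborel. K t * char M t) =
        (LINT t|lborel. LINT x|lborel. indicator {a..b} x *\<^sub>R iexp (- (t * x)) * char M t)"
    proof (rule integral_cong_AE)
      have "AE t in lborel. t \<noteq> (0 :: real)" by (rule AE_lborel_singleton)
      then show "AE t in lborel. K t * char M t =
          (LINT x|lborel. indicator {a..b} x *\<^sub>R iexp (- (t * x)) * char M t)"
        by eventually_elim (simp only: K_integral integral_mult_left_zero not_False_eq_True)
    qed measurable
    also have "\<dots> = (LINT x|lborel. LINT t|lborel. indicator {a..b} x *\<^sub>R iexp (- (t * x)) * char M t)"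
    proof -
      have "integrable (lborel \<Otimes>\<^sub>M lborel) (\<lambda>(t, x). indicator {a..b} x *\<^sub>R iexp (- (t * x)) * char M t)"
      proof (rule lborel_pair.Fubini_integrable)
        have "(LINT x|lborel. norm (indicator {a..b} x *\<^sub>R iexp (- (t * x)) * char M t)) = (b - a) * norm (char M t)" for t
          using ab by (simp add: norm_mult)
        then show "integrable lborel (\<lambda>t. LINT x|lborel. norm (case (t, x) of (t, x) \<Rightarrow>
            indicator {a..b} x *\<^sub>R iexp (- (t * x)) * char M t))"
          using char_int by simp
        have "set_integrable lborel {a..b} (\<lambda>x. iexp (- (t * x)))" for t
          by (intro borel_integrable_atLeastAtMost' continuous_intros)
        then show "AE t in lborel. integrable lborel (\<lambda>x. case (t, x) of (t, x) \<Rightarrow>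
            indicator {a..b} x *\<^sub>R iexp (- (t * x)) * char M t)"
          unfolding set_integrable_def prod.case by (intro AE_I2 integrable_mult_left) blast
      qed measurable
      from lborel_pair.Fubini_integral[OF this] show ?thesis by simp
    qed
    also have "1 / (2 * pi) * \<dots> = (LINT x|lborel. indicator {a..b} x *\<^sub>R H x)"
      unfolding H_char integral_mult_right_zero[symmetric]
      by (intro Bochner_Integration.integral_cong refl) (simp add: scaleR_conv_of_real mult.assoc)
    finally show ?thesis .
  qed
  have int_H: "integrable lborel (\<lambda>x. indicator {a..b} x *\<^sub>R H x)" for a b
    using borel_integrable_atLeastAtMost'[of a b H] H_cont
    by (auto intro!: continuous_at_imp_continuous_on simp: set_integrable_def)
  have Re: "measure M {a<..b} = (LINT x|lborel. indicator {a..b} x *\<^sub>R Re (H x))" if "a \<le> b" for a b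
  proof -
    have "Re (LINT x|lborel. indicator {a..b} x *\<^sub>R H x) = measure M {a<..b}"
      unfolding key[OF that, symmetric] by simp
    then show ?thesis using integral_Re[OF int_H[of a b]] by simp
  qed
  have Im: "(LINT x|lborel. indicator {a..b} x *\<^sub>R Im (H x)) = 0" if "a \<le> b" for a b
  proof -
    have "Im (LINT x|lborel. indicator {a..b} x *\<^sub>R H x) = 0"
      unfolding key[OF that, symmetric] by simp
    then show ?thesis using integral_Im[OF int_H[of a b]] by simp
  qed
  have cont: "isCont (\<lambda>x. Re (H x)) x" "isCont (\<lambda>x. Im (H x)) x" for x
    using H_cont by (auto intro!: continuous_intros)
  have "0 \<le> Im (H x)" for x
    by (rule continuous_nonneg_if_interval_integrals_nonneg[OF cont(2)])
       (simp add: Im[simplified])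
  moreover have "0 \<le> - Im (H x)" for x
    by (rule continuous_nonneg_if_interval_integrals_nonneg) (use Im[simplified] cont(2) in \<open>auto intro!: continuous_intros\<close>)
  ultimately have Im0: "Im (H x) = 0" for x by (simp add: order_antisym)
  have "0 \<le> Re (H x)" for x
    by (rule continuous_nonneg_if_interval_integrals_nonneg[OF cont(1)])
       (simp flip: Re[simplified])
  then have "AE x in lborel. f x = Re (H x)"
    using Re unfolding M_def by (intro density_interval_AE_eq f cont) auto
  then show ?thesis
    unfolding H_def[symmetric] by (rule eventually_mono) (simp add: complex_eq_iff Im0)
qed

text \<open>Exponential tilting: \<open>exp (- (\<sigma> * x)) * f x / c\<close> is a probability
  density whose transform on the imaginary axis is that of \<open>f\<close> on the vertical line
  through \<sigma>, divided by \<open>c\<close>.\<close>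

lemma laplace_inversion_AE:
  fixes f :: "real \<Rightarrow> real"
  assumes nonneg: "\<And>x. 0 \<le> f x" and conv: "laplace_converges f (of_real \<sigma>)"
    and c: "bilateral_laplace f (of_real \<sigma>) = of_real c" "0 < c"
    and int: "integrable lborel (\<lambda>t. bilateral_laplace f (of_real \<sigma> + \<i> * of_real t))"
  shows "AE x in lborel. of_real (f x) =
    of_real (exp (\<sigma> * x) / (2 * pi)) * (LINT t|lborel. iexp (t * x) * bilateral_laplace f (of_real \<sigma> + \<i> * of_real t))"
proof -
  have meas: "f \<in> borel_measurable lebesgue" by (rule laplace_converges_measurable[OF conv])
  obtain f' where f': "f' \<in> borel_measurable borel" "AE x in lebesgue. f x = f' x" "AE x in lborel. f x = f' x"
    using obtain_borel_version[OF meas] by blast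
  \<comment> \<open>A Borel version of \<open>f\<close> may be negative on a null set, which Fourier
    inversion does not allow.\<close>
  define h where "h x = max 0 (f' x)" for x
  have h_meas [measurable]: "h \<in> borel_measurable borel" unfolding h_def using f'(1) by measurable
  have h_AE: "AE x in lebesgue. f x = h x" "AE x in lborel. f x = h x"
    unfolding h_def
    by (rule eventually_mono[OF f'(2)] eventually_mono[OF f'(3)], metis max.absorb2 nonneg)+
  have h_meas': "h \<in> borel_measurable lebesgue"
    by (intro measurable_completion) (simp add: h_meas)
  note cong = laplace_cong_AE[OF h_AE(1) meas h_meas']
  define g where "g x = exp (- (\<sigma> * x)) * h x / c" for x
  have g_meas: "g \<in> borel_measurable borel" unfolding g_def by measurable
  have shift: "exp (- (complex_of_real x * s)) * complex_of_real (g x) =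
      exp (- (complex_of_real x * (of_real \<sigma> + s))) * complex_of_real (h x) / c" for x s
    by (simp add: g_def exp_of_real[symmetric] distrib_left exp_add exp_minus exp_diff
        inverse_mult_distrib divide_inverse mult_ac)
  have B: "bilateral_laplace g s = bilateral_laplace f (of_real \<sigma> + s) / c" for s
    unfolding cong(2) laplace_lborel(2)[OF g_meas] laplace_lborel(2)[OF h_meas] shift
    by (rule integral_divide_zero)
  have g_conv: "laplace_converges g 0"
    using conv unfolding cong(1) laplace_lborel(1)[OF g_meas] laplace_lborel(1)[OF h_meas] shift
    by (intro integrable_divide) simp
  then have g_int: "integrable lborel g"
    unfolding laplace_lborel(1)[OF g_meas] using complex_of_real_integrable_eq[of lborel g] by simp
  have "complex_of_real (LINT x|lborel. g x) = bilateral_laplace g 0"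
    unfolding laplace_lborel(2)[OF g_meas] by simp
  also have "\<dots> = 1" unfolding B using c by simp
  finally have g1: "(LINT x|lborel. g x) = 1" by (simp only: of_real_eq_1_iff)
  have "AE x in lborel. of_real (g x) =
    1 / (2 * pi) * (LINT t|lborel. iexp (t * x) * bilateral_laplace g (\<i> * of_real t))"
  proof (rule fourier_inversion_AE[OF g_meas _ g_int g1])
    show "0 \<le> g x" for x using c(2) by (simp add: g_def h_def)
    show "integrable lborel (\<lambda>t. bilateral_laplace g (\<i> * of_real t))"
      unfolding B using int by (rule integrable_divide)
  qed
  with h_AE(2) show ?thesis
  proof eventually_elim
    case (elim x)
    have "complex_of_real (f x) = of_real (exp (\<sigma> * x) * c) * of_real (g x)"
      using c(2) elim(1) by (simp add: g_def exp_minus del: exp_of_real)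
    also have "\<dots> = of_real (exp (\<sigma> * x) * c) * (1 / (2 * pi) *
        ((LINT t|lborel. iexp (t * x) * bilateral_laplace f (of_real \<sigma> + \<i> * of_real t)) / c))"
      unfolding elim(2) B by (simp only: times_divide_eq_right integral_divide_zero)
    finally show ?case using c(2) by simp
  qed
qed

lemma integrable_inverse_power:
  assumes "\<alpha> > 1"
  shows "integrable lborel (\<lambda>t :: real. (1 + \<bar>t\<bar>) powr (- \<alpha>))"
proof -
  define u where "u x = indicator {1..} x * x powr (- \<alpha>)" for x :: real
  have "((\<lambda>x. x powr (- \<alpha>)) has_integral - (1 powr (- \<alpha> + 1)) / (- \<alpha> + 1)) {1..}"
    using assms by (intro has_integral_powr_to_inf) auto
  moreover have "u = (\<lambda>x. if x \<in> {1..} then x powr (- \<alpha>) else 0)"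
    by (auto simp: fun_eq_iff u_def indicator_def)
  ultimately have "(u has_integral - (1 powr (- \<alpha> + 1)) / (- \<alpha> + 1)) UNIV"
    by (simp only: has_integral_restrict_UNIV)
  then have "has_bochner_integral lborel u (- (1 powr (- \<alpha> + 1)) / (- \<alpha> + 1))"
  proof (intro has_bochner_integral_nn_integral nn_integral_has_integral_lborel)
    show "u \<in> borel_measurable borel" unfolding u_def by measurable
    then show "u \<in> borel_measurable lborel" by simp
    show "AE x in lborel. 0 \<le> u x" "0 \<le> u x" for x by (auto simp: u_def)
    show "0 \<le> - (1 powr (- \<alpha> + 1)) / (- \<alpha> + 1)" using assms by (auto simp: divide_nonneg_neg)
  qed
  then have u: "integrable lborel u" by (simp add: has_bochner_integral_iff)
  show ?thesis
  proof (rule Bochner_Integration.integrable_bound)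
    show "integrable lborel (\<lambda>t. u (1 + t) + u (1 - t))"
      using lborel_integrable_real_affine[OF u, of 1 1] lborel_integrable_real_affine[OF u, of "-1" 1] by simp
    show "AE t in lborel. norm ((1 + \<bar>t\<bar>) powr (- \<alpha>)) \<le> norm (u (1 + t) + u (1 - t))"
      by (intro AE_I2) (auto simp: u_def indicator_def abs_if)
  qed measurable
qed

text \<open>On the imaginary axis the modulus of a power of a linear factor has this form, and so
  has the majorant of the approximating products.\<close>

lemma integrable_quadratic_power:
  assumes "\<alpha> > 1" "c > 0"
  shows "integrable lborel (\<lambda>t :: real. (1 + c * t\<^sup>2) powr (- \<alpha> / 2))"
proof -
  \<comment> \<open>Chosen so that m times the square of \<open>1 + \<bar>t\<bar>\<close>, which is
    at most 2 m times 1 plus the square of t, stays below \<open>1 + c * t\<^sup>2\<close>.\<close>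
  define m where "m = min 1 c / 2"
  have m: "0 < m" "m \<le> 1 / 2" "m \<le> c / 2" using assms by (auto simp: m_def)
  show ?thesis
  proof (rule Bochner_Integration.integrable_bound)
    show "integrable lborel (\<lambda>t. m powr (- \<alpha> / 2) * (1 + \<bar>t\<bar>) powr (- \<alpha>))"
      by (intro integrable_mult_right integrable_inverse_power assms)
    show "AE t in lborel. norm ((1 + c * t\<^sup>2) powr (- \<alpha> / 2)) \<le> norm (m powr (- \<alpha> / 2) * (1 + \<bar>t\<bar>) powr (- \<alpha>))"
    proof (intro AE_I2)
      fix t :: real
      have "(1 + \<bar>t\<bar>)\<^sup>2 \<le> 2 * (1 + t\<^sup>2)"
        using zero_le_power2[of "1 - \<bar>t\<bar>"] by (simp add: power2_eq_square algebra_simps)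
      then have "m * (1 + \<bar>t\<bar>)\<^sup>2 \<le> m * (2 * (1 + t\<^sup>2))" using m by (intro mult_left_mono) auto
      also have "\<dots> = 2 * m + 2 * m * t\<^sup>2" by (simp add: algebra_simps)
      also have "\<dots> \<le> 1 + c * t\<^sup>2" using m by (intro add_mono mult_right_mono) auto
      finally have "(1 + c * t\<^sup>2) powr (- \<alpha> / 2) \<le> (m * (1 + \<bar>t\<bar>)\<^sup>2) powr (- \<alpha> / 2)"
        using m assms by (intro powr_mono2') auto
      also have "\<dots> = m powr (- \<alpha> / 2) * ((1 + \<bar>t\<bar>) powr 2) powr (- \<alpha> / 2)"
        using m by (simp add: powr_mult powr_numeral)
      also have "\<dots> = m powr (- \<alpha> / 2) * (1 + \<bar>t\<bar>) powr (- \<alpha>)" by (simp only: powr_powr) simp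
      finally show "norm ((1 + c * t\<^sup>2) powr (- \<alpha> / 2)) \<le> norm (m powr (- \<alpha> / 2) * (1 + \<bar>t\<bar>) powr (- \<alpha>))"
        by simp
    qed
  qed measurable
qed

section \<open>Gamma densities and the power of the exponential density\<close>

definition gamma_density :: "real \<Rightarrow> real \<Rightarrow> real" where
  "gamma_density \<alpha> x = trunc_pow (\<alpha> - 1) x * exp (- x) / Gamma \<alpha>"

lemma gamma_density_measurable [measurable]: "gamma_density \<alpha> \<in> borel_measurable borel"
  unfolding gamma_density_def trunc_pow_def by measurable

lemma gamma_density_nonneg: "\<alpha> > 0 \<Longrightarrow> 0 \<le> gamma_density \<alpha> x"
  by (simp add: gamma_density_def trunc_pow_nonneg less_imp_le Gamma_real_pos)

lemma gamma_density_laplace_real: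
  assumes "\<alpha> > 0" "r > -1"
  shows "has_bochner_integral lborel (\<lambda>x. exp (- (x * r)) * gamma_density \<alpha> x) ((1 + r) powr (- \<alpha>))"
proof -
  define c where "c = 1 + r"
  have c: "c > 0" using assms by (simp add: c_def)
  have "has_bochner_integral lborel (\<lambda>t. indicator {0..} t * t powr (\<alpha> - 1) / exp t) (Gamma \<alpha>)"
    using assms Gamma_conv_nn_integral_real[of \<alpha>]
    by (intro has_bochner_integral_nn_integral) (auto simp: less_imp_le Gamma_real_pos indicator_def)
  then have "has_bochner_integral lborel (\<lambda>x. indicator {0..} (c * x) * (c * x) powr (\<alpha> - 1) / exp (c * x)) (Gamma \<alpha> / c)"
    using lborel_has_bochner_integral_real_affine_iff[of c "\<lambda>t. indicator {0..} t * t powr (\<alpha> - 1) / exp t" "Gamma \<alpha>" 0] c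
    by (simp add: divide_inverse mult.commute)
  then have "has_bochner_integral lborel (\<lambda>x. c powr (1 - \<alpha>) / Gamma \<alpha> * (indicator {0..} (c * x) * (c * x) powr (\<alpha> - 1) / exp (c * x)))
      (c powr (1 - \<alpha>) / Gamma \<alpha> * (Gamma \<alpha> / c))"
    by (rule has_bochner_integral_mult_right)
  moreover have "c powr (1 - \<alpha>) / Gamma \<alpha> * (indicator {0..} (c * x) * (c * x) powr (\<alpha> - 1) / exp (c * x)) =
      exp (- (x * r)) * gamma_density \<alpha> x" for x
  proof -
    have "c powr (1 - \<alpha>) * (c * x) powr (\<alpha> - 1) = x powr (\<alpha> - 1)" if "x > 0"
      using c that by (simp add: powr_mult powr_add[symmetric] mult.assoc[symmetric])
    moreover have "exp (- (x * r)) * exp (- x) = inverse (exp (c * x))"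
      by (simp add: c_def exp_add[symmetric] exp_minus[symmetric] algebra_simps)
    ultimately show ?thesis
      using c by (cases "x > 0"; cases "x = 0")
        (auto simp: gamma_density_def trunc_pow_def indicator_def zero_le_mult_iff divide_inverse mult_ac)
  qed
  moreover have "c powr (1 - \<alpha>) / Gamma \<alpha> * (Gamma \<alpha> / c) = c powr (- \<alpha>)"
    using c Gamma_real_pos[OF assms(1)] by (simp add: powr_diff powr_minus field_simps)
  ultimately show ?thesis by (simp add: c_def)
qed

text \<open>For real \<open>s\<close> a substitution in Euler's integral gives the value. Both sides
  are holomorphic for \<open>Re s > -1\<close> and agree at the real points, hence
  everywhere.\<close>

lemma gamma_density_laplace:
  assumes "\<alpha> > 0" "Re s > -1"
  shows "laplace_converges (gamma_density \<alpha>) s"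
    and "bilateral_laplace (gamma_density \<alpha>) s = exp (- (of_real \<alpha> * Ln (1 + s)))"
proof -
  have conv_real: "laplace_converges (gamma_density \<alpha>) (of_real r)"
    and real: "bilateral_laplace (gamma_density \<alpha>) (of_real r) = of_real ((1 + r) powr (- \<alpha>))" if "r > -1" for r
  proof -
    have eq: "exp (- (complex_of_real x * of_real r)) * complex_of_real (gamma_density \<alpha> x) =
        complex_of_real (exp (- (x * r)) * gamma_density \<alpha> x)" for x
      by (simp add: exp_of_real[symmetric])
    show "laplace_converges (gamma_density \<alpha>) (of_real r)"
      "bilateral_laplace (gamma_density \<alpha>) (of_real r) = of_real ((1 + r) powr (- \<alpha>))"
      unfolding laplace_lborel[OF gamma_density_measurable] eq
      using gamma_density_laplace_real[OF assms(1) that]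
      by (auto simp: has_bochner_integral_iff simp del: of_real_mult of_real_exp)
  qed
  have conv: "laplace_converges (gamma_density \<alpha>) w" if "Re w > -1" for w
    by (rule laplace_converges_Re_cong[OF conv_real[OF that]]) simp
  then show "laplace_converges (gamma_density \<alpha>) s" using assms by simp
  define H where "H = {w. Re w > -1}"
  have H: "open H" "convex H" unfolding H_def by (auto simp: open_halfspace_Re_gt convex_halfspace_Re_gt)
  have strip: "H \<subseteq> laplace_strip (gamma_density \<alpha>)"
    unfolding laplace_strip_def using conv H(1) by (intro interior_maximal) (auto simp: H_def)
  define D where "D w = bilateral_laplace (gamma_density \<alpha>) w - exp (- (of_real \<alpha> * Ln (1 + w)))" for w
  have "D s = 0"
  proof (rule analytic_continuation[of D H "complex_of_real ` {-1<..}" 0])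
    have "1 + w \<notin> \<real>\<^sub>\<le>\<^sub>0" if "w \<in> H" for w
      using that by (auto simp: H_def complex_nonpos_Reals_iff)
    then show "D holomorphic_on H"
      unfolding D_def
      by (intro holomorphic_intros holomorphic_on_subset[OF bilateral_laplace_holomorphic strip]) auto
    show "0 islimpt complex_of_real ` {-1<..}"
    proof (subst islimpt_sequential, intro exI conjI allI)
      fix n
      show "complex_of_real (1 / real (Suc n)) \<in> complex_of_real ` {-1<..} - {0}"
      proof (intro DiffI imageI)
        have "0 < 1 / real (Suc n)" by simp
        then show "1 / real (Suc n) \<in> {-1<..}" unfolding greaterThan_iff by linarith
      qed (simp del: of_nat_Suc)
      show "(\<lambda>n. complex_of_real (1 / real (Suc n))) \<longlonglongrightarrow> 0"
        using tendsto_of_real[OF LIMSEQ_inverse_real_of_nat, where ?'a = complex]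
        by (simp add: inverse_eq_divide)
    qed
    show "D w = 0" if w: "w \<in> complex_of_real ` {-1<..}" for w
    proof -
      obtain r where r: "w = of_real r" "r > -1" using w by auto
      have "Ln (1 + of_real r) = of_real (ln (1 + r))" using r(2) Ln_of_real[of "1 + r"] by simp
      then show ?thesis
        using r by (simp add: D_def real powr_def exp_of_real[symmetric])
    qed
  qed (use H assms in \<open>auto simp: H_def convex_connected\<close>)
  then show "bilateral_laplace (gamma_density \<alpha>) s = exp (- (of_real \<alpha> * Ln (1 + s)))"
    by (simp add: D_def)
qed

lemma isCont_gamma_density:
  assumes "\<alpha> > 1"
  shows "isCont (gamma_density \<alpha>) x"
proof -
  have eq: "gamma_density \<alpha> = (\<lambda>x. (max 0 x) powr (\<alpha> - 1) * exp (- x) / Gamma \<alpha>)"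
    by (auto simp: fun_eq_iff gamma_density_def trunc_pow_def max_def)
  have "isCont (\<lambda>x. (max 0 x) powr (\<alpha> - 1)) x"
    unfolding isCont_def using assms by (intro tendsto_powr2 tendsto_intros) auto
  moreover have "Gamma \<alpha> > 0" using assms by (intro Gamma_real_pos) simp
  then have "Gamma \<alpha> \<noteq> 0" by simp
  ultimately have "isCont (\<lambda>x. (max 0 x) powr (\<alpha> - 1) * exp (- x) / Gamma \<alpha>) x"
    by (intro isCont_divide isCont_mult) auto
  then show ?thesis unfolding eq .
qed

lemma gamma_density_bounded:
  assumes "\<alpha> > 1"
  shows "\<bar>gamma_density \<alpha> x\<bar> \<le> (\<alpha> - 1) powr (\<alpha> - 1) / Gamma \<alpha>"
proof -
  define \<beta> where "\<beta> = \<alpha> - 1"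
  have \<beta>: "\<beta> > 0" using assms by (simp add: \<beta>_def)
  have "trunc_pow \<beta> x * exp (- x) \<le> \<beta> powr \<beta>"
  proof (cases "x > 0")
    case True
    \<comment> \<open>Raised to the power \<beta> and multiplied by \<open>exp (- x)\<close>, this
      yields the bound \<open>\<beta> powr \<beta>\<close>, cruder than the maximum at x = \<beta>
      but elementary.\<close>
    have "x / \<beta> \<le> exp (x / \<beta>)" using exp_ge_add_one_self[of "x / \<beta>"] by linarith
    then have "x powr \<beta> \<le> (\<beta> * exp (x / \<beta>)) powr \<beta>"
      using True \<beta> by (intro powr_mono2) (auto simp: field_simps)
    also have "\<dots> = \<beta> powr \<beta> * exp (x / \<beta>) powr \<beta>" by (rule powr_mult)
    also have "exp (x / \<beta>) powr \<beta> = exp x" using \<beta> by (simp add: powr_def)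
    finally have "x powr \<beta> * exp (- x) \<le> \<beta> powr \<beta> * exp x * exp (- x)" by (rule mult_right_mono) simp
    then show ?thesis using True by (simp add: trunc_pow_def exp_minus field_simps)
  qed (simp add: trunc_pow_def)
  then show ?thesis
    using assms Gamma_real_pos[of \<alpha>] trunc_pow_nonneg[of \<beta> x]
    by (simp add: gamma_density_def \<beta>_def abs_mult divide_right_mono)
qed

lemma TN_gamma_density:
  assumes "\<alpha> > real p - 1" "\<alpha> > 0"
  shows "TN p (gamma_density \<alpha>)"
proof -
  have "TN p (\<lambda>x. exp (- 1 * x) * trunc_pow (\<alpha> - 1) x)"
    using assms by (intro TN_mult_exp TN_trunc_pow) auto
  then have "TN p (\<lambda>x. 1 / Gamma \<alpha> * (exp (- 1 * (x / 1)) * trunc_pow (\<alpha> - 1) (x / 1)))"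
    using assms Gamma_real_pos[of \<alpha>] by (intro TN_rescale) (auto simp: less_imp_le)
  then show ?thesis by (simp add: gamma_density_def[abs_def] mult.commute)
qed

lemma lambda1_AE_gamma_density: "AE x in lborel. lambda1 x = gamma_density 1 x"
proof -
  have "AE x in lborel. x \<noteq> (0 :: real)" by (rule AE_lborel_singleton)
  then show ?thesis
    by eventually_elim (auto simp: lambda1_def gamma_density_def trunc_pow_def)
qed

lemma lambda1_laplace:
  assumes "Re s > -1"
  shows "laplace_converges lambda1 s" "bilateral_laplace lambda1 s = exp (- Ln (1 + s))"
proof -
  have "lambda1 \<in> borel_measurable borel" unfolding lambda1_def by measurable
  then have "lambda1 \<in> borel_measurable lebesgue" "gamma_density 1 \<in> borel_measurable lebesgue"
    by (auto intro!: measurable_completion)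
  moreover have "AE x in lebesgue. lambda1 x = gamma_density 1 x"
    using lambda1_AE_gamma_density by (simp add: AE_completion_iff)
  ultimately show "laplace_converges lambda1 s" "bilateral_laplace lambda1 s = exp (- Ln (1 + s))"
    using gamma_density_laplace[of 1 s] assms laplace_cong_AE[of lambda1 "gamma_density 1" s] by auto
qed

lemma polya_frequency_lambda1: "polya_frequency lambda1"
  unfolding polya_frequency_def totally_nonneg_def
proof (intro conjI allI impI totally_nonneg_lambda1)
  show "integrable lebesgue lambda1"
    unfolding laplace_converges_0_iff[symmetric] by (rule lambda1_laplace) simp
  show "\<exists>x y. x \<noteq> y \<and> lambda1 x \<noteq> 0 \<and> lambda1 y \<noteq> 0"
    by (intro exI[of _ 0] exI[of _ 1]) (simp add: lambda1_def)
qed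

lemma one_sided_lambda1: "one_sided lambda1"
  unfolding one_sided_def lambda1_def by (intro exI[of _ 0]) auto

section \<open>Uniqueness of logarithms and powers; the converse direction\<close>

text \<open>The exponential of the difference is constantly 1; since an exponential never vanishes,
  the derivative of the difference does.\<close>

lemma holomorphic_log_diff_constant:
  assumes T: "open T" "convex T"
    and L: "L holomorphic_on T" and K: "K holomorphic_on T"
    and eq: "\<And>s. s \<in> T \<Longrightarrow> exp (L s) = exp (K s)"
  shows "\<exists>c. \<forall>s\<in>T. L s = K s + c"
proof -
  define d where "d s = L s - K s" for s
  have exp_d: "exp (d s) = 1" if "s \<in> T" for s
    using eq[OF that] by (simp add: d_def exp_diff)
  have d_holo: "d holomorphic_on T"
    unfolding d_def using L K by (intro holomorphic_intros)
  have "(d has_field_derivative 0) (at s within T)" if s: "s \<in> T" for s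
  proof -
    obtain D where D: "(d has_field_derivative D) (at s)"
      using d_holo s unfolding holomorphic_on_open[OF T(1)] by blast
    have "((\<lambda>s. exp (d s)) has_field_derivative exp (d s) * D) (at s)"
      by (rule DERIV_chain2[OF DERIV_exp D])
    moreover have "((\<lambda>s. exp (d s)) has_field_derivative 0) (at s)"
      by (rule has_field_derivative_transform_within_open[OF _ T(1) s, of "\<lambda>_. 1"]) (simp_all add: exp_d)
    ultimately have "exp (d s) * D = 0" by (rule DERIV_unique)
    then show ?thesis using D by (simp add: has_field_derivative_at_within)
  qed
  then obtain c where "\<And>s. s \<in> T \<Longrightarrow> d s = c"
    using has_field_derivative_zero_constant[OF T(2), of d] by blast
  then have "\<forall>s\<in>T. L s = K s + c" by (auto simp: d_def algebra_simps)
  then show ?thesis ..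
qed

lemma holomorphic_log_unique:
  assumes T: "open T" "convex T" "x0 \<in> T"
    and L: "L holomorphic_on T" and K: "K holomorphic_on T"
    and eq: "\<And>s. s \<in> T \<Longrightarrow> exp (L s) = exp (K s)" "L x0 = K x0"
    and s: "s \<in> T"
  shows "L s = K s"
proof -
  obtain c where c: "\<forall>s\<in>T. L s = K s + c"
    using holomorphic_log_diff_constant[OF T(1,2) L K eq(1)] by blast
  then have "c = 0" using T(3) eq(2) by simp
  then show ?thesis using c s by simp
qed

text \<open>The logarithm behind \<open>G\<close> and \<open>K\<close> differ by a constant
  \<open>c\<close> with \<open>exp c = 1\<close>, so the two powers differ by a unimodular factor,
  which positivity at 0 makes equal to 1.\<close>

lemma positive_power_unique:
  assumes G: "positive_power_on S F \<alpha> G" and T: "open T" "convex T" "0 \<in> T" "T \<subseteq> S"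
    and K: "K holomorphic_on T" "\<And>s. s \<in> T \<Longrightarrow> exp (K s) = F s" "K 0 = 0"
    and s: "s \<in> T"
  shows "G s = exp (of_real \<alpha> * K s)"
proof -
  obtain L where L: "L holomorphic_on S" "\<And>s. s \<in> S \<Longrightarrow> exp (L s) = F s" "\<And>s. s \<in> S \<Longrightarrow> G s = exp (of_real \<alpha> * L s)"
    using G unfolding positive_power_on_def by blast
  obtain c where c: "\<forall>s\<in>T. L s = K s + c"
    using holomorphic_log_diff_constant[OF T(1,2) holomorphic_on_subset[OF L(1) T(4)] K(1)] L(2) K(2) T(4)
    by (metis subsetD)
  have Gc: "G s = exp (of_real \<alpha> * c) * exp (of_real \<alpha> * K s)" if "s \<in> T" for s
    using L(3)[of s] c that T(4) by (auto simp: distrib_left exp_add mult.commute)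
  have "exp c = 1" using L(2)[of 0] K(2)[of 0] K(3) c T(3,4) by (auto simp: subset_iff)
  then have "Re c = 0" by (metis norm_exp_eq_Re exp_eq_one_iff norm_one)
  then have norm1: "norm (exp (of_real \<alpha> * c)) = 1" by simp
  have "of_real 0 \<in> S" using T by auto
  then obtain q :: real where q: "q > 0" "G (of_real 0) = of_real q"
    using G unfolding positive_power_on_def by blast
  then have "exp (of_real \<alpha> * c) = of_real q"
    using Gc[OF T(3)] K(3) by simp
  moreover from this norm1 q have "q = 1" by simp
  ultimately show ?thesis using Gc[OF s] by simp
qed

lemma norm_cpower:
  assumes "Re (1 + w) > 0"
  shows "norm (exp (- (of_real \<alpha> * Ln (1 + w)))) = norm (1 + w) powr (- \<alpha>)"
proof -
  have "1 + w \<noteq> 0" using assms by (metis less_irrefl zero_complex.simps(1))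
  then show ?thesis by (simp add: powr_def)
qed

lemma not_TN_gamma_density:
  assumes "real k + 1 < \<alpha>" "\<alpha> < real k + 2" "k + 3 \<le> p"
  shows "\<not> TN p (gamma_density \<alpha>)"
proof
  assume "TN p (gamma_density \<alpha>)"
  then have "TN p (\<lambda>x. exp (1 * x) * gamma_density \<alpha> x)" by (rule TN_mult_exp)
  then have "TN p (\<lambda>x. Gamma \<alpha> * (exp (1 * (x / 1)) * gamma_density \<alpha> (x / 1)))"
    using assms Gamma_real_pos[of \<alpha>] by (intro TN_rescale) (auto simp: less_imp_le)
  moreover have "Gamma \<alpha> * (exp (1 * (x / 1)) * gamma_density \<alpha> (x / 1)) = trunc_pow (\<alpha> - 1) x" for x
    using Gamma_real_pos[of \<alpha>] assms by (cases "Gamma \<alpha> = 0") (auto simp: gamma_density_def exp_minus)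
  ultimately have "TN p (trunc_pow (\<alpha> - 1))" by simp
  then have TN: "0 \<le> fdet (k + 3) (\<lambda>i j. trunc_pow (\<alpha> - 1) (x i - y j))"
    if "strict_mono_on {..<k + 3} x" "strict_mono_on {..<k + 3} y" for x y
    using that assms(3) by (intro TN_fdet)
  obtain x y where "strict_mono_on {..<k + 3} x" "strict_mono_on {..<k + 3} y"
    "fdet (k + 3) (\<lambda>i j. trunc_pow (\<alpha> - 1) (x i - y j)) < 0"
    using trunc_pow_not_TN[of k "\<alpha> - 1"] assms(1,2) by auto
  with TN[of x y] show False by simp
qed

text \<open>On the imaginary axis \<open>M\<close> and the gamma density have the same transform,
  integrable because \<alpha> > 1, so inversion makes them equal almost everywhere; continuity of
  the density then transfers the minors. The exponent \<alpha> - 1 lies strictly between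
  \<open>k\<close> and k + 1, and the order k + 3 of a negative minor is at most
  \<open>p\<close>.\<close>

lemma power_lambda1_TN_imp:
  assumes "p \<ge> 2" "\<alpha> \<ge> 1" "power_is_TN_laplace p \<alpha> lambda1"
  shows "\<alpha> \<in> real ` {n. n > 0} \<union> {real p - 1<..}"
proof (rule ccontr)
  assume contra: "\<alpha> \<notin> real ` {n. n > 0} \<union> {real p - 1<..}"
  define k where "k = nat \<lfloor>\<alpha> - 1\<rfloor>"
  have nonint: "\<alpha> \<noteq> real n" if "n > 0" for n using contra that by auto
  have k_le: "real k \<le> \<alpha> - 1" "\<alpha> - 1 < real k + 1"
    using assms(2) by (auto simp: k_def)
  have k: "real k + 1 < \<alpha>" "\<alpha> < real k + 2"
    using k_le nonint[of "k + 1"] by auto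
  \<comment> \<open>Equality is excluded because p - 1 is itself a positive integer.\<close>
  have "\<alpha> < real p - 1"
    using contra nonint[of "p - 1"] assms(1) by (auto simp: of_nat_diff)
  then have "real k + 2 < real p" using k by simp
  then have kp: "k + 3 \<le> p" by simp
  have \<alpha>: "\<alpha> > 1" using k by simp
  obtain G M where G: "positive_power_on (laplace_strip lambda1) (bilateral_laplace lambda1) \<alpha> G"
    and M: "TN p M" "laplace_transform_of_on (laplace_strip lambda1) G M"
    using assms(3) unfolding power_is_TN_laplace_def by blast
  define H where "H = {w. Re w > -1}"
  have H: "open H" "convex H" "0 \<in> H"
    unfolding H_def by (auto simp: open_halfspace_Re_gt convex_halfspace_Re_gt)
  have strip: "H \<subseteq> laplace_strip lambda1"
    unfolding laplace_strip_def using lambda1_laplace(1) H(1) by (intro interior_maximal) (auto simp: H_def)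
  have "1 + w \<notin> \<real>\<^sub>\<le>\<^sub>0" if "w \<in> H" for w
    using that by (auto simp: H_def complex_nonpos_Reals_iff)
  then have "(\<lambda>s. - Ln (1 + s)) holomorphic_on H" by (intro holomorphic_intros) auto
  then have G_eq: "G s = exp (of_real \<alpha> * - Ln (1 + s))" if "s \<in> H" for s
    using H strip that lambda1_laplace(2) by (intro positive_power_unique[OF G, of H]) (auto simp: H_def)
  have B: "bilateral_laplace M (\<i> * of_real t) = exp (- (of_real \<alpha> * Ln (1 + \<i> * of_real t)))" for t
  proof -
    have "\<i> * of_real t \<in> H" by (simp add: H_def)
    then show ?thesis
      using M(2) strip G_eq[of "\<i> * of_real t"] unfolding laplace_transform_of_on_def by auto
  qed
  have B_gamma: "bilateral_laplace (gamma_density \<alpha>) (\<i> * of_real t) = exp (- (of_real \<alpha> * Ln (1 + \<i> * of_real t)))" for t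
    using \<alpha> by (intro gamma_density_laplace) auto
  have "integrable lborel (\<lambda>t. exp (- (complex_of_real \<alpha> * Ln (1 + \<i> * complex_of_real t))))"
  proof (rule Bochner_Integration.integrable_bound[OF integrable_quadratic_power[OF \<alpha>, of 1]])
    have "norm (exp (- (complex_of_real \<alpha> * Ln (1 + \<i> * complex_of_real t)))) = (1 + 1 * t\<^sup>2) powr (- \<alpha> / 2)" for t
      by (subst norm_cpower) (simp_all add: cmod_def powr_half_sqrt[symmetric] powr_powr)
    then show "AE t in lborel. norm (exp (- (complex_of_real \<alpha> * Ln (1 + \<i> * complex_of_real t)))) \<le> norm ((1 + 1 * t\<^sup>2) powr (- \<alpha> / 2))"
      by simp
  qed measurable
  then have int: "integrable lborel (\<lambda>t. bilateral_laplace M (of_real 0 + \<i> * of_real t))"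
    "integrable lborel (\<lambda>t. bilateral_laplace (gamma_density \<alpha>) (of_real 0 + \<i> * of_real t))"
    by (simp_all add: B B_gamma)
  have "AE x in lborel. of_real (M x) = of_real (exp (0 * x) / (2 * pi)) *
      (LINT t|lborel. iexp (t * x) * bilateral_laplace M (of_real 0 + \<i> * of_real t))"
  proof (rule laplace_inversion_AE[where c = 1])
    show "0 \<le> M x" for x using M(1) assms(1) by (intro TN_nonneg[of p]) auto
    show "laplace_converges M (of_real 0)"
      using M(2) strip H(3) unfolding laplace_transform_of_on_def by auto
    show "bilateral_laplace M (of_real 0) = of_real 1" using B[of 0] by simp
  qed (use int in simp_all)
  moreover have "AE x in lborel. of_real (gamma_density \<alpha> x) = of_real (exp (0 * x) / (2 * pi)) *
      (LINT t|lborel. iexp (t * x) * bilateral_laplace (gamma_density \<alpha>) (of_real 0 + \<i> * of_real t))"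
  proof (rule laplace_inversion_AE[where c = 1])
    show "0 \<le> gamma_density \<alpha> x" for x using \<alpha> by (intro gamma_density_nonneg) auto
    show "laplace_converges (gamma_density \<alpha>) (of_real 0)" using \<alpha> by (intro gamma_density_laplace) auto
    show "bilateral_laplace (gamma_density \<alpha>) (of_real 0) = of_real 1" using B_gamma[of 0] by simp
  qed (use int in simp_all)
  ultimately have "AE x in lborel. M x = gamma_density \<alpha> x"
    by eventually_elim (simp add: B B_gamma flip: of_real_eq_iff[where ?'a = complex])
  \<comment> \<open>The constant sequence turns almost everywhere equality into almost everywhere
    convergence.\<close>
  then have "AE x in lborel. (\<lambda>m :: nat. M x) \<longlonglongrightarrow> gamma_density \<alpha> x"
    by (rule eventually_mono) simp
  then have "TN p (gamma_density \<alpha>)"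
    using isCont_gamma_density[OF \<alpha>] by (intro TN_AE_limit[OF M(1)]) auto
  then show False using not_TN_gamma_density[OF k kp] by contradiction
qed

section \<open>Decay of integrable totally nonnegative functions\<close>

text \<open>By log-concavity the geometric mean of \<open>f s\<close> and \<open>f t\<close> is at
  most that of \<open>f u\<close> and \<open>f (s + t - u)\<close>, hence at most their arithmetic
  mean. Integrating over u between s and t bounds t - s times the geometric mean by the total
  mass.\<close>

lemma TN_mult_gap_le:
  assumes f: "TN p f" "p \<ge> 2" "integrable lebesgue f" and st: "s < t"
  shows "f s * f t * (t - s)\<^sup>2 \<le> (LINT x|lebesgue. f x)\<^sup>2"
proof -
  have nonneg: "0 \<le> f x" for x using f by (intro TN_nonneg[of p]) auto
  define q where "q = sqrt (f s * f t)"
  have refl: "(LINT u|lebesgue. f (s + t - u)) = (LINT u|lebesgue. f u)"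
    using lebesgue_integral_real_affine[of "-1" f "s + t"] by simp
  have le: "q \<le> (f u + f (s + t - u)) / 2" if "s \<le> u" "u \<le> t" for u
  proof -
    have "f s * f t \<le> f u * f (s + t - u)"
      using TN_2_interchange[OF f(1,2), of "u - s" t s] that by (simp add: algebra_simps)
    then have "q \<le> sqrt (f u * f (s + t - u))" unfolding q_def by simp
    also have "\<dots> \<le> (f u + f (s + t - u)) / 2" using nonneg by (intro arith_geo_mean_sqrt)
    finally show ?thesis .
  qed
  have "(t - s) * q = (LINT u|lebesgue. indicator {s..t} u * q)"
    using st by simp
  also have "\<dots> \<le> (LINT u|lebesgue. (f u + f (s + t - u)) / 2)"
  proof (rule integral_mono)
    show "integrable lebesgue (\<lambda>u. indicator {s..t} u * q)"
      by (intro integrable_mult_left integrable_real_indicator) (auto simp: emeasure_lborel_Icc_eq)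
    show "integrable lebesgue (\<lambda>u. (f u + f (s + t - u)) / 2)"
      using f(3) integrable_lebesgue_reflect[OF f(3)] by auto
    show "indicator {s..t} u * q \<le> (f u + f (s + t - u)) / 2" for u
      using le[of u] nonneg[of u] nonneg[of "s + t - u"] by (auto simp: indicator_def)
  qed
  also have "\<dots> = (LINT u|lebesgue. f u)"
    using f(3) integrable_lebesgue_reflect[OF f(3)] by (simp add: refl)
  finally have "((t - s) * q)\<^sup>2 \<le> (LINT u|lebesgue. f u)\<^sup>2"
    using st nonneg by (intro power_mono) (auto simp: q_def)
  then show ?thesis using nonneg by (simp add: power_mult_distrib q_def mult.commute)
qed

text \<open>Every point is at distance at least d / 2 from \<open>a\<close> or from
  \<open>b\<close>, and the gap estimate applies to that pair.\<close>

lemma TN_integrable_bounded: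
  assumes f: "TN p f" "p \<ge> 2" "integrable lebesgue f" and ab: "a \<noteq> b" "f a \<noteq> 0" "f b \<noteq> 0"
  shows "\<exists>C. \<forall>x. f x \<le> C"
proof -
  have nonneg: "0 \<le> f x" for x using f by (intro TN_nonneg[of p]) auto
  define I where "I = (LINT x|lebesgue. f x)"
  define d where "d = \<bar>a - b\<bar>"
  have d: "d > 0" using ab by (simp add: d_def)
  have pos: "f a > 0" "f b > 0" using ab nonneg[of a] nonneg[of b] by auto
  have sym: "f x * f t * (x - t)\<^sup>2 \<le> I\<^sup>2" if "x \<noteq> t" for x t
    using TN_mult_gap_le[OF f, of x t] TN_mult_gap_le[OF f, of t x] that
    by (cases "x < t") (auto simp: I_def mult.commute power2_commute)
  have far: "f x \<le> 4 * I\<^sup>2 / d\<^sup>2 / f t" if "\<bar>x - t\<bar> \<ge> d / 2" "f t > 0" for x t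
  proof -
    have "x \<noteq> t" using that d by auto
    have "(d / 2)\<^sup>2 \<le> (x - t)\<^sup>2" using that d by (intro abs_le_square_iff[THEN iffD1]) simp
    then have "f x * f t * (d / 2)\<^sup>2 \<le> f x * f t * (x - t)\<^sup>2"
      using nonneg by (intro mult_left_mono) auto
    also note sym[OF \<open>x \<noteq> t\<close>]
    finally have "f x * (f t * (d / 2)\<^sup>2) \<le> I\<^sup>2" by (simp only: mult.assoc)
    then have "f x \<le> I\<^sup>2 / (f t * (d / 2)\<^sup>2)"
      using that d by (subst pos_le_divide_eq) auto
    also have "\<dots> = 4 * I\<^sup>2 / d\<^sup>2 / f t" by (simp add: power_divide mult.commute)
    finally show ?thesis .
  qed
  have "f x \<le> 4 * I\<^sup>2 / d\<^sup>2 / f a + 4 * I\<^sup>2 / d\<^sup>2 / f b" for x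
  proof -
    have nn: "0 \<le> 4 * I\<^sup>2 / d\<^sup>2 / f a" "0 \<le> 4 * I\<^sup>2 / d\<^sup>2 / f b" using pos by auto
    have "d \<le> \<bar>x - a\<bar> + \<bar>x - b\<bar>" unfolding d_def by arith
    then have "\<bar>x - a\<bar> \<ge> d / 2 \<or> \<bar>x - b\<bar> \<ge> d / 2" by linarith
    then show ?thesis using far[of x a] far[of x b] pos nn by linarith
  qed
  then show ?thesis by blast
qed

lemma TN_halving_step:
  assumes f: "TN p f" "p \<ge> 2" "integrable lebesgue f" and a: "f a \<noteq> 0"
  shows "\<exists>h>0. \<forall>x\<ge>a. f (x + h) \<le> f x / 2"
proof -
  have nonneg: "0 \<le> f x" for x using f by (intro TN_nonneg[of p]) auto
  have pos: "f a > 0" using a nonneg[of a] by simp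
  define I where "I = (LINT x|lebesgue. f x)"
  have I: "I \<ge> 0" unfolding I_def using nonneg by simp
  \<comment> \<open>Chosen so that the mass \<open>I\<close> is at most \<open>f a * h / 2\<close>;
    the gap estimate then gives even a quarter of \<open>f a\<close> at \<open>a + h\<close>. The
    summand 1 keeps \<open>h\<close> positive.\<close>
  define h where "h = 2 * I / f a + 1"
  have h: "h > 0" using I pos by (simp add: h_def add_nonneg_pos)
  have "f a * f (a + h) * h\<^sup>2 \<le> I\<^sup>2"
    using TN_mult_gap_le[OF f, of a "a + h"] h by (simp add: I_def)
  also have "I\<^sup>2 \<le> (f a * h / 2)\<^sup>2"
    using I pos by (intro power_mono) (auto simp: h_def field_simps)
  also have "\<dots> = f a * (f a / 4) * h\<^sup>2" by (simp add: power2_eq_square)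
  finally have half: "f (a + h) \<le> f a / 2" using pos h nonneg[of "a + h"] by simp
  have "f (x + h) \<le> f x / 2" if "x \<ge> a" for x
  proof -
    \<comment> \<open>By log-concavity the relative decrease over a step \<open>h\<close> is at
      least as strong at \<open>x\<close> as at \<open>a\<close>.\<close>
    have "f a * f (x + h) \<le> f (a + h) * f x"
      using TN_2_interchange[OF f(1,2), of h "x + h" a] h that by (simp add: algebra_simps)
    also have "\<dots> \<le> f a / 2 * f x" using half nonneg by (intro mult_right_mono)
    finally show ?thesis using pos by simp
  qed
  then show ?thesis using h by blast
qed

lemma TN_exponential_decay_right:
  assumes f: "TN p f" "p \<ge> 2" "integrable lebesgue f" and a: "f a \<noteq> 0"
    and C: "\<And>x. f x \<le> C"
  shows "\<exists>\<epsilon>>0. \<exists>K. \<forall>x. f x \<le> K * exp (- (\<epsilon> * x))"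
proof -
  have nonneg: "0 \<le> f x" for x using f by (intro TN_nonneg[of p]) auto
  have C0: "C \<ge> 0" using nonneg[of a] C[of a] by linarith
  obtain h where h: "h > 0" "\<And>x. x \<ge> a \<Longrightarrow> f (x + h) \<le> f x / 2"
    using TN_halving_step[OF f a] by blast
  have step: "f x \<le> C / 2 ^ k" if "x \<ge> a + real k * h" for k x
    using that
  proof (induction k arbitrary: x)
    case (Suc k)
    have "x - h \<ge> a + real k * h" using Suc.prems by (simp add: algebra_simps)
    then have "f (x - h) \<le> C / 2 ^ k" by (rule Suc.IH)
    moreover have "f (x - h + h) \<le> f (x - h) / 2"
      using \<open>x - h \<ge> a + real k * h\<close> h(1)
      by (intro h(2)) (meson mult_nonneg_nonneg of_nat_0_le_iff less_imp_le le_add_same_cancel1 order_trans)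
    ultimately have "f x \<le> C / 2 ^ k / 2" by simp
    then show ?case by (simp add: mult.commute)
  qed (use C in simp)
  define \<epsilon> where "\<epsilon> = ln 2 / h"
  have \<epsilon>: "\<epsilon> > 0" using h by (simp add: \<epsilon>_def)
  \<comment> \<open>The factor 2 absorbs the rounding of \<open>(x - a) / h\<close> down to an
    integer.\<close>
  have "f x \<le> 2 * C * exp (\<epsilon> * a) * exp (- (\<epsilon> * x))" for x
  proof (cases "x \<ge> a")
    case True
    define k where "k = nat \<lfloor>(x - a) / h\<rfloor>"
    have k: "real k \<le> (x - a) / h" "(x - a) / h < real k + 1"
      using True h(1) by (auto simp: k_def)
    have "f x \<le> C / 2 ^ k" using k(1) h(1) by (intro step) (simp add: field_simps)
    also have "C / 2 ^ k = C * exp (- (ln 2 * real k))"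
      by (simp add: exp_minus exp_of_nat2_mult divide_inverse)
    also have "\<dots> \<le> C * exp (ln 2 - \<epsilon> * (x - a))"
    proof -
      have "ln 2 * ((x - a) / h) \<le> ln 2 * (real k + 1)" using k(2) by (intro mult_left_mono) auto
      then have "- (ln 2 * real k) \<le> ln 2 - \<epsilon> * (x - a)" by (simp add: \<epsilon>_def algebra_simps)
      then show ?thesis using C0 by (intro mult_left_mono) auto
    qed
    also have "exp (ln 2 - \<epsilon> * (x - a)) = exp (ln 2) * exp (\<epsilon> * a) * exp (- (\<epsilon> * x))"
      unfolding exp_add[symmetric] by (simp add: algebra_simps)
    also have "C * \<dots> = 2 * C * exp (\<epsilon> * a) * exp (- (\<epsilon> * x))" by simp
    finally show ?thesis .
  next
    case False
    have "C * 1 \<le> C * (2 * exp (\<epsilon> * (a - x)))"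
    proof (rule mult_left_mono[OF _ C0])
      have "exp (\<epsilon> * (a - x)) \<ge> 1" using False \<epsilon> by simp
      then show "1 \<le> 2 * exp (\<epsilon> * (a - x))" by linarith
    qed
    also have "exp (\<epsilon> * (a - x)) = exp (\<epsilon> * a) * exp (- (\<epsilon> * x))"
      unfolding exp_add[symmetric] by (simp add: algebra_simps)
    finally show ?thesis using C[of x] by simp
  qed
  then show ?thesis using \<epsilon> by blast
qed

lemma TN_exponential_decay:
  assumes f: "TN p f" "p \<ge> 2" "integrable lebesgue f" and ab: "a \<noteq> b" "f a \<noteq> 0" "f b \<noteq> 0"
  shows "\<exists>\<epsilon>>0. \<exists>K. \<forall>x. f x \<le> K * exp (- (\<epsilon> * \<bar>x\<bar>))"
proof -
  have nonneg: "0 \<le> f x" for x using f by (intro TN_nonneg[of p]) auto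
  obtain C where C: "\<And>x. f x \<le> C" using TN_integrable_bounded[OF f ab] by blast
  obtain \<epsilon>1 K1 where 1: "\<epsilon>1 > 0" "\<And>x. f x \<le> K1 * exp (- (\<epsilon>1 * x))"
    using TN_exponential_decay_right[OF f ab(2) C] by blast
  have "TN p (\<lambda>x. 1 * f (x / -1))" using f by (intro TN_rescale) auto
  then have g: "TN p (\<lambda>x. f (- x))" by simp
  obtain \<epsilon>2 K2 where 2: "\<epsilon>2 > 0" "\<And>x. f (- x) \<le> K2 * exp (- (\<epsilon>2 * x))"
    using TN_exponential_decay_right[OF g f(2), of "- a" C] integrable_lebesgue_reflect[OF f(3), of 0] ab(2) C
    by auto
  define \<epsilon> where "\<epsilon> = min \<epsilon>1 \<epsilon>2"
  define K where "K = max K1 K2"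
  have K: "K1 \<le> K" "K2 \<le> K" "\<epsilon> \<le> \<epsilon>1" "\<epsilon> \<le> \<epsilon>2" "\<epsilon> > 0" using 1(1) 2(1) by (auto simp: K_def \<epsilon>_def)
  have "0 \<le> K1"
    using order_trans[OF nonneg 1(2)[of 0]] by simp
  then have K0: "0 \<le> K" using K by simp
  have "f x \<le> K * exp (- (\<epsilon> * \<bar>x\<bar>))" for x
  proof (cases "x \<ge> 0")
    case True
    have "f x \<le> K1 * exp (- (\<epsilon>1 * x))" by (rule 1)
    also have "\<dots> \<le> K * exp (- (\<epsilon> * x))"
      using True K K0 by (intro mult_mono) (auto intro: mult_right_mono)
    finally show ?thesis using True by simp
  next
    case False
    have "f (- (- x)) \<le> K2 * exp (- (\<epsilon>2 * (- x)))" by (rule 2)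
    also have "\<dots> \<le> K * exp (- (\<epsilon> * (- x)))"
      using False K K0 by (intro mult_mono) (auto intro: mult_right_mono_neg)
    finally show ?thesis using False by simp
  qed
  then show ?thesis using K by blast
qed

lemma integrable_exp_minus_abs:
  assumes "d > 0"
  shows "integrable lborel (\<lambda>x :: real. exp (- (d * \<bar>x\<bar>)))"
proof -
  define u where "u x = exp (- (x * (d - 1))) * gamma_density 1 x" for x
  have "integrable lborel u"
    using gamma_density_laplace_real[of 1 "d - 1"] assms by (simp add: u_def[abs_def] has_bochner_integral_iff)
  then have "integrable lborel (\<lambda>x. u x + u (- x))"
    using lborel_integrable_real_affine[of u "-1" 0] by simp
  then show ?thesis
  proof (rule Bochner_Integration.integrable_bound)
    have "AE x in lborel. x \<noteq> (0 :: real)" by (rule AE_lborel_singleton)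
    then show "AE x in lborel. norm (exp (- (d * \<bar>x\<bar>))) \<le> norm (u x + u (- x))"
    proof eventually_elim
      case (elim x)
      then show ?case
        by (cases "x > 0")
           (auto simp: u_def gamma_density_def trunc_pow_def exp_add[symmetric] algebra_simps)
    qed
  qed measurable
qed

lemma exponential_decay_laplace_strip:
  assumes f: "f \<in> borel_measurable lebesgue" "\<And>x. \<bar>f x\<bar> \<le> K * exp (- (\<epsilon> * \<bar>x\<bar>))" and s: "\<bar>Re s\<bar> < \<epsilon>"
  shows "s \<in> laplace_strip f"
proof -
  \<comment> \<open>Half of the margin is spent on the neighbourhood of \<open>s\<close>, the other
    half remains as decay of the majorant.\<close>
  define d where "d = (\<epsilon> - \<bar>Re s\<bar>) / 2"
  have d: "d > 0" using s by (simp add: d_def)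
  show ?thesis
  proof (rule laplace_stripI[OF d])
    fix w assume w: "\<bar>Re w - Re s\<bar> \<le> d"
    have "\<bar>Re w\<bar> \<le> \<bar>Re s\<bar> + \<bar>Re w - Re s\<bar>" by arith
    also have "\<dots> \<le> \<bar>Re s\<bar> + d" using w by (rule add_left_mono)
    also have "\<dots> = \<epsilon> - d" by (simp add: d_def field_simps)
    finally have Re_w: "\<bar>Re w\<bar> \<le> \<epsilon> - d" .
    have "integrable lborel (\<lambda>x :: real. K * exp (- (d * \<bar>x\<bar>)))"
      by (intro integrable_mult_right integrable_exp_minus_abs d)
    then have "integrable lebesgue (\<lambda>x :: real. K * exp (- (d * \<bar>x\<bar>)))"
      by (subst integrable_completion) auto
    then show "laplace_converges f w"
      unfolding laplace_converges_def
    proof (rule Bochner_Integration.integrable_bound)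
      have "(\<lambda>x. exp (- (complex_of_real x * w))) \<in> borel_measurable lebesgue"
        by (intro borel_measurable_lebesgue_continuous continuous_intros)
      moreover have "(\<lambda>x. complex_of_real (f x)) \<in> borel_measurable lebesgue" using f(1) by measurable
      ultimately show "(\<lambda>x. exp (- (complex_of_real x * w)) * complex_of_real (f x)) \<in> borel_measurable lebesgue"
        by (rule borel_measurable_times)
      show "AE x in lebesgue. norm (exp (- (complex_of_real x * w)) * complex_of_real (f x)) \<le> norm (K * exp (- (d * \<bar>x\<bar>)))"
      proof (intro always_eventually allI)
        fix x
        have "0 \<le> K * exp (- (\<epsilon> * \<bar>x\<bar>))" using order_trans[OF abs_ge_zero f(2)] .
        then have K: "0 \<le> K" by (simp add: zero_le_mult_iff)
        have "- (x * Re w) \<le> \<bar>x\<bar> * \<bar>Re w\<bar>" unfolding abs_mult[symmetric] by (rule abs_ge_minus_self)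
        also have "\<dots> \<le> \<bar>x\<bar> * (\<epsilon> - d)" using Re_w by (intro mult_left_mono) auto
        finally have "exp (- (x * Re w)) \<le> exp (\<bar>x\<bar> * (\<epsilon> - d))" by simp
        then have "exp (- (x * Re w)) * \<bar>f x\<bar> \<le> exp (\<bar>x\<bar> * (\<epsilon> - d)) * (K * exp (- (\<epsilon> * \<bar>x\<bar>)))"
          by (intro mult_mono f(2)) auto
        also have "\<dots> = K * (exp (\<bar>x\<bar> * (\<epsilon> - d)) * exp (- (\<epsilon> * \<bar>x\<bar>)))" by (simp only: mult_ac)
        also have "exp (\<bar>x\<bar> * (\<epsilon> - d)) * exp (- (\<epsilon> * \<bar>x\<bar>)) = exp (- (d * \<bar>x\<bar>))"
          unfolding exp_add[symmetric] by (simp add: algebra_simps)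
        finally show "norm (exp (- (complex_of_real x * w)) * complex_of_real (f x)) \<le> norm (K * exp (- (d * \<bar>x\<bar>)))"
          unfolding norm_laplace_integrand using K by simp
      qed
    qed
  qed
qed

section \<open>Variation diminution\<close>

text \<open>\<open>R\<close> is the set of real roots of odd multiplicity. While \<open>P\<close>
  takes both signs a root is split off, and its membership in \<open>R\<close> is toggled.
  Divisibility bounds the size of \<open>R\<close> by the degree and yields a full factorization in
  the case of equality.\<close>

lemma polynomial_sign_factor:
  fixes P :: "real poly"
  assumes "P \<noteq> 0"
  shows "\<exists>R e. finite R \<and> (\<Prod>r\<in>R. [:-r, 1:]) dvd P \<and> e \<noteq> 0 \<and> (\<forall>x. 0 \<le> e * poly P x * (\<Prod>r\<in>R. x - r))"
  using assms
proof (induction "degree P" arbitrary: P rule: less_induct)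
  case less
  show ?case
  proof (cases "(\<forall>x. 0 \<le> poly P x) \<or> (\<forall>x. poly P x \<le> 0)")
    case True
    then show ?thesis
    proof
      assume "\<forall>x. 0 \<le> poly P x"
      then show ?thesis by (intro exI[of _ "{}"] exI[of _ 1]) auto
    next
      assume "\<forall>x. poly P x \<le> 0"
      then show ?thesis by (intro exI[of _ "{}"] exI[of _ "-1"]) auto
    qed
  next
    case False
    then obtain a b where ab: "poly P a < 0" "poly P b > 0" by (auto simp: not_le)
    then have "a \<noteq> b" by auto
    then obtain r where r: "poly P r = 0"
      using poly_IVT_pos[of a b P] poly_IVT_neg[of b a P] ab by (cases "a < b") auto
    then obtain P1 where P1: "P = [:-r, 1:] * P1" by (auto simp: poly_eq_0_iff_dvd)
    have "P1 \<noteq> 0" using less.prems P1 by auto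
    moreover have "degree P1 < degree P"
      unfolding P1 using \<open>P1 \<noteq> 0\<close> by (subst degree_mult_eq) auto
    ultimately obtain R e where R: "finite R" "(\<Prod>r\<in>R. [:-r, 1:]) dvd P1" "e \<noteq> 0"
      "\<And>x. 0 \<le> e * poly P1 x * (\<Prod>r\<in>R. x - r)"
      using less.hyps[of P1] by blast
    show ?thesis
    proof (cases "r \<in> R")
      case True
      have R': "(\<Prod>r\<in>R. h r) = h r * (\<Prod>r\<in>R - {r}. h r)" for h :: "real \<Rightarrow> 'b :: comm_monoid_mult"
        using R(1) True by (rule prod.remove)
      have "(\<Prod>r\<in>R - {r}. [:-r, 1:]) dvd P"
        using R(2) unfolding P1 R' by (meson dvd_mult dvd_mult_right)
      moreover have "e * poly P x * (\<Prod>r\<in>R - {r}. x - r) = e * poly P1 x * (\<Prod>r\<in>R. x - r)" for x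
        unfolding R'[of "\<lambda>r. x - r"] P1 by (simp add: left_diff_distrib[symmetric] mult_ac)
      then have "0 \<le> e * poly P x * (\<Prod>r\<in>R - {r}. x - r)" for x using R(4) by (simp only:)
      ultimately show ?thesis using R by (intro exI[of _ "R - {r}"] exI[of _ e]) auto
    next
      case False
      have "(\<Prod>r\<in>insert r R. [:-r, 1:]) dvd P"
        using R(1,2) False unfolding P1 by (simp del: mult_pCons_left)
      moreover have "e * poly P x * (\<Prod>r\<in>insert r R. x - r) = (x - r)\<^sup>2 * (e * poly P1 x * (\<Prod>r\<in>R. x - r))" for x
        using R(1) False unfolding P1 by (simp add: left_diff_distrib[symmetric] power2_eq_square mult_ac)
      then have "0 \<le> e * poly P x * (\<Prod>r\<in>insert r R. x - r)" for x
        using R(4) by (simp only:) (rule mult_nonneg_nonneg[OF zero_le_power2])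
      ultimately show ?thesis using R by (intro exI[of _ "insert r R"] exI[of _ e]) auto
    qed
  qed
qed

lemma prod_linear_sign:
  fixes z :: real
  assumes "finite R" "z \<notin> R"
  shows "0 < (-1) ^ card {r \<in> R. z < r} * (\<Prod>r\<in>R. z - r)"
  using assms
proof (induction R rule: finite_induct)
  case (insert r R)
  have pos: "0 < (-1) ^ card {r \<in> R. z < r} * (\<Prod>r\<in>R. z - r)" using insert by simp
  show ?case
  proof (cases "z < r")
    case True
    then have "{x \<in> insert r R. z < x} = insert r {r \<in> R. z < r}" by auto
    then have "(-1) ^ card {x \<in> insert r R. z < x} * (\<Prod>x\<in>insert r R. z - x) =
        (r - z) * ((-1) ^ card {r \<in> R. z < r} * (\<Prod>r\<in>R. z - r))"
      using insert.hyps by (simp add: algebra_simps)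
    then show ?thesis using pos True by simp
  next
    case False
    then have "{x \<in> insert r R. z < x} = {r \<in> R. z < r}" by auto
    then have "(-1) ^ card {x \<in> insert r R. z < x} * (\<Prod>x\<in>insert r R. z - x) =
        (z - r) * ((-1) ^ card {r \<in> R. z < r} * (\<Prod>r\<in>R. z - r))"
      using insert.hyps by (simp add: mult_ac)
    moreover have "0 < z - r" using False insert.prems by auto
    ultimately show ?thesis using pos by simp
  qed
qed simp

text \<open>Ordered points carry weakly increasing block labels \<open>w\<close>. A repeated label
  gives equal rows; otherwise, comparing the first labels, there is a zero row, a zero column, or a
  first row that is a unit vector.\<close>

lemma fdet_block_indicator_nonneg:
  fixes w c :: "nat \<Rightarrow> nat"
  assumes "\<And>k l. k \<le> l \<Longrightarrow> l < n \<Longrightarrow> w k \<le> w l" "strict_mono_on {..<n} c"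
  shows "0 \<le> fdet n (\<lambda>k j. if w k = c j then 1 else 0 :: real)"
proof (cases "inj_on w {..<n}")
  case False
  then obtain k l where "k < n" "l < n" "k \<noteq> l" "w k = w l" by (auto simp: inj_on_def)
  then have "fdet n (\<lambda>k j. if w k = c j then 1 else 0 :: real) = 0"
    by (intro fdet_identical_rows[of k l]) auto
  then show ?thesis by simp
next
  case True
  have "strict_mono_on {..<n} w"
    unfolding strict_mono_on_def using assms(1) True by (auto simp: inj_on_def order_less_le)
  then show ?thesis using assms(2)
  proof (induction n arbitrary: w c)
    case (Suc n)
    have mono: "w k < w l" "c k < c l" if "k < l" "l < Suc n" for k l
      using Suc.prems that by (auto simp: strict_mono_on_def)
    consider "w 0 < c 0" | "c 0 < w 0" | "w 0 = c 0" by linarith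
    then show ?case
    proof cases
      case 1
      have "w 0 \<noteq> c j" if "j < Suc n" for j using 1 mono(2)[of 0 j] that by (cases "j = 0") auto
      then have "fdet (Suc n) (\<lambda>k j. if w k = c j then 1 else 0 :: real) = 0"
        by (intro fdet_zero_row[of 0]) auto
      then show ?thesis by simp
    next
      case 2
      have "w k \<noteq> c 0" if "k < Suc n" for k using 2 mono(1)[of 0 k] that by (cases "k = 0") auto
      then have "fdet (Suc n) (\<lambda>j k. if w k = c j then 1 else 0 :: real) = 0"
        by (intro fdet_zero_row[of 0]) auto
      then show ?thesis using fdet_transpose[of "Suc n" "\<lambda>j k. if w k = c j then 1 else 0 :: real"] by simp
    next
      case 3
      have "w 0 \<noteq> c (Suc j)" if "j < n" for j using 3 mono(2)[of 0 "Suc j"] that by auto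
      then have "fdet (Suc n) (\<lambda>k j. if w k = c j then 1 else 0 :: real) =
          (if w 0 = c 0 then 1 else 0) * fdet n (\<lambda>k j. if w (Suc k) = c (Suc j) then 1 else 0)"
        by (intro fdet_expand_first_row_unit) auto
      also have "0 \<le> \<dots>"
        using Suc.prems 3 by (simp, intro Suc.IH) (auto simp: strict_mono_on_def)
      finally show ?thesis .
    qed
  qed simp
qed

text \<open>By Andreief's identity, integrating \<open>f (x i - z)\<close> against the modulus of \<open>P\<close> over the blocks
  of constant sign gives a totally nonnegative matrix; the convolution lies in its column span.\<close>

lemma convolution_sign_changes:
  fixes P :: "real \<Rightarrow> real"
  assumes f: "\<And>q. TN q f" and R: "finite R"
    and P: "e \<noteq> 0" "\<And>z. 0 \<le> e * P z * (\<Prod>r\<in>R. z - r)"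
    and int: "\<And>x. integrable lebesgue (\<lambda>z. f (x - z) * P z)"
    and x: "strict_mono_on {..card R + 1} x"
    and alt: "\<And>i. i \<le> card R + 1 \<Longrightarrow> 0 < (-1) ^ i * (s * (LINT z|lebesgue. f (x i - z) * P z))"
  shows False
proof -
  define m where "m = card R"
  \<comment> \<open>The block of \<open>z\<close>: the number of elements of \<open>R\<close> to its
    left, between 0 and \<open>m\<close>.\<close>
  define \<iota> where "\<iota> z = card {r \<in> R. r < z}" for z
  define b where "b j z = (if \<iota> z = j then \<bar>P z\<bar> else 0)" for j z
  have \<iota>_le: "\<iota> z \<le> m" for z unfolding \<iota>_def m_def using R by (intro card_mono) auto
  have \<iota>_mono: "\<iota> z \<le> \<iota> z'" if "z \<le> z'" for z z' unfolding \<iota>_def using R that by (intro card_mono) auto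
  have sgn_P: "P z = sgn e * (-1) ^ (m - \<iota> z) * \<bar>P z\<bar>" if "z \<notin> R" for z
  proof -
    have "R = {r \<in> R. r < z} \<union> {r \<in> R. z < r}" using that by (auto, metis linorder_neqE)
    then have "card R = card {r \<in> R. r < z} + card {r \<in> R. z < r}"
      by (metis (no_types, lifting) R card_Un_disjoint finite_Un disjoint_iff mem_Collect_eq order_less_asym)
    then have "card {r \<in> R. z < r} = m - \<iota> z" by (simp add: m_def \<iota>_def)
    then have pos: "0 < (-1) ^ (m - \<iota> z) * (\<Prod>r\<in>R. z - r)" using prod_linear_sign[OF R that] by simp
    have "0 \<le> e * P z * (-1) ^ (m - \<iota> z)"
    proof (rule ccontr)
      assume "\<not> ?thesis"
      then have "e * P z * (-1) ^ (m - \<iota> z) * ((-1) ^ (m - \<iota> z) * (\<Prod>r\<in>R. z - r)) < 0"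
        using pos by (intro mult_neg_pos[of "e * P z * (-1) ^ (m - \<iota> z)"]) (simp_all only: not_le)
      also have "e * P z * (-1) ^ (m - \<iota> z) * ((-1) ^ (m - \<iota> z) * (\<Prod>r\<in>R. z - r)) =
          e * P z * (\<Prod>r\<in>R. z - r) * ((-1) ^ (m - \<iota> z) * (-1) ^ (m - \<iota> z))"
        by (simp only: mult_ac)
      also have "(-1 :: real) ^ (m - \<iota> z) * (-1) ^ (m - \<iota> z) = 1"
        by (simp add: power_mult_distrib[symmetric])
      finally show False using P(2)[of z] by simp
    qed
    moreover have "(-1 :: real) ^ (m - \<iota> z) = 1 \<or> (-1 :: real) ^ (m - \<iota> z) = -1"
      by (cases "even (m - \<iota> z)") auto
    ultimately show ?thesis
      using P(1) by (cases "e > 0"; auto simp: sgn_if abs_if zero_le_mult_iff mult_le_0_iff)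
  qed
  have \<iota>_meas: "{z. \<iota> z = j} \<in> sets lebesgue" for j
  proof -
    have "real (\<iota> z) = (\<Sum>r\<in>R. indicator {r<..} z)" for z
      unfolding \<iota>_def using R by (simp add: indicator_def sum.If_cases Int_def)
    then have "{z. \<iota> z = j} = {z \<in> space borel. (\<Sum>r\<in>R. indicator {r<..} z :: real) = real j}"
      by auto (metis of_nat_eq_iff)
    also have "\<dots> \<in> sets borel" by measurable
    finally show ?thesis by (simp add: sets_completionI_sets)
  qed
  have fb_int: "integrable lebesgue (\<lambda>z. f (x i - z) * b j z)" for i j
  proof (rule Bochner_Integration.integrable_bound[OF int[of "x i"]])
    have nonneg: "0 \<le> f t" for t using f[of 1] by (intro TN_nonneg[of 1]) auto
    have "(\<lambda>z. \<bar>f (x i - z) * P z\<bar>) \<in> borel_measurable lebesgue"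
      using int[of "x i"] by (intro borel_measurable_abs borel_measurable_integrable)
    then have "(\<lambda>z. indicator {z. \<iota> z = j} z * \<bar>f (x i - z) * P z\<bar>) \<in> borel_measurable lebesgue"
      using \<iota>_meas by (intro borel_measurable_times borel_measurable_indicator)
    moreover have "indicator {z. \<iota> z = j} z * \<bar>f (x i - z) * P z\<bar> = f (x i - z) * b j z" for z
      using nonneg by (simp add: b_def abs_mult indicator_def)
    ultimately show "(\<lambda>z. f (x i - z) * b j z) \<in> borel_measurable lebesgue" by simp
    show "AE z in lebesgue. norm (f (x i - z) * b j z) \<le> norm (f (x i - z) * P z)"
      by (intro always_eventually allI) (auto simp: b_def abs_mult intro!: mult_left_mono)
  qed
  define A where "A i j = (LINT z|lebesgue. f (x i - z) * b j z)" for i j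
  \<comment> \<open>Up to \<open>m\<close> sign changes make \<open>m + 1\<close> blocks and hence
    columns, so \<open>m + 2\<close> alternating values are one more than the span allows.\<close>
  show False
  proof (rule totally_nonneg_span_no_alternation[of "m + 1" A
        "\<lambda>i. s * (LINT z|lebesgue. f (x i - z) * P z)" "\<lambda>j. s * (sgn e * (-1) ^ (m - j))"])
    fix i assume "i \<le> m + 1"
    then show "0 < (-1) ^ i * (s * (LINT z|lebesgue. f (x i - z) * P z))"
      by (intro alt) (simp add: m_def)
    \<comment> \<open>On \<open>R\<close> itself the sign of \<open>P\<close> is not prescribed, but
      a finite set is null.\<close>
    have "AE z in lebesgue. z \<notin> R"
      using R by (intro AE_not_in) (auto simp: null_sets_completionI finite_imp_null_set_lborel)
    then have AE: "AE z in lebesgue. f (x i - z) * P z = (\<Sum>j<m + 1. sgn e * (-1) ^ (m - j) * (f (x i - z) * b j z))"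
    proof eventually_elim
      case (elim z)
      have "(\<Sum>j<m + 1. sgn e * (-1) ^ (m - j) * (f (x i - z) * b j z)) =
          (\<Sum>j<m + 1. if \<iota> z = j then sgn e * (-1) ^ (m - j) * (f (x i - z) * \<bar>P z\<bar>) else 0)"
        by (intro sum.cong refl) (simp add: b_def)
      also have "\<dots> = f (x i - z) * (sgn e * (-1) ^ (m - \<iota> z) * \<bar>P z\<bar>)"
        using \<iota>_le[of z] by (simp add: less_Suc_eq_le)
      finally show ?case using sgn_P[OF elim] by simp
    qed
    have "(LINT z|lebesgue. f (x i - z) * P z) =
        (LINT z|lebesgue. (\<Sum>j<m + 1. sgn e * (-1) ^ (m - j) * (f (x i - z) * b j z)))"
      using int[of "x i"] fb_int[of i]
      by (intro integral_cong_AE AE borel_measurable_integrable Bochner_Integration.integrable_sum integrable_mult_right)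
    also have "\<dots> = (\<Sum>j<m + 1. sgn e * (-1) ^ (m - j) * A i j)"
      unfolding A_def using fb_int[of i] by (subst Bochner_Integration.integral_sum) auto
    finally show "s * (LINT z|lebesgue. f (x i - z) * P z) = (\<Sum>j<m + 1. s * (sgn e * (-1) ^ (m - j)) * A i j)"
      by (simp only: sum_distrib_left mult.assoc)
  next
    fix k :: nat and r c
    assume rc: "strict_mono_on {..<k} r" "strict_mono_on {..<k} c" "\<And>i. i < k \<Longrightarrow> r i \<le> m + 1 \<and> c i < m + 1"
    show "0 \<le> fdet k (\<lambda>i j. A (r i) (c j))"
      unfolding A_def
    proof (rule andreief_nonneg[OF sigma_finite_lebesgue fb_int])
      fix z :: "nat \<Rightarrow> real" assume z: "strict_mono_on {..<k} z"
      have "strict_mono_on {..<k} (\<lambda>i. x (r i))"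
      proof (rule strict_mono_onI)
        fix i j assume "i \<in> {..<k}" "j \<in> {..<k}" "i < j"
        then have "r i < r j" "r i \<le> m + 1" "r j \<le> m + 1"
          using rc(1,3) by (auto simp: strict_mono_on_def)
        then show "x (r i) < x (r j)" using strict_mono_onD[OF x, of "r i" "r j"] by (simp add: m_def)
      qed
      then have "0 \<le> fdet k (\<lambda>i l. f (x (r i) - z l))" using z by (intro TN_fdet[OF f[of k]]) auto
      then have "0 \<le> fdet k (\<lambda>l i. f (x (r i) - z l))"
        using fdet_transpose[of k "\<lambda>i l. f (x (r i) - z l)"] by simp
      moreover have "0 \<le> fdet k (\<lambda>l j. b (c j) (z l))"
      proof -
        have "fdet k (\<lambda>l j. b (c j) (z l)) = fdet k (\<lambda>l j. \<bar>P (z l)\<bar> * 1 * (if \<iota> (z l) = c j then 1 else 0))"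
          by (intro fdet_cong) (auto simp: b_def)
        also have "\<dots> = (\<Prod>l<k. \<bar>P (z l)\<bar>) * (\<Prod>j<k. 1) * fdet k (\<lambda>l j. if \<iota> (z l) = c j then 1 else 0)"
          by (rule fdet_scale)
        also have "0 \<le> \<dots>"
        proof (intro mult_nonneg_nonneg prod_nonneg fdet_block_indicator_nonneg rc(2))
          fix l l' assume "l \<le> l'" "l' < k"
          then have "z l \<le> z l'"
            using strict_mono_onD[OF z, of l l'] by (cases "l = l'") auto
          then show "\<iota> (z l) \<le> \<iota> (z l')" by (rule \<iota>_mono)
        qed auto
        finally show ?thesis .
      qed
      ultimately show "0 \<le> fdet k (\<lambda>l i. f (x (r i) - z l)) * fdet k (\<lambda>l j. b (c j) (z l))" by simp
    qed
  qed
qed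

section \<open>Appell polynomials and the reciprocal of the transform\<close>

text \<open>Total mass 1 makes the expansion of the transform at 0 start with 1, so the reciprocal
  series starts with 1 and the Appell polynomials are monic. The general case is reduced to this one
  by scaling.\<close>

locale normalized_polya =
  fixes f :: "real \<Rightarrow> real" and \<epsilon> :: real
  assumes TN: "TN q f"
    and total: "(LINT x|lebesgue. f x) = 1"
    and \<epsilon>_pos: "\<epsilon> > 0"
    and converges: "\<bar>Re w\<bar> \<le> \<epsilon> \<Longrightarrow> laplace_converges f w"
begin

lemma nonneg: "0 \<le> f x"
  using TN[of 1] by (intro TN_nonneg[of 1]) auto

definition moment :: "nat \<Rightarrow> real" where
  "moment k = (LINT y|lebesgue. y ^ k * f y)"

lemma moment_integrable: "integrable lebesgue (\<lambda>y. y ^ k * f y)"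
proof -
  have "integrable lebesgue (\<lambda>x. (- complex_of_real x)^k * exp (- (of_real x * 0)) * of_real (f x))"
    using \<epsilon>_pos converges by (intro laplace_moment_integrable[of \<epsilon>]) auto
  then have "integrable lebesgue (\<lambda>x. (-1)^k * ((- complex_of_real x)^k * of_real (f x)))"
    by (intro integrable_mult_right) simp
  moreover have "(-1)^k * ((- complex_of_real x)^k * of_real (f x)) = of_real (x ^ k * f x)" for x
    by (simp add: power_mult_distrib[symmetric] mult.assoc[symmetric])
  ultimately show ?thesis by (simp only: complex_of_real_integrable_eq)
qed

lemma integrable_f: "integrable lebesgue f"
  using moment_integrable[of 0] by simp

lemma laplace_moment_0: "laplace_moment f 0 k = of_real ((-1)^k * moment k)"
proof -
  have "(- complex_of_real x)^k * exp (- (of_real x * 0)) * of_real (f x) = of_real ((-1)^k * (x ^ k * f x))" for x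
    by (simp add: power_mult_distrib[symmetric] mult.assoc[symmetric])
  then show ?thesis
    unfolding laplace_moment_def moment_def by (simp only: integral_complex_of_real integral_mult_right_zero)
qed

text \<open>The Taylor series of the transform at 0.\<close>

definition B :: "real fps" where
  "B = Abs_fps (\<lambda>n. (-1)^n * moment n / fact n)"

lemma B_0: "B $ 0 = 1"
  by (simp add: B_def moment_def total)

definition \<psi> :: "nat \<Rightarrow> real" where
  "\<psi> = fps_nth (inverse B)"

lemma B_inverse: "inverse B * B = 1"
  by (rule inverse_mult_eq_1) (simp add: B_0)

lemma \<psi>_B: "(\<Sum>i\<le>n. \<psi> i * B $ (n - i)) = (if n = 0 then 1 else 0)"
proof -
  have "(\<Sum>i\<le>n. \<psi> i * B $ (n - i)) = (inverse B * B) $ n"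
    unfolding fps_mult_nth \<psi>_def atLeast0AtMost ..
  then show ?thesis by (simp add: B_inverse)
qed

lemma \<psi>_0: "\<psi> 0 = 1"
  using \<psi>_B[of 0] by (simp add: B_0)

text \<open>Divided by n!, this is the coefficient of \<open>s ^ n\<close> in the product of
  \<open>exp (x * s)\<close> and the reciprocal series. The coefficient type is left open so that
  the polynomial can be evaluated at real and at complex arguments.\<close>

definition appell :: "nat \<Rightarrow> 'a :: {comm_ring_1, real_algebra_1} poly" where
  "appell n = (\<Sum>k\<le>n. Polynomial.monom (of_real (fact n / fact (n - k) * \<psi> k)) (n - k))"

lemma poly_appell: "poly (appell n) x = (\<Sum>k\<le>n. of_real (fact n / fact (n - k) * \<psi> k) * x ^ (n - k))"
  by (simp add: appell_def poly_sum poly_monom)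

lemma poly_appell_of_real: "poly (appell n) (complex_of_real x) = of_real (poly (appell n) x)"
  by (simp add: poly_appell)

text \<open>Convolving \<open>exp (x * s)\<close> with \<open>f\<close> multiplies it by the
  transform, which the reciprocal series cancels; this is that identity coefficient by coefficient.
  Collecting the double sum by m = k + l produces the coefficients of the product of the two series,
  of which only m = 0 survives.\<close>

lemma convolution_appell:
  shows "integrable lebesgue (\<lambda>y. f y * poly (appell n) (x - y))"
    and "(LINT y|lebesgue. f y * poly (appell n) (x - y)) = x ^ n"
proof -
  let ?t = "\<lambda>k l y. fact n / fact (n - k) * \<psi> k * (of_nat (n - k choose l) * (-1)^l * x ^ (n - k - l)) * (y ^ l * f y)"
  have eq: "f y * poly (appell n) (x - y) = (\<Sum>k\<le>n. \<Sum>l\<le>n - k. ?t k l y)" for y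
  proof -
    have "(x - y) ^ m = (\<Sum>l\<le>m. of_nat (m choose l) * (-1)^l * x ^ (m - l) * y ^ l)" for m
      using binomial_ring[of "- y" x m] by (simp add: power_minus[of y] mult_ac)
    then show ?thesis
      unfolding poly_appell by (simp add: sum_distrib_left sum_distrib_right mult_ac)
  qed
  show "integrable lebesgue (\<lambda>y. f y * poly (appell n) (x - y))"
    unfolding eq by (intro Bochner_Integration.integrable_sum integrable_mult_right moment_integrable)
  have "(LINT y|lebesgue. f y * poly (appell n) (x - y)) =
      (\<Sum>k\<le>n. \<Sum>l\<le>n - k. LINT y|lebesgue. ?t k l y)"
    unfolding eq
    by (subst Bochner_Integration.integral_sum, intro Bochner_Integration.integrable_sum integrable_mult_right moment_integrable,
        intro sum.cong refl Bochner_Integration.integral_sum integrable_mult_right moment_integrable)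
  also have "\<dots> = (\<Sum>k\<le>n. \<Sum>l\<le>n - k. fact n / fact (n - (k + l)) * x ^ (n - (k + l)) * (\<psi> k * B $ l))"
  proof (intro sum.cong refl)
    fix k l assume "k \<in> {..n}" "l \<in> {..n - k}"
    then have kl: "l \<le> n - k" by simp
    have "real (n - k choose l) / fact (n - k) = 1 / (fact l * fact (n - k - l))"
      using binomial_fact[OF kl, where ?'a = real] by simp
    then have "fact n / fact (n - k) * real (n - k choose l) = fact n / (fact l * fact (n - k - l))"
      by (metis (no_types) mult.commute times_divide_eq_left times_divide_eq_right mult.right_neutral)
    moreover have "(LINT y|lebesgue. ?t k l y) = (fact n / fact (n - k) * real (n - k choose l)) * (\<psi> k * (-1)^l * x ^ (n - k - l) * moment l)"
      unfolding moment_def integral_mult_right_zero by (simp add: mult_ac)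
    ultimately show "(LINT y|lebesgue. ?t k l y) = fact n / fact (n - (k + l)) * x ^ (n - (k + l)) * (\<psi> k * B $ l)"
      by (simp add: B_def mult_ac)
  qed
  also have "\<dots> = (\<Sum>(k, l)\<in>(SIGMA k:{..n}. {..n - k}). fact n / fact (n - (k + l)) * x ^ (n - (k + l)) * (\<psi> k * B $ l))"
    by (rule sum.Sigma) auto
  also have "(SIGMA k:{..n}. {..n - k}) = {(k, l). k + l \<le> n}" by auto
  also have "(\<Sum>(k, l)\<in>\<dots>. fact n / fact (n - (k + l)) * x ^ (n - (k + l)) * (\<psi> k * B $ l)) =
      (\<Sum>m\<le>n. \<Sum>k\<le>m. fact n / fact (n - (k + (m - k))) * x ^ (n - (k + (m - k))) * (\<psi> k * B $ (m - k)))"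
    by (rule sum.triangle_reindex_eq)
  also have "\<dots> = (\<Sum>m\<le>n. fact n / fact (n - m) * x ^ (n - m) * (\<Sum>k\<le>m. \<psi> k * B $ (m - k)))"
    unfolding sum_distrib_left by (intro sum.cong refl) auto
  also have "\<dots> = (\<Sum>m\<le>n. if m = 0 then x ^ n else 0)"
    unfolding \<psi>_B by (intro sum.cong refl) auto
  also have "\<dots> = x ^ n" by simp
  finally show "(LINT y|lebesgue. f y * poly (appell n) (x - y)) = x ^ n" .
qed

text \<open>\<open>deconvolve\<close> inverts convolution with \<open>f\<close> on polynomials of degree at most \<open>n\<close>.\<close>

definition deconvolve :: "nat \<Rightarrow> real poly \<Rightarrow> 'a :: {comm_ring_1, real_algebra_1} poly" where
  "deconvolve n Q = (\<Sum>j\<le>n. Polynomial.smult (of_real (poly.coeff Q j)) (appell j))"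

lemma convolution_deconvolve:
  assumes "degree Q \<le> n"
  shows "integrable lebesgue (\<lambda>z. f (x - z) * poly (deconvolve n Q) z)"
    and "(LINT z|lebesgue. f (x - z) * poly (deconvolve n Q) z) = poly Q x"
proof -
  have eq: "f y * poly (deconvolve n Q) (x - y) = (\<Sum>j\<le>n. poly.coeff Q j * (f y * poly (appell j) (x - y)))" for y
    by (simp add: deconvolve_def poly_sum sum_distrib_left mult_ac)
  have int: "integrable lebesgue (\<lambda>y. f y * poly (deconvolve n Q) (x - y))"
    unfolding eq by (intro Bochner_Integration.integrable_sum integrable_mult_right convolution_appell)
  show "integrable lebesgue (\<lambda>z. f (x - z) * poly (deconvolve n Q) z)"
    using integrable_lebesgue_reflect[OF int, of x] by simp
  have "(LINT z|lebesgue. f (x - z) * poly (deconvolve n Q) z) = (LINT y|lebesgue. f y * poly (deconvolve n Q) (x - y))"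
    by (subst lebesgue_integral_real_affine[of "-1" _ x]) simp_all
  also have "\<dots> = (\<Sum>j\<le>n. poly.coeff Q j * x ^ j)"
    unfolding eq by (simp add: Bochner_Integration.integral_sum convolution_appell)
  also have "\<dots> = poly Q x"
    using assms unfolding poly_altdef
    by (intro sum.mono_neutral_right) (auto simp: coeff_eq_0)
  finally show "(LINT z|lebesgue. f (x - z) * poly (deconvolve n Q) z) = poly Q x" .
qed

lemma coeff_appell_top: "poly.coeff (appell n) n = (1 :: real)"
proof -
  have "poly.coeff (appell n) n = (\<Sum>k\<le>n. if k = 0 then 1 else 0 :: real)"
    unfolding appell_def coeff_sum by (intro sum.cong refl) (auto simp: \<psi>_0)
  then show ?thesis by simp
qed

lemma degree_appell_le: "degree (appell n :: real poly) \<le> n"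
  unfolding appell_def by (intro degree_sum_le) (auto intro: order_trans[OF degree_monom_le])

text \<open>The convolution of \<open>f\<close> with \<open>deconvolve n Q\<close> is \<open>Q\<close>, which has \<open>n\<close> sign changes. This needs the
  roots of \<open>Q\<close> to be distinct; \<open>x^n\<close> is then reached by letting \<open>\<delta>\<close> tend to 0.\<close>

lemma deconvolve_real_rooted:
  fixes Q :: "real poly"
  assumes "\<delta> > 0" and Q: "Q = (\<Prod>i<n. [:- (\<delta> * real i), 1:])"
  shows "\<exists>R. finite R \<and> card R = n \<and> deconvolve n Q = (\<Prod>r\<in>R. [:- r, 1:] :: real poly)"
proof -
  define P :: "real poly" where "P = deconvolve n Q"
  have degQ: "degree Q = n" unfolding Q by (subst degree_prod_eq_sum_degree) auto
  have leadQ: "poly.coeff Q n = 1"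
  proof -
    have "lead_coeff Q = 1" unfolding Q by (subst lead_coeff_prod) simp
    then show ?thesis by (simp add: degQ)
  qed
  have degP: "degree P \<le> n"
    unfolding P_def deconvolve_def
    by (intro degree_sum_le) (auto intro: order_trans[OF degree_smult_le] order_trans[OF degree_appell_le])
  have coeffP: "poly.coeff P n = 1"
  proof -
    have "poly.coeff P n = (\<Sum>j\<le>n. if j = n then 1 else 0)"
      unfolding P_def deconvolve_def coeff_sum
    proof (intro sum.cong refl)
      fix j assume "j \<in> {..n}"
      then have "j < n \<Longrightarrow> poly.coeff (appell j :: real poly) n = 0"
        using degree_appell_le[of j] by (intro coeff_eq_0) simp
      then show "poly.coeff (Polynomial.smult (of_real (poly.coeff Q j)) (appell j :: real poly)) n = (if j = n then 1 else 0)"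
        using \<open>j \<in> {..n}\<close> by (auto simp: leadQ coeff_appell_top order_le_less)
    qed
    then show ?thesis by simp
  qed
  then have P0: "P \<noteq> 0" by auto
  have degP_eq: "degree P = n" using degP coeffP le_degree[of P n] by auto
  obtain R e where R: "finite R" "(\<Prod>r\<in>R. [:-r, 1:]) dvd P" "e \<noteq> 0" "\<And>x. 0 \<le> e * poly P x * (\<Prod>r\<in>R. x - r)"
    using polynomial_sign_factor[OF P0] by blast
  have deg_prod: "degree (\<Prod>r\<in>R. [:-r, 1:]) = card R"
    by (subst degree_prod_eq_sum_degree) auto
  have "card R \<le> n" using dvd_imp_degree_le[OF R(2) P0] deg_prod degP by simp
  moreover have "\<not> card R < n"
  proof
    assume less: "card R < n"
    define S where "S = (\<lambda>i. \<delta> * real i) ` {..<n}"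
    \<comment> \<open>These points separate the roots of \<open>Q\<close>, one of them lying to the
      left and one to the right of all roots. So \<open>Q\<close> alternates at n + 1 points, while
      \<open>card R < n\<close> permits at most n.\<close>
    define x where "x i = \<delta> * (real i - 1 / 2)" for i
    have Q_eval: "poly Q t = (\<Prod>r\<in>S. t - r)" for t
      unfolding Q S_def poly_prod using \<open>\<delta> > 0\<close>
      by (subst prod.reindex) (auto simp: inj_on_def)
    show False
    \<comment> \<open>\<open>(-1)^n\<close> is the sign of \<open>Q\<close> to the left of all its
      roots, where the alternation starts.\<close>
    proof (rule convolution_sign_changes[OF TN R(1,3,4), of x "(-1)^n"])
      show "integrable lebesgue (\<lambda>z. f (t - z) * poly P z)" for t
        unfolding P_def using degQ by (intro convolution_deconvolve) simp
      show "strict_mono_on {..card R + 1} x"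
        using \<open>\<delta> > 0\<close> by (auto simp: strict_mono_on_def x_def)
      fix i assume "i \<le> card R + 1"
      then have i: "i \<le> n" using less by simp
      have lt_iff: "x i < \<delta> * real j \<longleftrightarrow> i \<le> j" for j
      proof -
        have "x i < \<delta> * real j \<longleftrightarrow> real i - 1 / 2 < real j"
          using \<open>\<delta> > 0\<close> by (simp add: x_def)
        also have "\<dots> \<longleftrightarrow> i \<le> j" by linarith
        finally show ?thesis .
      qed
      have "x i \<noteq> \<delta> * real j" for j
      proof
        assume "x i = \<delta> * real j"
        then have "real i - 1 / 2 = real j" using \<open>\<delta> > 0\<close> by (simp add: x_def)
        then have "2 * real i = 2 * real j + 1" by linarith
        then have "2 * i = 2 * j + 1" by linarith
        then show False by presburger
      qed
      then have "x i \<notin> S" by (auto simp: S_def)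
      moreover have "{r \<in> S. x i < r} = (\<lambda>i. \<delta> * real i) ` {i..<n}"
        by (auto simp: S_def lt_iff)
      then have "card {r \<in> S. x i < r} = n - i"
        using \<open>\<delta> > 0\<close> by (simp add: card_image inj_on_def)
      ultimately have "0 < (-1) ^ (n - i) * poly Q (x i)"
        using prod_linear_sign[of S "x i"] by (simp add: Q_eval S_def)
      moreover have "(-1 :: real) ^ (n - i) = (-1) ^ i * (-1) ^ n"
        using i by (simp add: power_add[symmetric] minus_one_power_iff)
      moreover have "(LINT z|lebesgue. f (x i - z) * poly P z) = poly Q (x i)"
        unfolding P_def using degQ by (intro convolution_deconvolve) simp
      ultimately show "0 < (-1) ^ i * ((-1) ^ n * (LINT z|lebesgue. f (x i - z) * poly P z))"
        by (simp add: mult.assoc)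
    qed
  qed
  ultimately have card: "card R = n" by simp
  obtain C where C: "P = (\<Prod>r\<in>R. [:-r, 1:]) * C" using R(2) by (elim dvdE)
  have "C \<noteq> 0" using C P0 by auto
  then have "degree C = 0"
    using degP_eq deg_prod card P0 unfolding C by (subst (asm) degree_mult_eq) auto
  then obtain c where c: "C = [:c:]" by (rule degree_eq_zeroE)
  have "lead_coeff P = lead_coeff (\<Prod>r\<in>R. [:-r, 1:]) * lead_coeff C"
    unfolding C by (rule lead_coeff_mult)
  also have "lead_coeff (\<Prod>r\<in>R. [:-r, 1:]) = (1 :: real)" by (subst lead_coeff_prod) simp
  finally have "c = 1" using coeffP degP_eq by (simp add: c)
  then have "P = (\<Prod>r\<in>R. [:-r, 1:])" using C c by simp
  then show ?thesis using R(1) card by (auto simp: P_def)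
qed

lemma poly_eqI_on_reals:
  fixes p q :: "complex poly"
  assumes "\<And>x. poly p (of_real x) = poly q (of_real x)"
  shows "p = q"
proof (rule ccontr)
  assume "p \<noteq> q"
  then have "finite {z. poly (p - q) z = 0}" by (intro poly_roots_finite) simp
  moreover have "range complex_of_real \<subseteq> {z. poly (p - q) z = 0}" using assms by auto
  ultimately have "finite (range complex_of_real)" by (rule finite_subset[rotated])
  then have "finite (UNIV :: real set)" by (rule finite_imageD) (simp add: inj_on_def)
  then show False using infinite_UNIV_char_0 by blast
qed

lemma coeff_shrinking_roots_tendsto:
  "((\<lambda>\<delta>. poly.coeff (\<Prod>i<n. [:- (\<delta> * real i), 1:]) j) \<longlongrightarrow> (if j = n then 1 else 0)) (at_right 0)"
proof (induction n arbitrary: j)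
  case (Suc n)
  have "((\<lambda>\<delta>. - (\<delta> * real n) * poly.coeff (\<Prod>i<n. [:- (\<delta> * real i), 1:]) j +
      (case j of 0 \<Rightarrow> 0 | Suc k \<Rightarrow> poly.coeff (\<Prod>i<n. [:- (\<delta> * real i), 1:]) k)) \<longlongrightarrow>
      - (0 * real n) * (if j = n then 1 else 0) + (case j of 0 \<Rightarrow> 0 | Suc k \<Rightarrow> if k = n then 1 else 0)) (at_right 0)"
    by (intro tendsto_intros Suc.IH) (cases j; simp add: Suc.IH)
  moreover have "poly.coeff (\<Prod>i<Suc n. [:- (\<delta> * real i), 1:]) j =
      - (\<delta> * real n) * poly.coeff (\<Prod>i<n. [:- (\<delta> * real i), 1:]) j +
      (case j of 0 \<Rightarrow> 0 | Suc k \<Rightarrow> poly.coeff (\<Prod>i<n. [:- (\<delta> * real i), 1:]) k)" for \<delta>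
    by (simp add: coeff_pCons split: nat.split)
  moreover have "- (0 * real n) * (if j = n then 1 else 0) + (case j of 0 \<Rightarrow> 0 | Suc k \<Rightarrow> if k = n then 1 else 0) =
      (if j = Suc n then 1 else 0 :: real)"
    by (auto split: nat.split)
  ultimately show ?case by (simp only:)
qed (simp add: coeff_1 eq_commute)

text \<open>Real-rootedness passes to the limit in the form of a lower bound away from the real line.\<close>

lemma norm_appell_ge: "\<bar>Im z\<bar> ^ n \<le> norm (poly (appell n) z)"
proof -
  define Q where "Q \<delta> = (\<Prod>i<n. [:- (\<delta> * real i), 1:])" for \<delta> :: real
  have ge: "\<bar>Im z\<bar> ^ n \<le> norm (poly (deconvolve n (Q \<delta>)) z)" if \<delta>: "\<delta> > 0" for \<delta>
  proof -
    obtain R where R: "finite R" "card R = n" "deconvolve n (Q \<delta>) = (\<Prod>r\<in>R. [:- r, 1:] :: real poly)"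
      using deconvolve_real_rooted[of \<delta> "Q \<delta>" n] \<delta> Q_def[of \<delta>] by blast
    have "deconvolve n (Q \<delta>) = (\<Prod>r\<in>R. [:- of_real r, 1:] :: complex poly)"
    proof (rule poly_eqI_on_reals)
      fix x
      have "poly (deconvolve n (Q \<delta>)) (complex_of_real x) = of_real (poly (deconvolve n (Q \<delta>)) x)"
        by (simp add: deconvolve_def poly_sum poly_appell_of_real)
      also have "\<dots> = poly (\<Prod>r\<in>R. [:- of_real r, 1:]) (complex_of_real x)"
        unfolding R(3) by (simp add: poly_prod)
      finally show "poly (deconvolve n (Q \<delta>)) (complex_of_real x) = \<dots>" .
    qed
    then have "norm (poly (deconvolve n (Q \<delta>)) z) = (\<Prod>r\<in>R. norm (z - of_real r))"
      by (simp add: poly_prod prod_norm[symmetric])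
    \<comment> \<open>No real root is closer to \<open>z\<close> than the real line is.\<close>
    moreover have "(\<Prod>r\<in>R. \<bar>Im z\<bar>) \<le> (\<Prod>r\<in>R. norm (z - of_real r))"
    proof (intro prod_mono conjI abs_ge_zero)
      fix r show "\<bar>Im z\<bar> \<le> norm (z - of_real r)" using abs_Im_le_cmod[of "z - of_real r"] by simp
    qed
    ultimately show ?thesis using R(2) by simp
  qed
  have "((\<lambda>\<delta>. poly (deconvolve n (Q \<delta>)) z) \<longlongrightarrow> (\<Sum>j\<le>n. of_real (if j = n then 1 else 0) * poly (appell j) z)) (at_right 0)"
    unfolding deconvolve_def poly_sum poly_smult Q_def
    by (intro tendsto_intros coeff_shrinking_roots_tendsto)
  also have "(\<Sum>j\<le>n. of_real (if j = n then 1 else 0) * poly (appell j) z) =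
      (\<Sum>j\<le>n. if j = n then poly (appell j) z else 0)"
    by (intro sum.cong refl) auto
  also have "\<dots> = poly (appell n) z" by simp
  finally have "((\<lambda>\<delta>. norm (poly (deconvolve n (Q \<delta>)) z)) \<longlongrightarrow> norm (poly (appell n) z)) (at_right 0)"
    by (rule tendsto_norm)
  then show ?thesis
  proof (rule tendsto_lowerbound)
    show "\<forall>\<^sub>F \<delta> in at_right 0. \<bar>Im z\<bar> ^ n \<le> norm (poly (deconvolve n (Q \<delta>)) z)"
      using eventually_at_right_less[of "0 :: real"] ge by (auto elim!: eventually_mono)
  qed simp
qed

lemma appell_real_roots:
  "\<exists>r :: nat \<Rightarrow> real. \<forall>z. poly (appell n) z = (\<Prod>j<n. z - complex_of_real (r j))"
proof -
  define A :: "complex poly" where "A = appell n"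
  have "poly.coeff A n = 1"
  proof -
    have "poly.coeff A n = (\<Sum>k\<le>n. if k = 0 then 1 else 0)"
      unfolding A_def appell_def coeff_sum by (intro sum.cong refl) (auto simp: \<psi>_0)
    then show ?thesis by simp
  qed
  moreover have "degree A \<le> n"
    unfolding A_def appell_def by (intro degree_sum_le) (auto intro: order_trans[OF degree_monom_le])
  ultimately have A: "degree A = n" "lead_coeff A = 1" using le_degree[of A n] by auto
  obtain root where root: "Polynomial.smult (lead_coeff A) (\<Prod>i<degree A. [:-root i, 1:]) = A"
    by (rule complex_poly_decompose')
  have prod: "poly A z = (\<Prod>i<n. z - root i)" for z
  proof -
    have "poly A z = poly (\<Prod>i<n. [:-root i, 1:]) z" using root A by simp
    then show ?thesis by (simp add: poly_prod)
  qed
  have "root i = of_real (Re (root i))" if i: "i < n" for i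
  proof -
    have "poly A (root i) = 0" unfolding prod using i by (intro prod_zero) auto
    then have "\<bar>Im (root i)\<bar> ^ n \<le> 0" using norm_appell_ge[of "root i" n] by (simp add: A_def)
    then have "Im (root i) = 0" by (metis abs_ge_zero abs_eq_0 power_eq_0_iff zero_le_power order_antisym)
    then show ?thesis by (simp add: complex_eq_iff)
  qed
  then have "poly A z = (\<Prod>i<n. z - of_real (Re (root i)))" for z
    unfolding prod by (intro prod.cong refl) auto
  then show ?thesis unfolding A_def by (intro exI[of _ "\<lambda>i. Re (root i)"]) blast
qed

text \<open>\<open>g n s = (s / n)^n * poly (appell n) (n / s)\<close>\<close>

definition c :: "nat \<Rightarrow> nat \<Rightarrow> real" where
  "c n k = (if k \<le> n then fact n / (fact (n - k) * real n ^ k) * \<psi> k else 0)"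

definition g :: "nat \<Rightarrow> complex \<Rightarrow> complex" where
  "g n s = (\<Sum>k\<le>n. of_real (c n k) * s ^ k)"

text \<open>Reversing the polynomial turns a root r into the factor 1 - (r / n) s; a root 0 yields
  the factor 1.\<close>

lemma g_product:
  assumes "n > 0"
  shows "\<exists>\<beta> :: nat \<Rightarrow> real. \<forall>s. g n s = (\<Prod>j<n. 1 + of_real (\<beta> j) * s)"
proof -
  obtain r :: "nat \<Rightarrow> real" where r: "\<And>z. poly (appell n) z = (\<Prod>j<n. z - complex_of_real (r j))"
    using appell_real_roots by blast
  have "g n s = (\<Prod>j<n. 1 + of_real (- (r j) / n) * s)" for s
  proof (cases "s = 0")
    case True
    have "g n 0 = (\<Sum>k\<le>n. if k = 0 then 1 else 0)"
      unfolding g_def by (intro sum.cong refl) (auto simp: c_def \<psi>_0)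
    then show ?thesis using True by simp
  next
    case False
    have "g n s = (s / n) ^ n * poly (appell n) (n / s)"
      unfolding g_def poly_appell sum_distrib_left
    proof (intro sum.cong refl)
      fix k assume "k \<in> {..n}"
      then have k: "k \<le> n" by simp
      have "(s / n) ^ n = (s / n) ^ (n - k) * (s / n) ^ k" using k by (simp add: power_add[symmetric])
      then have "(s / n) ^ n * (n / s) ^ (n - k) = ((s / n) * (n / s)) ^ (n - k) * (s / n) ^ k"
        by (simp only: power_mult_distrib mult_ac)
      also have "\<dots> = (s / n) ^ k" using False assms by simp
      finally have key: "(s / n) ^ n * (n / s) ^ (n - k) = (s / n) ^ k" .
      have "(s / n) ^ n * (of_real (fact n / fact (n - k) * \<psi> k) * (n / s) ^ (n - k)) =
          of_real (fact n / fact (n - k) * \<psi> k) * ((s / n) ^ n * (n / s) ^ (n - k))"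
        by (simp only: mult_ac)
      also have "\<dots> = of_real (c n k) * s ^ k"
        unfolding key using k by (simp add: c_def power_divide)
      finally show "of_real (c n k) * s ^ k = (s / n) ^ n * (of_real (fact n / fact (n - k) * \<psi> k) * (n / s) ^ (n - k))" ..
    qed
    also have "\<dots> = (\<Prod>j<n. (s / n) * (n / s - of_real (r j)))"
      by (simp only: r prod.distrib prod_constant card_lessThan)
    also have "\<dots> = (\<Prod>j<n. 1 + of_real (- (r j) / n) * s)"
      using False assms by (intro prod.cong refl) (simp add: field_simps)
    finally show ?thesis .
  qed
  then show ?thesis by (intro exI[of _ "\<lambda>j. - (r j) / n"] allI)
qed

end

section \<open>Convergence of the products to the reciprocal transform\<close>

text \<open>Newton's identity: the sum of squares is determined by the first two coefficients, which
  therefore control all \<beta> at once.\<close>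

lemma poly_prod_linear_coeffs:
  fixes \<beta> :: "nat \<Rightarrow> 'a :: comm_ring_1"
  defines "p \<equiv> \<lambda>n. \<Prod>j<n. [:1, \<beta> j:]"
  shows "poly.coeff (p n) 0 = 1" "poly.coeff (p n) 1 = (\<Sum>j<n. \<beta> j)"
    "2 * poly.coeff (p n) 2 = (\<Sum>j<n. \<beta> j)\<^sup>2 - (\<Sum>j<n. (\<beta> j)\<^sup>2)"
proof (induction n)
  case 0
  show "poly.coeff (p 0) 0 = 1" "poly.coeff (p 0) 1 = (\<Sum>j<0. \<beta> j)"
    "2 * poly.coeff (p 0) 2 = (\<Sum>j<0. \<beta> j)\<^sup>2 - (\<Sum>j<0. (\<beta> j)\<^sup>2)"
    by (simp_all add: p_def)
next
  case (Suc n)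
  have p: "p (Suc n) = p n + pCons 0 (Polynomial.smult (\<beta> n) (p n))"
    by (simp add: p_def mult.commute)
  have 2: "poly.coeff (pCons 0 (Polynomial.smult (\<beta> n) (p n))) 2 = \<beta> n * poly.coeff (p n) 1"
    by (simp add: numeral_2_eq_2)
  show "poly.coeff (p (Suc n)) 0 = 1" using Suc(1) by (simp add: p)
  show "poly.coeff (p (Suc n)) 1 = (\<Sum>j<Suc n. \<beta> j)" using Suc(1,2) by (simp add: p)
  have "2 * poly.coeff (p (Suc n)) 2 = 2 * poly.coeff (p n) 2 + 2 * (\<beta> n * (\<Sum>j<n. \<beta> j))"
    using Suc(2) 2 by (simp add: p distrib_left)
  then show "2 * poly.coeff (p (Suc n)) 2 = (\<Sum>j<Suc n. \<beta> j)\<^sup>2 - (\<Sum>j<Suc n. (\<beta> j)\<^sup>2)"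
    unfolding Suc(3) by (simp add: power2_eq_square algebra_simps)
qed

text \<open>The linear term keeps its sign, so a product is estimated by the sum of the \<beta> and
  that of their squares, both known, and not by the sum of absolute values.\<close>

lemma norm_one_plus_le_exp: "norm (1 + w) \<le> exp (Re w + (norm w)\<^sup>2 / 2)"
proof -
  have "(norm (1 + w))\<^sup>2 = 1 + (2 * Re w + (norm w)\<^sup>2)"
    unfolding cmod_power2 by (simp add: power2_eq_square algebra_simps)
  also have "\<dots> \<le> exp (2 * Re w + (norm w)\<^sup>2)" by (rule exp_ge_add_one_self)
  also have "\<dots> = (exp (Re w + (norm w)\<^sup>2 / 2))\<^sup>2" by (simp add: exp_double[symmetric])
  finally show ?thesis by (rule power2_le_imp_le) simp
qed

lemma coeff_norm_le_Cauchy: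
  fixes p :: "complex poly"
  assumes "r > 0" "\<And>s. norm s = r \<Longrightarrow> norm (poly p s) \<le> C"
  shows "norm (poly.coeff p k) \<le> C / r ^ k"
proof -
  have "poly.coeff p k = (deriv ^^ k) (poly p) 0 / fact k"
    using fps_nth_conv_deriv[of "fps_of_poly p" k] by (simp add: eval_fps_of_poly[abs_def])
  moreover have "norm ((deriv ^^ k) (poly p) 0) / fact k \<le> fact k * C / r ^ k / fact k"
    by (intro divide_right_mono Cauchy_inequality)
       (use assms in \<open>auto intro!: holomorphic_intros continuous_intros\<close>)
  ultimately show ?thesis by (simp add: norm_divide)
qed

lemma falling_ratio_tendsto:
  "(\<lambda>n. if k \<le> n then fact n / (fact (n - k) * real n ^ k) else 0) \<longlonglongrightarrow> 1"
proof (induction k)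
  case 0
  have "\<forall>\<^sub>F n in sequentially. (if 0 \<le> n then fact n / (fact (n - 0) * real n ^ 0) else 0) = (1 :: real)"
    by simp
  then show ?case by (rule tendsto_eventually)
next
  case (Suc k)
  have "(\<lambda>n. 1 - real k * (1 / real n)) \<longlonglongrightarrow> 1 - real k * 0"
    by (intro tendsto_intros lim_1_over_n)
  then have "(\<lambda>n. (if k \<le> n then fact n / (fact (n - k) * real n ^ k) else 0) * (1 - real k * (1 / real n))) \<longlonglongrightarrow> 1 * (1 - real k * 0)"
    by (intro tendsto_mult Suc.IH)
  then have "(\<lambda>n. (if k \<le> n then fact n / (fact (n - k) * real n ^ k) else 0) * (1 - real k * (1 / real n))) \<longlonglongrightarrow> 1"
    by simp
  then show ?case
  proof (rule Lim_transform_eventually)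
    show "\<forall>\<^sub>F n in sequentially. (if k \<le> n then fact n / (fact (n - k) * real n ^ k) else 0) * (1 - real k * (1 / real n)) =
        (if Suc k \<le> n then fact n / (fact (n - Suc k) * real n ^ Suc k) else 0)"
      using eventually_ge_at_top[of "Suc k"]
    proof eventually_elim
      case (elim n)
      then have "n - k = Suc (n - Suc k)" by simp
      then have fact: "fact (n - k) = (real n - real k) * (fact (n - Suc k) :: real)"
        using elim by (simp only: fact_Suc) (simp add: of_nat_diff)
      have nz: "real n - real k \<noteq> 0" "real n \<noteq> 0" using elim by auto
      have "1 - real k * (1 / real n) = (real n - real k) / real n"
        using nz(2) by (simp add: diff_divide_distrib)
      then show ?case using elim nz by (simp add: fact)
    qed
  qed
qed

context normalized_polya
begin

lemma c_tendsto: "(\<lambda>n. c n k) \<longlonglongrightarrow> \<psi> k"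
proof -
  have "(\<lambda>n. (if k \<le> n then fact n / (fact (n - k) * real n ^ k) else 0) * \<psi> k) \<longlonglongrightarrow> 1 * \<psi> k"
    by (intro tendsto_mult falling_ratio_tendsto tendsto_const)
  then show ?thesis by (simp add: c_def[abs_def] if_distrib[of "\<lambda>x. x * \<psi> k"] cong: if_cong)
qed

lemma c_le: "\<bar>c n k\<bar> \<le> \<bar>\<psi> k\<bar>"
proof (cases "k \<le> n \<and> n > 0")
  case True
  then have "fact n / fact (n - k) \<le> real n ^ k"
  proof -
    have "real (fact n div fact (n - k)) \<le> real (n ^ k)"
      using fact_div_fact_le_pow[of k n] True by (simp only: of_nat_le_iff)
    moreover have "real (fact n div fact (n - k)) = fact n / fact (n - k)"
    proof -
      have "(fact (n - k) :: nat) dvd fact n" by (rule fact_dvd) simp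
      then show ?thesis by (subst real_of_nat_div) auto
    qed
    ultimately show ?thesis by simp
  qed
  then have "fact n / (fact (n - k) * real n ^ k) \<le> 1" using True by (simp add: field_simps)
  then have "fact n / (fact (n - k) * real n ^ k) * \<bar>\<psi> k\<bar> \<le> 1 * \<bar>\<psi> k\<bar>" by (intro mult_right_mono) auto
  then show ?thesis using True by (simp add: c_def abs_mult)
qed (auto simp: c_def)

definition \<beta> :: "nat \<Rightarrow> nat \<Rightarrow> real" where
  "\<beta> n = (SOME \<beta>. \<forall>s. g n s = (\<Prod>j<n. 1 + of_real (\<beta> j) * s))"

lemma g_eq:
  assumes "n > 0"
  shows "g n s = (\<Prod>j<n. 1 + of_real (\<beta> n j) * s)"
proof -
  have "\<forall>s. g n s = (\<Prod>j<n. 1 + of_real (\<beta> n j) * s)"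
    unfolding \<beta>_def by (rule someI_ex[OF g_product[OF assms]])
  then show ?thesis by (rule spec)
qed

text \<open>The coefficients of s and of its square in \<open>g n\<close> are
  \<open>\<psi> 1\<close> and \<open>(1 - 1 / n) * \<psi> 2\<close>; Newton's identity converts
  them.\<close>

lemma
  assumes "n \<ge> 2"
  shows sum_\<beta>: "(\<Sum>j<n. \<beta> n j) = \<psi> 1"
    and sum_\<beta>_squares: "(\<Sum>j<n. (\<beta> n j)\<^sup>2) = (\<psi> 1)\<^sup>2 - 2 * (1 - 1 / n) * \<psi> 2"
proof -
  define p where "p = (\<Prod>j<n. [:1, \<beta> n j:])"
  have "(\<Sum>k\<le>n. Polynomial.monom (c n k) k) = p"
  proof (subst poly_eq_poly_eq_iff[symmetric], rule ext)
    fix x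
    have "complex_of_real (poly (\<Sum>k\<le>n. Polynomial.monom (c n k) k) x) = g n (of_real x)"
      by (simp add: g_def poly_sum poly_monom)
    also have "\<dots> = of_real (poly p x)"
      using assms by (subst g_eq) (auto simp: p_def poly_prod mult.commute)
    finally show "poly (\<Sum>k\<le>n. Polynomial.monom (c n k) k) x = poly p x" by (simp only: of_real_eq_iff)
  qed
  moreover have "poly.coeff (\<Sum>k\<le>n. Polynomial.monom (c n k) k) i = c n i" for i
    by (simp add: coeff_sum) (simp add: c_def)
  ultimately have coeff: "poly.coeff p i = c n i" for i by metis
  have fact: "fact n = real n * (real n - 1) * fact (n - 2)"
  proof -
    have "n = Suc (Suc (n - 2))" using assms by simp
    then have "fact n = real (Suc (Suc (n - 2))) * (real (Suc (n - 2)) * fact (n - 2))"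
      by (metis fact_Suc)
    then show ?thesis using assms by (simp add: of_nat_diff)
  qed
  have "c n 2 = real n * (real n - 1) * fact (n - 2) / (fact (n - 2) * real n ^ 2) * \<psi> 2"
    using assms by (simp only: c_def fact) simp
  also have "real n * (real n - 1) * fact (n - 2) / (fact (n - 2) * real n ^ 2) = 1 - 1 / n"
    using assms by (simp add: power2_eq_square diff_divide_distrib)
  finally have c2: "c n 2 = (1 - 1 / n) * \<psi> 2" .
  have "fact n = real n * fact (n - 1)" using assms by (intro fact_reduce) simp
  then have c1: "c n 1 = \<psi> 1" using assms by (simp add: c_def)
  show 1: "(\<Sum>j<n. \<beta> n j) = \<psi> 1"
    using coeff[of 1] c1 poly_prod_linear_coeffs(2)[of "\<beta> n" n] by (simp add: p_def)
  show "(\<Sum>j<n. (\<beta> n j)\<^sup>2) = (\<psi> 1)\<^sup>2 - 2 * (1 - 1 / n) * \<psi> 2"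
  proof -
    have "2 * ((1 - 1 / n) * \<psi> 2) = (\<psi> 1)\<^sup>2 - (\<Sum>j<n. (\<beta> n j)\<^sup>2)"
      using poly_prod_linear_coeffs(3)[of "\<beta> n" n] unfolding p_def[symmetric] coeff c2 1 .
    then show ?thesis by (simp only: mult.assoc)
  qed
qed

definition K :: real where "K = (\<psi> 1)\<^sup>2 + 2 * \<bar>\<psi> 2\<bar>"

lemma sum_\<beta>_squares_le:
  assumes "n \<ge> 2"
  shows "(\<Sum>j<n. (\<beta> n j)\<^sup>2) \<le> K"
proof -
  have "\<bar>(1 - 1 / n) * \<psi> 2\<bar> \<le> 1 * \<bar>\<psi> 2\<bar>"
    unfolding abs_mult using assms by (intro mult_right_mono) auto
  then have "- (2 * (1 - 1 / n) * \<psi> 2) \<le> 2 * \<bar>\<psi> 2\<bar>"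
    by (simp only: mult.assoc abs_le_iff mult_1) linarith
  then show ?thesis unfolding sum_\<beta>_squares[OF assms] K_def by linarith
qed

lemma norm_g_le:
  assumes "n \<ge> 2" "norm s \<le> r"
  shows "norm (g n s) \<le> exp (\<bar>\<psi> 1\<bar> * r + K * r\<^sup>2 / 2)"
proof -
  have r: "r \<ge> 0" using assms(2) norm_ge_zero order_trans by blast
  have "norm (g n s) = (\<Prod>j<n. norm (1 + of_real (\<beta> n j) * s))"
    using assms by (simp add: g_eq prod_norm[symmetric])
  also have "\<dots> \<le> (\<Prod>j<n. exp (Re (of_real (\<beta> n j) * s) + (norm (of_real (\<beta> n j) * s))\<^sup>2 / 2))"
    by (intro prod_mono conjI norm_ge_zero norm_one_plus_le_exp)
  also have "\<dots> = exp (\<Sum>j<n. \<beta> n j * Re s + (\<beta> n j)\<^sup>2 * ((norm s)\<^sup>2 / 2))"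
    by (simp add: exp_sum norm_mult power_mult_distrib)
  also have "(\<Sum>j<n. \<beta> n j * Re s + (\<beta> n j)\<^sup>2 * ((norm s)\<^sup>2 / 2)) =
      \<psi> 1 * Re s + (\<Sum>j<n. (\<beta> n j)\<^sup>2) * ((norm s)\<^sup>2 / 2)"
    by (simp only: sum.distrib sum_distrib_right[symmetric] sum_\<beta>[OF assms(1)])
  also have "\<dots> \<le> \<bar>\<psi> 1\<bar> * r + K * (r\<^sup>2 / 2)"
  proof (rule add_mono)
    have "\<psi> 1 * Re s \<le> \<bar>\<psi> 1\<bar> * \<bar>Re s\<bar>" by (metis abs_ge_self abs_mult)
    also have "\<dots> \<le> \<bar>\<psi> 1\<bar> * r" using assms(2) abs_Re_le_cmod[of s] by (intro mult_left_mono) auto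
    finally show "\<psi> 1 * Re s \<le> \<bar>\<psi> 1\<bar> * r" .
    have "(norm s)\<^sup>2 / 2 \<le> r\<^sup>2 / 2" using assms(2) by (intro divide_right_mono power_mono) auto
    then show "(\<Sum>j<n. (\<beta> n j)\<^sup>2) * ((norm s)\<^sup>2 / 2) \<le> K * (r\<^sup>2 / 2)"
      by (intro mult_mono sum_\<beta>_squares_le assms(1)) (auto simp: K_def)
  qed
  finally show ?thesis by simp
qed

text \<open>Cauchy's estimates for the polynomials \<open>g n\<close> are uniform in
  \<open>n\<close> and survive the limit of the coefficients. As \<open>r\<close> is arbitrary, the
  reciprocal series, so far formal, converges everywhere.\<close>

lemma \<psi>_le:
  assumes "r > 0"
  shows "\<bar>\<psi> k\<bar> \<le> exp (\<bar>\<psi> 1\<bar> * r + K * r\<^sup>2 / 2) / r ^ k"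
proof (rule LIMSEQ_le_const2)
  show "(\<lambda>n. \<bar>c n k\<bar>) \<longlonglongrightarrow> \<bar>\<psi> k\<bar>" by (intro tendsto_rabs c_tendsto)
  have "\<bar>c n k\<bar> \<le> exp (\<bar>\<psi> 1\<bar> * r + K * r\<^sup>2 / 2) / r ^ k" if n: "n \<ge> 2" for n
  proof -
    define p where "p = (\<Sum>k\<le>n. Polynomial.monom (complex_of_real (c n k)) k)"
    have "poly.coeff p k = of_real (c n k)"
      unfolding p_def by (simp add: coeff_sum) (simp add: c_def)
    moreover have "poly p s = g n s" for s by (simp add: p_def g_def poly_sum poly_monom)
    then have "norm (poly.coeff p k) \<le> exp (\<bar>\<psi> 1\<bar> * r + K * r\<^sup>2 / 2) / r ^ k"
      using norm_g_le[OF n, of _ r] by (intro coeff_norm_le_Cauchy assms) auto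
    ultimately show ?thesis by simp
  qed
  then show "\<exists>N. \<forall>n\<ge>N. \<bar>c n k\<bar> \<le> exp (\<bar>\<psi> 1\<bar> * r + K * r\<^sup>2 / 2) / r ^ k" by blast
qed

lemma summable_\<psi>:
  assumes "r \<ge> 0"
  shows "summable (\<lambda>k. \<bar>\<psi> k\<bar> * r ^ k)"
proof (rule summable_comparison_test)
  \<comment> \<open>A radius above 2 r makes the ratio r / R at most 1 / 2; the summand 1 keeps it
    positive when \<open>r\<close> is 0.\<close>
  define R where "R = 2 * r + 1"
  define C where "C = exp (\<bar>\<psi> 1\<bar> * R + K * R\<^sup>2 / 2)"
  have R: "R > 0" using assms by (simp add: R_def)
  show "summable (\<lambda>k. C * (1 / 2) ^ k)" by (intro summable_mult summable_geometric) simp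
  have "norm (\<bar>\<psi> k\<bar> * r ^ k) \<le> C * (1 / 2) ^ k" for k
  proof -
    have "\<bar>\<psi> k\<bar> * r ^ k \<le> C / R ^ k * r ^ k"
      unfolding C_def using assms by (intro mult_right_mono \<psi>_le R) auto
    also have "\<dots> = C * (r / R) ^ k" by (simp add: power_divide)
    also have "\<dots> \<le> C * (1 / 2) ^ k"
      using assms by (intro mult_left_mono power_mono) (auto simp: C_def R_def field_simps)
    finally show ?thesis using assms by simp
  qed
  then show "\<exists>N. \<forall>k\<ge>N. norm (\<bar>\<psi> k\<bar> * r ^ k) \<le> C * (1 / 2) ^ k" by blast
qed

definition \<Psi> :: "complex \<Rightarrow> complex" where
  "\<Psi> s = (\<Sum>k. of_real (\<psi> k) * s ^ k)"

lemma summable_norm_\<psi>: "summable (\<lambda>k. norm (complex_of_real (\<psi> k) * s ^ k))"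
  using summable_\<psi>[of "norm s"] by (simp add: norm_mult norm_power)

lemma \<Psi>_sums: "(\<lambda>k. of_real (\<psi> k) * s ^ k) sums \<Psi> s"
  unfolding \<Psi>_def by (rule summable_sums[OF summable_norm_cancel[OF summable_norm_\<psi>]])

lemma \<Psi>_holomorphic: "\<Psi> holomorphic_on A"
proof -
  have "\<Psi> field_differentiable at s" for s
  proof (rule holomorphic_on_imp_differentiable_at)
    show "\<Psi> holomorphic_on ball 0 (norm s + 1)"
      by (rule power_series_holomorphic[of 0 _ "\<lambda>k. of_real (\<psi> k)"]) (simp add: \<Psi>_sums)
  qed auto
  then show ?thesis unfolding holomorphic_on_def by (blast intro: field_differentiable_at_within)
qed

lemma \<Psi>_0: "\<Psi> 0 = 1"
proof -
  have "\<Psi> 0 = of_real (\<psi> 0)" unfolding \<Psi>_def by (rule powser_zero)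
  then show ?thesis by (simp only: \<psi>_0 of_real_1)
qed

text \<open>On the disc the error is at most \<open>D n\<close>, the sum of the coefficient errors
  weighted with \<open>r ^ k\<close>. Tannery's theorem with the majorant
  \<open>2 * (\<bar>\<psi> k\<bar> * r ^ k)\<close> sends it to 0.\<close>

lemma uniform_limit_g: "uniform_limit (cball 0 r) g \<Psi> sequentially"
proof (cases "r \<ge> 0")
  case True
  define D where "D n = (\<Sum>k. \<bar>c n k - \<psi> k\<bar> * r ^ k)" for n
  have c_sub: "\<bar>c n k - \<psi> k\<bar> \<le> 2 * \<bar>\<psi> k\<bar>" for n k
    using c_le[of n k] by linarith
  have summ: "summable (\<lambda>k. \<bar>c n k - \<psi> k\<bar> * r ^ k)" for n
  proof (rule summable_comparison_test)
    show "summable (\<lambda>k. 2 * (\<bar>\<psi> k\<bar> * r ^ k))" by (intro summable_mult summable_\<psi> True)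
    show "\<exists>N. \<forall>k\<ge>N. norm (\<bar>c n k - \<psi> k\<bar> * r ^ k) \<le> 2 * (\<bar>\<psi> k\<bar> * r ^ k)"
      using mult_right_mono[OF c_sub zero_le_power[OF True]] True by (simp add: mult.assoc)
  qed
  have "D \<longlonglongrightarrow> (\<Sum>k. 0)"
    unfolding D_def
  proof (rule tannerys_theorem[THEN conjunct2, THEN conjunct2])
    show "(\<lambda>n. \<bar>c n k - \<psi> k\<bar> * r ^ k) \<longlonglongrightarrow> 0" for k
      using tendsto_mult_right[OF tendsto_rabs[OF tendsto_diff[OF c_tendsto[of k] tendsto_const[of "\<psi> k"]]], of "r ^ k"]
      by simp
    show "\<forall>\<^sub>F (k, n) in at_top \<times>\<^sub>F sequentially. norm (\<bar>c n k - \<psi> k\<bar> * r ^ k) \<le> 2 * (\<bar>\<psi> k\<bar> * r ^ k)"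
      using mult_right_mono[OF c_sub zero_le_power[OF True]] True
      by (intro always_eventually allI) (auto simp: mult.assoc split: prod.split)
    show "summable (\<lambda>k. 2 * (\<bar>\<psi> k\<bar> * r ^ k))" by (intro summable_mult summable_\<psi> True)
  qed simp
  then have D: "D \<longlonglongrightarrow> 0" by simp
  have le: "dist (g n s) (\<Psi> s) \<le> D n" if s: "s \<in> cball 0 r" for n s
  proof -
    have "(\<lambda>k. of_real (c n k) * s ^ k) sums g n s"
      unfolding g_def by (rule sums_finite) (auto simp: c_def)
    then have diff: "(\<lambda>k. of_real (c n k) * s ^ k - of_real (\<psi> k) * s ^ k) sums (g n s - \<Psi> s)"
      using \<Psi>_sums by (rule sums_diff)
    have bound: "norm (of_real (c n k) * s ^ k - of_real (\<psi> k) * s ^ k) \<le> \<bar>c n k - \<psi> k\<bar> * r ^ k" for k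
    proof -
      have "norm (of_real (c n k) * s ^ k - of_real (\<psi> k) * s ^ k) = \<bar>c n k - \<psi> k\<bar> * norm s ^ k"
        unfolding left_diff_distrib[symmetric] of_real_diff[symmetric] norm_mult norm_power norm_of_real ..
      also have "\<dots> \<le> \<bar>c n k - \<psi> k\<bar> * r ^ k"
        using s by (intro mult_left_mono power_mono) auto
      finally show ?thesis .
    qed
    have "norm (\<Sum>k. of_real (c n k) * s ^ k - of_real (\<psi> k) * s ^ k) \<le> D n"
      unfolding D_def by (rule norm_suminf_le[OF bound summ])
    then show ?thesis using sums_unique[OF diff] by (simp add: dist_norm)
  qed
  show ?thesis
    unfolding uniform_limit_iff
  proof (intro allI impI)
    fix e :: real assume "e > 0"
    then have "\<forall>\<^sub>F n in sequentially. D n < e" using D by (intro order_tendstoD)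
    then show "\<forall>\<^sub>F n in sequentially. \<forall>s\<in>cball 0 r. dist (g n s) (\<Psi> s) < e"
    proof eventually_elim
      case (elim n)
      show ?case using le[of _ n] elim by (meson le_less_trans)
    qed
  qed
next
  case False
  then have "cball (0 :: complex) r = {}" by simp
  then show ?thesis by (simp add: uniform_limit_iff)
qed

lemma g_tendsto: "(\<lambda>n. g n s) \<longlonglongrightarrow> \<Psi> s"
  by (rule tendsto_uniform_limitI[OF uniform_limit_g[of "norm s"]]) simp

lemma zero_in_strip: "0 \<in> laplace_strip f"
  using converges by (intro laplace_stripI[OF \<epsilon>_pos]) simp

lemma laplace_\<Psi>_near_0:
  assumes "norm w < \<epsilon>"
  shows "bilateral_laplace f w * \<Psi> w = 1"
proof -
  have B: "(\<lambda>n. of_real (B $ n) * w ^ n) sums bilateral_laplace f w"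
    using laplace_power_series[OF \<epsilon>_pos, of 0 f w] converges assms
    by (simp add: laplace_moment_0 B_def)
  \<comment> \<open>The series of the transform converges at \<rho>, hence absolutely at
    \<open>w\<close>, as the Cauchy product requires.\<close>
  obtain \<rho> where \<rho>: "norm w < \<rho>" "\<rho> < \<epsilon>" using dense[OF assms] by blast
  have "summable (\<lambda>n. of_real (B $ n) * complex_of_real \<rho> ^ n)"
    using laplace_power_series[OF \<epsilon>_pos, of 0 f "of_real \<rho>"] converges \<rho>(2) order_le_less_trans[OF norm_ge_zero \<rho>(1)]
    by (simp add: laplace_moment_0 B_def sums_iff)
  then have "summable (\<lambda>n. norm (of_real (B $ n) * w ^ n))"
    by (rule powser_insidea) (use \<rho>(1) order_le_less_trans[OF norm_ge_zero \<rho>(1)] in simp)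
  then have "(\<lambda>n. \<Sum>i\<le>n. (of_real (\<psi> i) * w ^ i) * (of_real (B $ (n - i)) * w ^ (n - i))) sums
      ((\<Sum>n. of_real (\<psi> n) * w ^ n) * (\<Sum>n. of_real (B $ n) * w ^ n))"
    by (intro Cauchy_product_sums summable_norm_\<psi>)
  moreover have "(\<Sum>i\<le>n. (of_real (\<psi> i) * w ^ i) * (of_real (B $ (n - i)) * w ^ (n - i))) =
      (if n = 0 then 1 else 0)" for n
  proof -
    have "(\<Sum>i\<le>n. (of_real (\<psi> i) * w ^ i) * (of_real (B $ (n - i)) * w ^ (n - i))) =
        (\<Sum>i\<le>n. of_real (\<psi> i * B $ (n - i)) * w ^ n)"
    proof (intro sum.cong refl)
      fix i assume "i \<in> {..n}"
      then have "w ^ n = w ^ i * w ^ (n - i)" by (simp add: power_add[symmetric])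
      then show "(of_real (\<psi> i) * w ^ i) * (of_real (B $ (n - i)) * w ^ (n - i)) = of_real (\<psi> i * B $ (n - i)) * w ^ n"
        by simp
    qed
    also have "\<dots> = of_real (\<Sum>i\<le>n. \<psi> i * B $ (n - i)) * w ^ n"
      by (simp add: sum_distrib_right)
    finally show ?thesis unfolding \<psi>_B by simp
  qed
  moreover have "(\<lambda>n. if n = 0 then 1 else 0) sums (1 :: complex)"
    using sums_single[of 0 "\<lambda>_. 1 :: complex"] by simp
  ultimately show ?thesis
    using sums_unique[OF B] sums_unique[OF \<Psi>_sums[of w]] by (simp add: sums_iff mult.commute)
qed

lemma laplace_\<Psi>:
  assumes "s \<in> laplace_strip f"
  shows "bilateral_laplace f s * \<Psi> s = 1"
proof -
  have "bilateral_laplace f s * \<Psi> s - 1 = 0"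
  proof (rule analytic_continuation[of "\<lambda>s. bilateral_laplace f s * \<Psi> s - 1" "laplace_strip f" "ball 0 \<epsilon>" 0])
    show "(\<lambda>s. bilateral_laplace f s * \<Psi> s - 1) holomorphic_on laplace_strip f"
      by (intro holomorphic_intros bilateral_laplace_holomorphic \<Psi>_holomorphic)
    show "ball 0 \<epsilon> \<subseteq> laplace_strip f"
    proof
      fix w :: complex assume "w \<in> ball 0 \<epsilon>"
      then have w: "norm w < \<epsilon>" by simp
      show "w \<in> laplace_strip f"
      proof (rule laplace_stripI[of "\<epsilon> - norm w"])
        fix z assume "\<bar>Re z - Re w\<bar> \<le> \<epsilon> - norm w"
        then show "laplace_converges f z" using abs_Re_le_cmod[of w] by (intro converges) linarith
      qed (use w in simp)
    qed
    show "(0 :: complex) islimpt ball 0 \<epsilon>" using \<epsilon>_pos by (intro interior_limit_point) simp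
    show "bilateral_laplace f w * \<Psi> w - 1 = 0" if "w \<in> ball 0 \<epsilon>" for w
      using laplace_\<Psi>_near_0[of w] that by simp
  qed (use assms zero_in_strip open_laplace_strip convex_laplace_strip convex_connected in auto)
  then show ?thesis by simp
qed

text \<open>The variance of \<open>f\<close>, and the limit of the sums of squares of the
  \<beta>.\<close>

definition v :: real where "v = (\<psi> 1)\<^sup>2 - 2 * \<psi> 2"

lemma v_pos: "v > 0"
proof -
  have 1: "\<psi> 1 = moment 1"
    using \<psi>_B[of 1] by (simp add: \<psi>_0 B_0) (simp add: B_def)
  have "\<psi> 2 + \<psi> 1 * B $ 1 + B $ 2 = 0"
    using \<psi>_B[of 2] by (simp add: \<psi>_0 B_0 numeral_2_eq_2)
  moreover have "B $ 1 = - moment 1" "B $ 2 = moment 2 / 2" by (simp_all add: B_def)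
  ultimately have v: "v = moment 2 - (moment 1)\<^sup>2"
    unfolding v_def 1 by (simp add: power2_eq_square)
  define m where "m = moment 1"
  have int: "integrable lebesgue (\<lambda>y. (y - m)\<^sup>2 * f y)"
    and eq: "(LINT y|lebesgue. (y - m)\<^sup>2 * f y) = v"
  proof -
    have *: "(y - m)\<^sup>2 * f y = y ^ 2 * f y - 2 * m * (y ^ 1 * f y) + m\<^sup>2 * (y ^ 0 * f y)" for y
      by (simp add: power2_eq_square algebra_simps)
    note int = moment_integrable[of 2] moment_integrable[of 1] moment_integrable[of 0]
    show "integrable lebesgue (\<lambda>y. (y - m)\<^sup>2 * f y)"
      unfolding * by (intro Bochner_Integration.integrable_add Bochner_Integration.integrable_diff integrable_mult_right moment_integrable)
    have "(LINT y|lebesgue. (y - m)\<^sup>2 * f y) = moment 2 - 2 * m * moment 1 + m\<^sup>2 * moment 0"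
      unfolding * moment_def
      by (subst Bochner_Integration.integral_add Bochner_Integration.integral_diff,
          intro Bochner_Integration.integrable_diff integrable_mult_right moment_integrable,
          intro integrable_mult_right moment_integrable)+
         (simp only: integral_mult_right_zero)
    then show "(LINT y|lebesgue. (y - m)\<^sup>2 * f y) = v"
      unfolding v by (simp add: m_def moment_def[of 0] total power2_eq_square)
  qed
  have "v \<ge> 0" unfolding eq[symmetric] using nonneg by simp
  moreover have "v \<noteq> 0"
  proof
    \<comment> \<open>A density of variance 0 would be concentrated at its mean, which is a null
      set.\<close>
    assume "v = 0"
    then have "AE y in lebesgue. (y - m)\<^sup>2 * f y = 0"
      using integral_nonneg_eq_0_iff_AE[OF int] nonneg eq by simp
    moreover have "AE y in lebesgue. y \<noteq> m"
      using AE_lborel_singleton[of m] by (simp add: AE_completion_iff)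
    ultimately have "AE y in lebesgue. f y = 0" by eventually_elim simp
    then have "(LINT y|lebesgue. f y) = 0" by (rule integral_eq_zero_AE)
    then show False using total by simp
  qed
  ultimately show ?thesis by simp
qed

lemma eventually_sum_\<beta>_squares_ge: "\<forall>\<^sub>F n in sequentially. v / 2 \<le> (\<Sum>j<n. (\<beta> n j)\<^sup>2)"
proof -
  have "(\<lambda>n. (\<psi> 1)\<^sup>2 - 2 * (1 - 1 / real n) * \<psi> 2) \<longlonglongrightarrow> (\<psi> 1)\<^sup>2 - 2 * (1 - 0) * \<psi> 2"
    by (intro tendsto_intros lim_1_over_n)
  then have "\<forall>\<^sub>F n in sequentially. v / 2 < (\<psi> 1)\<^sup>2 - 2 * (1 - 1 / real n) * \<psi> 2"
    using v_pos by (intro order_tendstoD) (auto simp: v_def)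
  then show ?thesis
    using eventually_ge_at_top[of 2] by eventually_elim (simp add: sum_\<beta>_squares)
qed

end

section \<open>Powers of the transform\<close>

text \<open>A continuous logarithm starting at 0 stays on the principal branch as long as its
  exponential stays in the right half plane.\<close>

lemma path_log_principal:
  fixes d :: "real \<Rightarrow> complex"
  assumes cont: "continuous_on {0..1} d" and d0: "d 0 = 0"
    and Re: "\<And>t. t \<in> {0..1} \<Longrightarrow> 0 < Re (exp (d t))"
  shows "d 1 = Ln (exp (d 1))"
proof -
  have cos: "cos (Im (d t)) > 0" if "t \<in> {0..1}" for t
    using Re[OF that] by (simp add: Re_exp zero_less_mult_iff)
  have cont_Im: "continuous_on {0..1} (\<lambda>t. Im (d t))" by (intro continuous_intros cont)
  have "Im (d 1) < pi / 2"
  proof (rule ccontr)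
    assume "\<not> ?thesis"
    then have "\<exists>t\<ge>0. t \<le> 1 \<and> Im (d t) = pi / 2"
      using d0 cont_Im by (intro IVT') auto
    then obtain t where t: "0 \<le> t" "t \<le> 1" "Im (d t) = pi / 2" by blast
    have "cos (Im (d t)) = 0" unfolding t(3) by (rule cos_pi_half)
    then show False using cos[of t] t(1,2) by simp
  qed
  moreover have "- (pi / 2) < Im (d 1)"
  proof (rule ccontr)
    assume "\<not> ?thesis"
    then have "\<exists>t\<ge>0. t \<le> 1 \<and> Im (d t) = - (pi / 2)"
      using d0 cont_Im by (intro IVT2') auto
    then obtain t where t: "0 \<le> t" "t \<le> 1" "Im (d t) = - (pi / 2)" by blast
    then show False using cos[of t] by simp
  qed
  ultimately show ?thesis using pi_gt_zero by (intro Ln_exp[symmetric]) linarith+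
qed

lemma one_plus_sum_le_prod:
  fixes x :: "nat \<Rightarrow> real"
  assumes "\<And>j. 0 \<le> x j"
  shows "1 + (\<Sum>j<n. x j) \<le> (\<Prod>j<n. 1 + x j)"
proof (induction n)
  case (Suc n)
  have "1 + (\<Sum>j<Suc n. x j) \<le> (1 + (\<Sum>j<n. x j)) * (1 + x n)"
    using assms sum_nonneg[of "{..<n}" x] by (simp add: algebra_simps)
  also have "\<dots> \<le> (\<Prod>j<n. 1 + x j) * (1 + x n)"
    using assms[of n] by (intro mult_right_mono Suc.IH) simp
  finally show ?case by simp
qed simp

lemma integrable_mult_nonzero_iff:
  fixes h :: "'a \<Rightarrow> 'b :: {real_normed_field, second_countable_topology}"
  assumes "c \<noteq> 0"
  shows "integrable M (\<lambda>x. c * h x) \<longleftrightarrow> integrable M h"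
proof
  assume "integrable M (\<lambda>x. c * h x)"
  then have "integrable M (\<lambda>x. inverse c * (c * h x))" by (rule integrable_mult_right)
  then show "integrable M h" using assms by (simp add: mult.assoc[symmetric])
qed (rule integrable_mult_right)

lemma laplace_scale:
  assumes "c \<noteq> 0"
  shows "laplace_converges (\<lambda>x. c * f x) s \<longleftrightarrow> laplace_converges f s"
    and "bilateral_laplace (\<lambda>x. c * f x) s = of_real c * bilateral_laplace f s"
proof -
  have eq: "exp (- (complex_of_real x * s)) * of_real (c * f x) = of_real c * (exp (- (complex_of_real x * s)) * of_real (f x))" for x
    by (simp add: mult.left_commute)
  show "laplace_converges (\<lambda>x. c * f x) s \<longleftrightarrow> laplace_converges f s"
    unfolding laplace_converges_def eq using assms by (intro integrable_mult_nonzero_iff) simp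
  show "bilateral_laplace (\<lambda>x. c * f x) s = of_real c * bilateral_laplace f s"
    unfolding bilateral_laplace_def eq by (rule integral_mult_right_zero)
qed

lemma laplace_rescale:
  assumes "b \<noteq> 0"
  shows "laplace_converges (\<lambda>x. 1 / \<bar>b\<bar> * f (x / b)) s \<longleftrightarrow> laplace_converges f (of_real b * s)"
    and "bilateral_laplace (\<lambda>x. 1 / \<bar>b\<bar> * f (x / b)) s = bilateral_laplace f (of_real b * s)"
proof -
  define F where "F x = exp (- (complex_of_real x * s)) * complex_of_real (1 / \<bar>b\<bar> * f (x / b))" for x
  have F: "F (0 + b * x) = of_real (1 / \<bar>b\<bar>) * (exp (- (complex_of_real x * (of_real b * s))) * complex_of_real (f x))" for x
    using assms by (simp add: F_def mult_ac)
  have "integrable lebesgue (\<lambda>x. F (0 + b * x)) \<longleftrightarrow> integrable lebesgue F"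
    by (rule lebesgue_integrable_real_affine_iff[OF assms])
  moreover have "integrable lebesgue (\<lambda>x. c * h x) \<longleftrightarrow> integrable lebesgue h" if "c \<noteq> 0"
    for c and h :: "real \<Rightarrow> complex"
    using that by (rule integrable_mult_nonzero_iff)
  ultimately show "laplace_converges (\<lambda>x. 1 / \<bar>b\<bar> * f (x / b)) s \<longleftrightarrow> laplace_converges f (of_real b * s)"
    unfolding F laplace_converges_def F_def[symmetric, abs_def] using assms by (metis (no_types) divide_eq_0_iff abs_eq_0 of_real_eq_0_iff zero_neq_one)
  have "bilateral_laplace (\<lambda>x. 1 / \<bar>b\<bar> * f (x / b)) s = integral\<^sup>L lebesgue F"
    unfolding bilateral_laplace_def F_def ..
  also have "\<dots> = \<bar>b\<bar> *\<^sub>R (LINT x|lebesgue. F (0 + b * x))"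
    by (rule lebesgue_integral_real_affine[OF assms])
  also have "\<dots> = bilateral_laplace f (of_real b * s)"
    unfolding F bilateral_laplace_def integral_mult_right_zero using assms by (simp add: scaleR_conv_of_real)
  finally show "bilateral_laplace (\<lambda>x. 1 / \<bar>b\<bar> * f (x / b)) s = bilateral_laplace f (of_real b * s)" .
qed

text \<open>Each factor contributes a gamma density rescaled by \<beta>, reflected if \<beta> is
  negative. Boundedness is carried along because the next convolution requires it. The index set is
  nonempty, since the empty product 1 is the transform of a point mass and not of a
  function.\<close>

lemma gamma_convolution:
  assumes "finite J" "J \<noteq> {}" "\<And>j. j \<in> J \<Longrightarrow> \<beta> j \<noteq> (0 :: real)" and \<alpha>: "\<alpha> > real p - 1" "\<alpha> > 1"
  shows "\<exists>h. TN p h \<and> (\<exists>C. \<forall>x. \<bar>h x\<bar> \<le> C) \<and>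
    (\<forall>s. (\<forall>j\<in>J. 0 < 1 + \<beta> j * Re s) \<longrightarrow> laplace_converges h s \<and>
       bilateral_laplace h s = (\<Prod>j\<in>J. exp (- (of_real \<alpha> * Ln (1 + of_real (\<beta> j) * s)))))"
  using assms(1-3)
proof (induction J rule: finite_ne_induct)
  case (singleton j)
  define b where "b = \<beta> j"
  have b: "b \<noteq> 0" using singleton by (simp add: b_def)
  define h where "h x = 1 / \<bar>b\<bar> * gamma_density \<alpha> (x / b)" for x
  have "TN p h" unfolding h_def using \<alpha> b by (intro TN_rescale TN_gamma_density) auto
  moreover have "\<bar>h x\<bar> \<le> 1 / \<bar>b\<bar> * ((\<alpha> - 1) powr (\<alpha> - 1) / Gamma \<alpha>)" for x
    unfolding h_def abs_mult abs_divide abs_abs abs_one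
    using gamma_density_bounded[OF \<alpha>(2)] by (intro mult_left_mono) (auto simp: abs_divide)
  moreover have "laplace_converges h s \<and> bilateral_laplace h s = exp (- (of_real \<alpha> * Ln (1 + of_real b * s)))"
    if "0 < 1 + b * Re s" for s
    unfolding h_def laplace_rescale[OF b] using that \<alpha> by (intro conjI gamma_density_laplace) auto
  ultimately show ?case by (intro exI[of _ h]) (auto simp: b_def)
next
  case (insert j J)
  obtain h C where h: "TN p h" "\<And>x. \<bar>h x\<bar> \<le> C"
    "\<And>s. (\<And>j. j \<in> J \<Longrightarrow> 0 < 1 + \<beta> j * Re s) \<Longrightarrow> laplace_converges h s \<and>
       bilateral_laplace h s = (\<Prod>j\<in>J. exp (- (of_real \<alpha> * Ln (1 + of_real (\<beta> j) * s))))"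
    using insert.IH insert.prems by (auto simp: Ball_def)
  define b where "b = \<beta> j"
  have b: "b \<noteq> 0" using insert.prems by (simp add: b_def)
  define k where "k x = 1 / \<bar>b\<bar> * gamma_density \<alpha> (x / b)" for x
  have TN_k: "TN p k" unfolding k_def using \<alpha> b by (intro TN_rescale TN_gamma_density) auto
  have k: "laplace_converges k s \<and> bilateral_laplace k s = exp (- (of_real \<alpha> * Ln (1 + of_real b * s)))"
    if "0 < 1 + b * Re s" for s
    unfolding k_def laplace_rescale[OF b] using that \<alpha> by (intro conjI gamma_density_laplace) auto
  have int: "integrable lebesgue h" "integrable lebesgue k"
    using h(3)[of 0] k[of 0] by (auto simp: laplace_converges_0_iff)
  have "TN p (convolve h k)" by (rule TN_convolve[OF h(1) int(1) h(2) TN_k int(2)])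
  moreover have "\<exists>C. \<forall>x. \<bar>convolve h k x\<bar> \<le> C" using convolve_bounded[OF h(2) int] by blast
  moreover have "laplace_converges (convolve h k) s \<and> bilateral_laplace (convolve h k) s =
      (\<Prod>j\<in>insert j J. exp (- (of_real \<alpha> * Ln (1 + of_real (\<beta> j) * s))))"
    if "\<forall>j\<in>insert j J. 0 < 1 + \<beta> j * Re s" for s
    using h(3)[of s] k[of s] laplace_convolve[of h s k] that insert.hyps by (simp add: b_def mult.commute)
  ultimately show ?case by blast
qed

section \<open>The branch of the power and its approximation\<close>

context normalized_polya
begin

lemma \<Psi>_nonzero: "s \<in> laplace_strip f \<Longrightarrow> \<Psi> s \<noteq> 0"
  using laplace_\<Psi>[of s] by auto

lemma segment_in_strip: "s \<in> laplace_strip f \<Longrightarrow> t \<in> {0..1} \<Longrightarrow> of_real t * s \<in> laplace_strip f"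
  using convexD[OF convex_laplace_strip[of f] zero_in_strip, of s "1 - t" t] by (simp add: scaleR_conv_of_real)

text \<open>\<open>\<Psi>\<close> is bounded away from 0 on the compact segment from 0 to
  \<open>s\<close>, on which \<open>g n\<close> converges uniformly. The quotient then stays in the
  unit disc about 1, hence in the right half plane.\<close>

lemma eventually_g_near_\<Psi>:
  assumes s: "s \<in> laplace_strip f"
  shows "\<forall>\<^sub>F n in sequentially. \<forall>t\<in>{0..1}. g n (of_real t * s) \<noteq> 0 \<and>
    norm (\<Psi> (of_real t * s) / g n (of_real t * s) - 1) < 1"
proof -
  have "continuous_on {0..1} (\<lambda>t. norm (\<Psi> (complex_of_real t * s)))"
    by (intro continuous_intros continuous_on_compose2[OF holomorphic_on_imp_continuous_on[OF \<Psi>_holomorphic[of UNIV]]]) auto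
  then obtain t0 where t0: "t0 \<in> {0..1}" "\<And>t. t \<in> {0..1} \<Longrightarrow> norm (\<Psi> (complex_of_real t0 * s)) \<le> norm (\<Psi> (complex_of_real t * s))"
    using continuous_attains_inf[of "{0..1::real}" "\<lambda>t. norm (\<Psi> (complex_of_real t * s))"] by auto
  \<comment> \<open>An error below a third of this minimum leaves the modulus of \<open>g n\<close>
    above two thirds of it, so the quotient differs from 1 by less than 1 / 2.\<close>
  define \<delta> where "\<delta> = norm (\<Psi> (complex_of_real t0 * s))"
  have \<delta>: "\<delta> > 0" using \<Psi>_nonzero[OF segment_in_strip[OF s t0(1)]] by (simp add: \<delta>_def)
  have "\<forall>\<^sub>F n in sequentially. \<forall>w\<in>cball 0 (norm s). dist (g n w) (\<Psi> w) < \<delta> / 3"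
    using uniform_limit_g[of "norm s"] \<delta> unfolding uniform_limit_iff by (meson divide_pos_pos zero_less_numeral)
  then show ?thesis
  proof (rule eventually_mono, intro ballI)
    fix n and t :: real
    assume n: "\<forall>w\<in>cball 0 (norm s). dist (g n w) (\<Psi> w) < \<delta> / 3" and t: "t \<in> {0..1}"
    define w where "w = complex_of_real t * s"
    have "norm w \<le> norm s" using t by (simp add: w_def norm_mult mult_left_le_one_le)
    then have close: "norm (g n w - \<Psi> w) < \<delta> / 3" using n by (simp add: dist_norm)
    have "\<delta> \<le> norm (\<Psi> w)" using t0(2)[OF t] by (simp add: \<delta>_def w_def)
    then have g: "norm (g n w) > 2 * \<delta> / 3"
      using close norm_triangle_ineq2[of "\<Psi> w" "g n w"] by (simp add: norm_minus_commute)
    then have nz: "g n w \<noteq> 0" using \<delta> by auto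
    then have "norm (\<Psi> w / g n w - 1) = norm (g n w - \<Psi> w) / norm (g n w)"
      by (simp add: norm_divide[symmetric] norm_minus_commute diff_divide_distrib)
    also have "\<dots> < 1" using close g \<delta> nz by (simp add: divide_less_eq)
    finally show "g n (of_real t * s) \<noteq> 0 \<and> norm (\<Psi> (of_real t * s) / g n (of_real t * s) - 1) < 1"
      using nz by (simp add: w_def)
  qed
qed

text \<open>All factors are 1 at 0. One that is not positive at \<open>Re s\<close> would vanish
  somewhere on the segment from 0 to \<open>Re s\<close>, and so would \<open>g n\<close>, which is
  eventually excluded.\<close>

lemma eventually_factors_pos:
  assumes s: "s \<in> laplace_strip f"
  shows "\<forall>\<^sub>F n in sequentially. \<forall>j<n. 0 < 1 + \<beta> n j * Re s"
proof -
  have "of_real (Re s) \<in> laplace_strip f" using s by (rule laplace_strip_Re_cong) simp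
  from eventually_g_near_\<Psi>[OF this] show ?thesis
    using eventually_gt_at_top[of 0]
  proof eventually_elim
    case (elim n)
    show ?case
    proof (intro allI impI, rule ccontr)
      fix j assume j: "j < n" and neg: "\<not> 0 < 1 + \<beta> n j * Re s"
      define t where "t = - 1 / (\<beta> n j * Re s)"
      have "\<beta> n j * Re s \<le> - 1" using neg by simp
      then have t: "t \<in> {0..1}" "1 + \<beta> n j * (t * Re s) = 0"
        by (auto simp: t_def divide_simps)
      have "1 + of_real (\<beta> n j) * (of_real t * of_real (Re s)) = (0 :: complex)"
        using t(2) by (metis of_real_0 of_real_1 of_real_add of_real_mult)
      then have "g n (of_real t * of_real (Re s)) = 0"
        using j elim(2) unfolding g_eq[OF elim(2)] by (intro prod_zero bexI[of _ j]) auto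
      then show False using elim(1) t(1) by blast
    qed
  qed
qed

lemma ex_log_laplace:
  "\<exists>L. L holomorphic_on laplace_strip f \<and> L 0 = 0 \<and>
    (\<forall>s\<in>laplace_strip f. exp (L s) = bilateral_laplace f s)"
proof -
  have nz: "bilateral_laplace f s \<noteq> 0" if "s \<in> laplace_strip f" for s
    using laplace_\<Psi>[OF that] by auto
  obtain L where L: "L holomorphic_on laplace_strip f" "\<And>s. s \<in> laplace_strip f \<Longrightarrow> bilateral_laplace f s = exp (L s)"
    using contractible_imp_holomorphic_log[OF bilateral_laplace_holomorphic
        convex_imp_contractible[OF convex_laplace_strip] nz] by blast
  have "bilateral_laplace f 0 = 1" using laplace_\<Psi>[OF zero_in_strip] \<Psi>_0 by simp
  then have "exp (L 0) = 1" using L(2)[OF zero_in_strip] by simp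
  then show ?thesis
    using L by (intro exI[of _ "\<lambda>s. L s - L 0"]) (auto intro!: holomorphic_intros simp: exp_diff)
qed

definition L :: "complex \<Rightarrow> complex" where
  "L = (SOME L. L holomorphic_on laplace_strip f \<and> L 0 = 0 \<and>
    (\<forall>s\<in>laplace_strip f. exp (L s) = bilateral_laplace f s))"

lemma L_holomorphic: "L holomorphic_on laplace_strip f"
  and L_0: "L 0 = 0"
  and exp_L: "s \<in> laplace_strip f \<Longrightarrow> exp (L s) = bilateral_laplace f s"
  using someI_ex[OF ex_log_laplace] unfolding L_def[symmetric] by auto

lemma bilateral_laplace_cnj: "bilateral_laplace f (cnj s) = cnj (bilateral_laplace f s)"
proof -
  have "exp (- (complex_of_real x * cnj s)) * complex_of_real (f x) = cnj (exp (- (complex_of_real x * s)) * complex_of_real (f x))" for x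
    by (simp add: exp_cnj)
  then show ?thesis unfolding bilateral_laplace_def by (simp only: Bochner_Integration.integral_cnj)
qed

text \<open>Conjugating argument and value gives another logarithm of the transform that vanishes at
  0, and such a logarithm is unique.\<close>

lemma L_real:
  assumes "of_real r \<in> laplace_strip f"
  shows "L (of_real r) \<in> \<real>"
proof -
  have cnj_strip: "cnj s \<in> laplace_strip f" if "s \<in> laplace_strip f" for s
    using that by (rule laplace_strip_Re_cong) simp
  have "cnj ` laplace_strip f \<subseteq> laplace_strip f" using cnj_strip by auto
  then have "(\<lambda>s. cnj (L (cnj s))) holomorphic_on laplace_strip f"
    using holomorphic_on_compose_cnj_cnj[OF holomorphic_on_subset[OF L_holomorphic] open_laplace_strip]
    by (simp add: o_def)
  moreover have "exp (cnj (L (cnj s))) = exp (L s)" if "s \<in> laplace_strip f" for s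
    using exp_L[OF cnj_strip[OF that]] exp_L[OF that] by (simp add: exp_cnj[symmetric] bilateral_laplace_cnj)
  ultimately have "cnj (L (cnj (of_real r))) = L (of_real r)"
    by (rule holomorphic_log_unique[where L = "\<lambda>s. cnj (L (cnj s))", OF open_laplace_strip convex_laplace_strip zero_in_strip _ L_holomorphic _ _ assms])
      (simp_all add: L_0)
  then show ?thesis unfolding complex_cnj_complex_of_real Reals_cnj_iff .
qed

lemma positive_power_L:
  "positive_power_on (laplace_strip f) (bilateral_laplace f) \<alpha> (\<lambda>s. exp (of_real \<alpha> * L s))"
  unfolding positive_power_on_def
proof (intro conjI exI[of _ L] L_holomorphic ballI allI impI)
  fix r :: real assume "of_real r \<in> laplace_strip f"
  then obtain l where "L (of_real r) = of_real l" using L_real by (auto elim: Reals_cases)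
  then show "\<exists>c::real. 0 < c \<and> exp (of_real \<alpha> * L (of_real r)) = of_real c"
    by (intro exI[of _ "exp (\<alpha> * l)"]) (simp only: of_real_mult[symmetric] exp_of_real exp_gt_zero simp_thms)
qed (auto simp: exp_L)

definition G_approx :: "real \<Rightarrow> nat \<Rightarrow> complex \<Rightarrow> complex" where
  "G_approx \<alpha> n s = (\<Prod>j<n. exp (- (of_real \<alpha> * Ln (1 + of_real (\<beta> n j) * s))))"

text \<open>The discrepancy \<open>d n t\<close> between the sum of principal logarithms and
  \<open>L\<close> is 0 at t = 0, and its exponential stays in the unit disc about 1 along the
  segment. So \<open>d n 1\<close> is the principal logarithm of \<open>\<Psi> s / g n s\<close> and
  tends to 0, which is enough for powers with any exponent.\<close>

lemma G_approx_tendsto: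
  assumes s: "s \<in> laplace_strip f"
  shows "(\<lambda>n. G_approx \<alpha> n s) \<longlonglongrightarrow> exp (of_real \<alpha> * L s)"
proof -
  define d where "d n t = - (\<Sum>j<n. Ln (1 + of_real (\<beta> n j) * (of_real t * s))) - L (of_real t * s)" for n and t :: real
  have ev: "\<forall>\<^sub>F n in sequentially. exp (d n 1) = \<Psi> s / g n s \<and> d n 1 = Ln (\<Psi> s / g n s)"
    using eventually_g_near_\<Psi>[OF s] eventually_factors_pos[OF s] eventually_gt_at_top[of 0]
  proof eventually_elim
    case (elim n)
    have pos: "0 < Re (1 + of_real (\<beta> n j) * (of_real t * s))" if "j < n" "t \<in> {0..1}" for j t
    proof -
      have "Re (1 + of_real (\<beta> n j) * (of_real t * s)) = (1 - t) + t * (1 + \<beta> n j * Re s)"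
        by (simp add: algebra_simps)
      also have "\<dots> > 0"
      proof (cases "t = 0")
        case False
        have "0 < 1 + \<beta> n j * Re s" using elim(2) that by simp
        then have "0 < t * (1 + \<beta> n j * Re s)" by (rule mult_pos_pos[rotated]) (use False that in auto)
        then show ?thesis using that by (intro add_nonneg_pos) auto
      qed simp
      finally show ?thesis .
    qed
    have exp_d: "exp (d n t) = \<Psi> (of_real t * s) / g n (of_real t * s)" if t: "t \<in> {0..1}" for t
    proof -
      have nz: "1 + of_real (\<beta> n j) * (of_real t * s) \<noteq> 0" if "j < n" for j
        using pos[OF that t] by (metis less_irrefl zero_complex.simps(1))
      have "exp (d n t) = 1 / (g n (of_real t * s) * bilateral_laplace f (of_real t * s))"
        using elim(3) nz exp_L[OF segment_in_strip[OF s t]]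
        by (simp add: d_def exp_diff exp_minus exp_sum g_eq divide_inverse)
      also have "\<dots> = \<Psi> (of_real t * s) / g n (of_real t * s)"
      proof -
        have "1 / bilateral_laplace f (of_real t * s) = \<Psi> (of_real t * s)"
          using laplace_\<Psi>[OF segment_in_strip[OF s t]]
          by (metis inverse_unique inverse_eq_divide)
        then show ?thesis by (metis divide_divide_eq_left' mult.commute)
      qed
      finally show ?thesis .
    qed
    have "d n 1 = Ln (exp (d n 1))"
    proof (rule path_log_principal)
      show "d n 0 = 0" by (simp add: d_def L_0)
      have "continuous_on {0..1} (\<lambda>t. L (complex_of_real t * s))"
        using segment_in_strip[OF s]
        by (intro continuous_on_compose2[OF holomorphic_on_imp_continuous_on[OF L_holomorphic]] continuous_intros) auto
      moreover have "continuous_on {0..1} (\<lambda>t. Ln (1 + of_real (\<beta> n j) * (complex_of_real t * s)))" if "j < n" for j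
      proof (intro continuous_intros ballI)
        fix t :: real assume "t \<in> {0..1}"
        from pos[OF that this] show "1 + of_real (\<beta> n j) * (of_real t * s) \<notin> \<real>\<^sub>\<le>\<^sub>0"
          unfolding complex_nonpos_Reals_iff by linarith
      qed
      ultimately show "continuous_on {0..1} (d n)"
        unfolding d_def by (intro continuous_on_diff continuous_on_minus continuous_on_sum) auto
      fix t :: real assume t: "t \<in> {0..1}"
      define z where "z = exp (d n t)"
      have "norm (z - 1) < 1" using elim(1) t exp_d[OF t] by (simp add: z_def)
      then have "\<bar>Re (z - 1)\<bar> < 1" using abs_Re_le_cmod[of "z - 1"] by linarith
      then show "0 < Re (exp (d n t))" by (simp add: z_def[symmetric])
    qed
    then show ?case using exp_d[of 1] by simp
  qed
  have "(\<lambda>n. \<Psi> s / g n s) \<longlonglongrightarrow> \<Psi> s / \<Psi> s"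
    using \<Psi>_nonzero[OF s] by (intro tendsto_intros g_tendsto)
  then have "(\<lambda>n. Ln (\<Psi> s / g n s)) \<longlonglongrightarrow> Ln 1"
    using \<Psi>_nonzero[OF s] by (intro tendsto_Ln) auto
  then have "(\<lambda>n. d n 1) \<longlonglongrightarrow> 0"
    unfolding Ln_1 by (rule Lim_transform_eventually) (rule eventually_mono[OF ev], erule conjE, rule sym)
  then have "(\<lambda>n. exp (of_real \<alpha> * (d n 1 + L s))) \<longlonglongrightarrow> exp (of_real \<alpha> * (0 + L s))"
    by (intro tendsto_intros)
  moreover have "exp (of_real \<alpha> * (d n 1 + L s)) = G_approx \<alpha> n s" for n
  proof -
    have "G_approx \<alpha> n s = exp (\<Sum>j<n. - (of_real \<alpha> * Ln (1 + of_real (\<beta> n j) * s)))"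
      unfolding G_approx_def by (rule exp_sum[symmetric]) simp
    also have "(\<Sum>j<n. - (of_real \<alpha> * Ln (1 + of_real (\<beta> n j) * s))) = of_real \<alpha> * (d n 1 + L s)"
      unfolding d_def sum_negf sum_distrib_left[symmetric] by simp
    finally show ?thesis by (rule sym)
  qed
  ultimately show ?thesis by simp
qed

lemma norm_G_approx:
  assumes "\<forall>j<n. 0 < 1 + \<beta> n j * Re s"
  shows "norm (G_approx \<alpha> n s) = (\<Prod>j<n. norm (1 + of_real (\<beta> n j) * s)) powr (- \<alpha>)"
proof -
  have "norm (G_approx \<alpha> n s) = (\<Prod>j<n. norm (1 + of_real (\<beta> n j) * s) powr (- \<alpha>))"
    unfolding G_approx_def prod_norm[symmetric] using assms by (intro prod.cong refl norm_cpower) auto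
  also have "\<dots> = (\<Prod>j<n. norm (1 + of_real (\<beta> n j) * s)) powr (- \<alpha>)"
    by (simp add: prod_powr_distrib)
  finally show ?thesis .
qed

text \<open>On the line through \<sigma> the modulus of each factor is its value at \<sigma> times
  \<open>sqrt (1 + \<gamma> j * t\<^sup>2)\<close>. The product of the radicands is at least 1 plus
  the sum of the \<open>\<gamma> j * t\<^sup>2\<close>, and the sum of the \<gamma> inherits a
  positive lower bound from that of the squares of the \<beta>.\<close>

lemma G_approx_bound:
  assumes \<sigma>: "of_real \<sigma> \<in> laplace_strip f" and \<alpha>: "\<alpha> > 0"
  shows "\<exists>C c. c > 0 \<and> (\<forall>\<^sub>F n in sequentially. \<forall>t. norm (G_approx \<alpha> n (of_real \<sigma> + \<i> * of_real t)) \<le>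
    C * (1 + c * t\<^sup>2) powr (- \<alpha> / 2))"
proof -
  \<comment> \<open>The values at \<sigma> converge, so their moduli are eventually below that of
    the limit plus 1.\<close>
  define C where "C = norm (exp (of_real \<alpha> * L (of_real \<sigma>))) + 1"
  \<comment> \<open>Bounds the square of every \<open>1 + \<beta> n j * \<sigma>\<close>, because
    each \<beta> has square at most \<open>K\<close>.\<close>
  define B where "B = (1 + sqrt K * \<bar>\<sigma>\<bar>)\<^sup>2"
  have "K \<ge> 0" by (simp add: K_def)
  then have B: "B > 0" unfolding B_def by (intro zero_less_power add_pos_nonneg) auto
  define c where "c = v / 2 / B"
  have c: "c > 0" using B v_pos by (simp add: c_def)
  have "(\<lambda>n. norm (G_approx \<alpha> n (of_real \<sigma>))) \<longlonglongrightarrow> norm (exp (of_real \<alpha> * L (of_real \<sigma>)))"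
    by (intro tendsto_norm G_approx_tendsto \<sigma>)
  then have "\<forall>\<^sub>F n in sequentially. norm (G_approx \<alpha> n (of_real \<sigma>)) < C"
    by (rule order_tendstoD) (simp add: C_def)
  then have "\<forall>\<^sub>F n in sequentially. \<forall>t. norm (G_approx \<alpha> n (of_real \<sigma> + \<i> * of_real t)) \<le> C * (1 + c * t\<^sup>2) powr (- \<alpha> / 2)"
    using eventually_factors_pos[OF \<sigma>] eventually_sum_\<beta>_squares_ge eventually_ge_at_top[of 2]
  proof eventually_elim
    case (elim n)
    show ?case
    proof
      fix t
      define \<gamma> where "\<gamma> j = (\<beta> n j / (1 + \<beta> n j * \<sigma>))\<^sup>2" for j
      have pos: "0 < 1 + \<beta> n j * \<sigma>" if "j < n" for j using elim(2) that by simp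
      have norm_factor: "norm (1 + of_real (\<beta> n j) * (of_real \<sigma> + \<i> * of_real t)) =
          norm (1 + of_real (\<beta> n j) * complex_of_real \<sigma>) * sqrt (1 + \<gamma> j * t\<^sup>2)" if "j < n" for j
      proof -
        have "norm (1 + of_real (\<beta> n j) * (of_real \<sigma> + \<i> * of_real t)) = sqrt ((1 + \<beta> n j * \<sigma>)\<^sup>2 + (\<beta> n j * t)\<^sup>2)"
          by (simp add: cmod_def)
        also have "(1 + \<beta> n j * \<sigma>)\<^sup>2 + (\<beta> n j * t)\<^sup>2 = (1 + \<beta> n j * \<sigma>)\<^sup>2 * (1 + \<gamma> j * t\<^sup>2)"
          using pos[OF that] by (simp add: \<gamma>_def power_divide power_mult_distrib distrib_left)
        also have "sqrt \<dots> = norm (1 + of_real (\<beta> n j) * complex_of_real \<sigma>) * sqrt (1 + \<gamma> j * t\<^sup>2)"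
          using pos[OF that] by (simp add: real_sqrt_mult cmod_def)
        finally show ?thesis .
      qed
      have "c * t\<^sup>2 \<le> (\<Sum>j<n. \<gamma> j * t\<^sup>2)"
      proof -
        have "(\<beta> n j)\<^sup>2 / B \<le> \<gamma> j" if "j < n" for j
        proof -
          have "(\<beta> n j)\<^sup>2 \<le> (\<Sum>j<n. (\<beta> n j)\<^sup>2)" using that by (intro member_le_sum) auto
          then have "(\<beta> n j)\<^sup>2 \<le> K" using sum_\<beta>_squares_le[OF elim(4)] by simp
          then have "\<bar>\<beta> n j\<bar> \<le> sqrt K" by (simp add: real_le_rsqrt)
          then have "\<bar>\<beta> n j\<bar> * \<bar>\<sigma>\<bar> \<le> sqrt K * \<bar>\<sigma>\<bar>" by (rule mult_right_mono) simp
          moreover have "\<beta> n j * \<sigma> \<le> \<bar>\<beta> n j\<bar> * \<bar>\<sigma>\<bar>" by (metis abs_ge_self abs_mult)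
          ultimately have "(1 + \<beta> n j * \<sigma>)\<^sup>2 \<le> B"
            unfolding B_def using pos[OF that] by (intro power_mono) auto
          then show ?thesis
            unfolding \<gamma>_def power_divide using pos[OF that] by (intro divide_left_mono) (auto simp: B)
        qed
        then have "(\<Sum>j<n. (\<beta> n j)\<^sup>2 / B) \<le> (\<Sum>j<n. \<gamma> j)" by (intro sum_mono) auto
        moreover have "c \<le> (\<Sum>j<n. (\<beta> n j)\<^sup>2 / B)"
          using elim(3) B unfolding c_def sum_divide_distrib[symmetric] by (intro divide_right_mono) auto
        ultimately have "c \<le> (\<Sum>j<n. \<gamma> j)" by simp
        then show ?thesis unfolding sum_distrib_right[symmetric] by (intro mult_right_mono) auto
      qed
      also have "1 + (\<Sum>j<n. \<gamma> j * t\<^sup>2) \<le> (\<Prod>j<n. 1 + \<gamma> j * t\<^sup>2)"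
        by (intro one_plus_sum_le_prod) (simp add: \<gamma>_def)
      finally have prod_ge: "1 + c * t\<^sup>2 \<le> (\<Prod>j<n. 1 + \<gamma> j * t\<^sup>2)" by simp
      have "norm (G_approx \<alpha> n (of_real \<sigma> + \<i> * of_real t)) =
          (\<Prod>j<n. norm (1 + of_real (\<beta> n j) * complex_of_real \<sigma>) * sqrt (1 + \<gamma> j * t\<^sup>2)) powr (- \<alpha>)"
      proof (subst norm_G_approx)
        show "\<forall>j<n. 0 < 1 + \<beta> n j * Re (of_real \<sigma> + \<i> * of_real t)" using elim(2) by simp
      qed (intro arg_cong2[where f = "(powr)"] prod.cong refl norm_factor, simp)
      also have "\<dots> = (\<Prod>j<n. norm (1 + of_real (\<beta> n j) * complex_of_real \<sigma>)) powr (- \<alpha>) *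
          (\<Prod>j<n. sqrt (1 + \<gamma> j * t\<^sup>2)) powr (- \<alpha>)"
        by (simp add: prod.distrib powr_mult)
      also have "(\<Prod>j<n. norm (1 + of_real (\<beta> n j) * complex_of_real \<sigma>)) powr (- \<alpha>) = norm (G_approx \<alpha> n (of_real \<sigma>))"
        using elim(2) by (subst norm_G_approx) auto
      also have "(\<Prod>j<n. sqrt (1 + \<gamma> j * t\<^sup>2)) powr (- \<alpha>) = (\<Prod>j<n. 1 + \<gamma> j * t\<^sup>2) powr (- \<alpha> / 2)"
      proof -
        have "(\<Prod>j<n. sqrt (1 + \<gamma> j * t\<^sup>2)) = (\<Prod>j<n. (1 + \<gamma> j * t\<^sup>2) powr (1 / 2))"
          by (intro prod.cong refl powr_half_sqrt[symmetric]) (simp add: \<gamma>_def)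
        also have "\<dots> = (\<Prod>j<n. 1 + \<gamma> j * t\<^sup>2) powr (1 / 2)"
          by (rule prod_powr_distrib[symmetric])
        finally have "(\<Prod>j<n. sqrt (1 + \<gamma> j * t\<^sup>2)) = (\<Prod>j<n. 1 + \<gamma> j * t\<^sup>2) powr (1 / 2)" .
        then show ?thesis by (simp add: powr_powr)
      qed
      also have "norm (G_approx \<alpha> n (of_real \<sigma>)) * \<dots> \<le> C * (1 + c * t\<^sup>2) powr (- \<alpha> / 2)"
        using elim(1) prod_ge c \<alpha> by (intro mult_mono powr_mono2') (auto simp: C_def intro: add_pos_nonneg)
      finally show "norm (G_approx \<alpha> n (of_real \<sigma> + \<i> * of_real t)) \<le> C * (1 + c * t\<^sup>2) powr (- \<alpha> / 2)" .
    qed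
  qed
  then show ?thesis using c by blast
qed

definition approximant :: "nat \<Rightarrow> real \<Rightarrow> nat \<Rightarrow> (real \<Rightarrow> real) \<Rightarrow> bool" where
  "approximant p \<alpha> n h \<longleftrightarrow> TN p h \<and>
    (\<forall>s. (\<forall>j<n. 0 < 1 + \<beta> n j * Re s) \<longrightarrow> laplace_converges h s \<and> bilateral_laplace h s = G_approx \<alpha> n s)"

text \<open>Vanishing \<beta> contribute the factor 1 but no density and are left out; the lower
  bound on the sum of squares ensures that some \<beta> remains.\<close>

lemma eventually_ex_approximant:
  assumes \<alpha>: "\<alpha> > real p - 1" "\<alpha> > 1"
  shows "\<forall>\<^sub>F n in sequentially. \<exists>h. approximant p \<alpha> n h"
  using eventually_sum_\<beta>_squares_ge
proof eventually_elim
  case (elim n)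
  define J where "J = {j. j < n \<and> \<beta> n j \<noteq> 0}"
  have J: "finite J" "j \<in> J \<Longrightarrow> \<beta> n j \<noteq> 0" for j by (auto simp: J_def)
  have "J \<noteq> {}"
  proof
    assume "J = {}"
    then have "(\<Sum>j<n. (\<beta> n j)\<^sup>2) = 0" by (intro sum.neutral) (auto simp: J_def)
    then show False using elim v_pos by simp
  qed
  from gamma_convolution[where \<beta> = "\<beta> n", OF J(1) this J(2) \<alpha>] obtain h where h: "TN p h" "\<And>s. (\<forall>j\<in>J. 0 < 1 + \<beta> n j * Re s) \<Longrightarrow> laplace_converges h s \<and>
       bilateral_laplace h s = (\<Prod>j\<in>J. exp (- (of_real \<alpha> * Ln (1 + of_real (\<beta> n j) * s))))"
    by blast
  have "(\<Prod>j\<in>J. exp (- (of_real \<alpha> * Ln (1 + of_real (\<beta> n j) * s)))) = G_approx \<alpha> n s" for s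
    unfolding G_approx_def
  proof (rule prod.mono_neutral_left)
    show "\<forall>j\<in>{..<n} - J. exp (- (complex_of_real \<alpha> * Ln (1 + of_real (\<beta> n j) * s))) = 1"
    proof
      fix j assume "j \<in> {..<n} - J"
      then have "\<beta> n j = 0" by (simp add: J_def)
      then show "exp (- (complex_of_real \<alpha> * Ln (1 + of_real (\<beta> n j) * s))) = 1" by simp
    qed
  qed (auto simp: J_def)
  note prod = this
  have "approximant p \<alpha> n h"
    unfolding approximant_def
  proof (intro conjI[OF h(1)] allI impI)
    fix s assume "\<forall>j<n. 0 < 1 + \<beta> n j * Re s"
    then have "\<forall>j\<in>J. 0 < 1 + \<beta> n j * Re s" by (simp add: J_def)
    from h(2)[OF this] show "laplace_converges h s \<and> bilateral_laplace h s = G_approx \<alpha> n s"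
      unfolding prod .
  qed
  then show ?case by blast
qed

lemma G_approx_vertical_measurable:
  assumes "\<forall>j<n. 0 < 1 + \<beta> n j * \<sigma>"
  shows "(\<lambda>t. G_approx \<alpha> n (of_real \<sigma> + \<i> * of_real t)) \<in> borel_measurable borel"
proof (rule borel_measurable_continuous_onI)
  have "continuous_on UNIV (\<lambda>t. Ln (1 + of_real (\<beta> n j) * (of_real \<sigma> + \<i> * complex_of_real t)))" if "j < n" for j
  proof (intro continuous_intros ballI)
    fix t :: real
    have "0 < 1 + \<beta> n j * \<sigma>" using assms that by simp
    then show "1 + of_real (\<beta> n j) * (of_real \<sigma> + \<i> * of_real t) \<notin> \<real>\<^sub>\<le>\<^sub>0"
      by (simp add: complex_nonpos_Reals_iff)
  qed
  then show "continuous_on UNIV (\<lambda>t. G_approx \<alpha> n (of_real \<sigma> + \<i> * of_real t))"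
    unfolding G_approx_def
    by (intro continuous_on_prod continuous_on_exp continuous_on_minus continuous_on_mult continuous_on_const) auto
qed

lemma G_approx_real_pos:
  assumes "\<forall>j<n. 0 < 1 + \<beta> n j * \<sigma>"
  shows "\<exists>c. G_approx \<alpha> n (of_real \<sigma>) = of_real c \<and> 0 < c"
proof (intro exI conjI)
  show "0 < (\<Prod>j<n. exp (- (\<alpha> * ln (1 + \<beta> n j * \<sigma>))))" by (intro prod_pos) auto
  have "exp (- (complex_of_real \<alpha> * Ln (1 + of_real (\<beta> n j) * of_real \<sigma>))) = of_real (exp (- (\<alpha> * ln (1 + \<beta> n j * \<sigma>))))"
    if "j < n" for j
  proof -
    have "0 < 1 + \<beta> n j * \<sigma>" using assms that by simp
    then have "Ln (of_real (1 + \<beta> n j * \<sigma>)) = of_real (ln (1 + \<beta> n j * \<sigma>))" by (rule Ln_of_real)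
    then show ?thesis by (simp add: exp_of_real[symmetric])
  qed
  then show "G_approx \<alpha> n (of_real \<sigma>) = of_real (\<Prod>j<n. exp (- (\<alpha> * ln (1 + \<beta> n j * \<sigma>))))"
    unfolding G_approx_def of_real_prod by (intro prod.cong) auto
qed

lemma G_approx_dominated:
  assumes \<sigma>: "of_real \<sigma> \<in> laplace_strip f" and \<alpha>: "\<alpha> > 1"
  shows "\<exists>w. integrable lborel w \<and> (\<forall>\<^sub>F n in sequentially.
    (\<lambda>t. G_approx \<alpha> n (of_real \<sigma> + \<i> * of_real t)) \<in> borel_measurable borel \<and>
    (\<forall>t. norm (G_approx \<alpha> n (of_real \<sigma> + \<i> * of_real t)) \<le> w t))"
proof -
  obtain C c where C: "c > 0" "\<forall>\<^sub>F n in sequentially. \<forall>t. norm (G_approx \<alpha> n (of_real \<sigma> + \<i> * of_real t)) \<le>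
      C * (1 + c * t\<^sup>2) powr (- \<alpha> / 2)"
    using G_approx_bound[OF \<sigma>, of \<alpha>] \<alpha> by auto
  show ?thesis
  proof (intro exI conjI)
    show "integrable lborel (\<lambda>t. C * (1 + c * t\<^sup>2) powr (- \<alpha> / 2))"
      by (intro integrable_mult_right integrable_quadratic_power \<alpha> C)
    show "\<forall>\<^sub>F n in sequentially. (\<lambda>t. G_approx \<alpha> n (of_real \<sigma> + \<i> * of_real t)) \<in> borel_measurable borel \<and>
        (\<forall>t. norm (G_approx \<alpha> n (of_real \<sigma> + \<i> * of_real t)) \<le> C * (1 + c * t\<^sup>2) powr (- \<alpha> / 2))"
      using C(2) eventually_factors_pos[OF \<sigma>]
      by eventually_elim (intro conjI G_approx_vertical_measurable, simp_all)
  qed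
qed

lemma approximant_inversion:
  assumes \<sigma>: "of_real \<sigma> \<in> laplace_strip f" and \<alpha>: "\<alpha> > 1" and p: "p \<ge> 1"
  shows "\<forall>\<^sub>F n in sequentially. \<forall>h. approximant p \<alpha> n h \<longrightarrow>
    (AE x in lborel. of_real (h x) = of_real (exp (\<sigma> * x) / (2 * pi)) *
      (LINT t|lborel. iexp (t * x) * G_approx \<alpha> n (of_real \<sigma> + \<i> * of_real t)))"
proof -
  obtain w where w: "integrable lborel w" "\<forall>\<^sub>F n in sequentially.
    (\<lambda>t. G_approx \<alpha> n (of_real \<sigma> + \<i> * of_real t)) \<in> borel_measurable borel \<and>
    (\<forall>t. norm (G_approx \<alpha> n (of_real \<sigma> + \<i> * of_real t)) \<le> w t)"
    using G_approx_dominated[OF \<sigma> \<alpha>] by blast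
  from w(2) eventually_factors_pos[OF \<sigma>] show ?thesis
  proof (eventually_elim, intro allI impI)
    fix n h
    assume G: "(\<lambda>t. G_approx \<alpha> n (of_real \<sigma> + \<i> * of_real t)) \<in> borel_measurable borel \<and>
        (\<forall>t. norm (G_approx \<alpha> n (of_real \<sigma> + \<i> * of_real t)) \<le> w t)"
      and pos: "\<forall>j<n. 0 < 1 + \<beta> n j * Re (complex_of_real \<sigma>)" and h: "approximant p \<alpha> n h"
    have laplace: "laplace_converges h (of_real \<sigma> + \<i> * of_real t)"
      "bilateral_laplace h (of_real \<sigma> + \<i> * of_real t) = G_approx \<alpha> n (of_real \<sigma> + \<i> * of_real t)" for t
      using h pos unfolding approximant_def by auto
    obtain c where c: "G_approx \<alpha> n (of_real \<sigma>) = of_real c" "0 < c"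
      using G_approx_real_pos[of n \<sigma> \<alpha>] pos by auto
    have "integrable lborel (\<lambda>t. G_approx \<alpha> n (of_real \<sigma> + \<i> * of_real t))"
      using G by (intro Bochner_Integration.integrable_bound[OF w(1)] AE_I2) (auto intro: order_trans[OF _ abs_ge_self])
    then show "AE x in lborel. of_real (h x) = of_real (exp (\<sigma> * x) / (2 * pi)) *
        (LINT t|lborel. iexp (t * x) * G_approx \<alpha> n (of_real \<sigma> + \<i> * of_real t))"
      unfolding laplace(2)[symmetric]
      using laplace[of 0] c h p
      by (intro laplace_inversion_AE[where c = c]) (auto simp: approximant_def intro: TN_nonneg)
  qed
qed

text \<open>Inversion along the line through \<sigma> gives the rate
  \<open>exp (\<sigma> * x)\<close> with a constant uniform in \<open>n\<close>. Values of \<sigma>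
  on both sides of \<open>Re s\<close> will combine to a majorant of the Laplace integrals at
  \<open>s\<close>.\<close>

lemma approximant_le_exp:
  assumes \<sigma>: "of_real \<sigma> \<in> laplace_strip f" and \<alpha>: "\<alpha> > 1" and p: "p \<ge> 1"
  shows "\<exists>C. \<forall>\<^sub>F n in sequentially. \<forall>h. approximant p \<alpha> n h \<longrightarrow> (AE x in lborel. h x \<le> C * exp (\<sigma> * x))"
proof -
  obtain w where w: "integrable lborel w" "\<forall>\<^sub>F n in sequentially.
    (\<lambda>t. G_approx \<alpha> n (of_real \<sigma> + \<i> * of_real t)) \<in> borel_measurable borel \<and>
    (\<forall>t. norm (G_approx \<alpha> n (of_real \<sigma> + \<i> * of_real t)) \<le> w t)"
    using G_approx_dominated[OF \<sigma> \<alpha>] by blast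
  from w(2) approximant_inversion[OF assms]
  have "\<forall>\<^sub>F n in sequentially. \<forall>h. approximant p \<alpha> n h \<longrightarrow>
    (AE x in lborel. h x \<le> (LINT t|lborel. w t) / (2 * pi) * exp (\<sigma> * x))"
  proof (eventually_elim, intro allI impI)
    fix n h
    assume G: "(\<lambda>t. G_approx \<alpha> n (of_real \<sigma> + \<i> * of_real t)) \<in> borel_measurable borel \<and>
        (\<forall>t. norm (G_approx \<alpha> n (of_real \<sigma> + \<i> * of_real t)) \<le> w t)"
      and inv: "\<forall>h. approximant p \<alpha> n h \<longrightarrow>
        (AE x in lborel. of_real (h x) = of_real (exp (\<sigma> * x) / (2 * pi)) *
          (LINT t|lborel. iexp (t * x) * G_approx \<alpha> n (of_real \<sigma> + \<i> * of_real t)))"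
      and h: "approximant p \<alpha> n h"
    have bound: "norm (LINT t|lborel. iexp (t * x) * G_approx \<alpha> n (of_real \<sigma> + \<i> * of_real t)) \<le> (LINT t|lborel. w t)" for x
    proof (rule Bochner_Integration.integral_norm_bound_integral)
      show "integrable lborel (\<lambda>t. iexp (t * x) * G_approx \<alpha> n (of_real \<sigma> + \<i> * of_real t))"
        using G by (intro Bochner_Integration.integrable_bound[OF w(1)] AE_I2)
          (auto simp: norm_mult intro: order_trans[OF _ abs_ge_self])
      show "norm (iexp (t * x) * G_approx \<alpha> n (of_real \<sigma> + \<i> * of_real t)) \<le> w t" for t
        using G by (simp add: norm_mult)
    qed (rule w)
    from inv h have "AE x in lborel. of_real (h x) = of_real (exp (\<sigma> * x) / (2 * pi)) *
          (LINT t|lborel. iexp (t * x) * G_approx \<alpha> n (of_real \<sigma> + \<i> * of_real t))" by blast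
    then show "AE x in lborel. h x \<le> (LINT t|lborel. w t) / (2 * pi) * exp (\<sigma> * x)"
    proof eventually_elim
      case (elim x)
      have "h x \<le> norm (complex_of_real (h x))" by simp
      also have "\<dots> = exp (\<sigma> * x) / (2 * pi) * norm (LINT t|lborel. iexp (t * x) * G_approx \<alpha> n (of_real \<sigma> + \<i> * of_real t))"
        unfolding elim norm_mult norm_of_real by simp
      also have "\<dots> \<le> exp (\<sigma> * x) / (2 * pi) * (LINT t|lborel. w t)"
        by (intro mult_left_mono bound) simp
      finally show ?case by (simp add: mult.commute)
    qed
  qed
  then show ?thesis by blast
qed

lemma exp_L_vertical_integrable:
  assumes \<alpha>: "\<alpha> > 1"
  shows "integrable lborel (\<lambda>t. exp (of_real \<alpha> * L (\<i> * of_real t)))"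
    and "(\<lambda>n. LINT t|lborel. iexp (t * x) * G_approx \<alpha> n (\<i> * of_real t)) \<longlonglongrightarrow>
      (LINT t|lborel. iexp (t * x) * exp (of_real \<alpha> * L (\<i> * of_real t)))"
proof -
  obtain w where w: "integrable lborel w" "\<forall>\<^sub>F n in sequentially.
    (\<lambda>t. G_approx \<alpha> n (of_real 0 + \<i> * of_real t)) \<in> borel_measurable borel \<and>
    (\<forall>t. norm (G_approx \<alpha> n (of_real 0 + \<i> * of_real t)) \<le> w t)"
    using G_approx_dominated[of 0 \<alpha>] zero_in_strip \<alpha> by auto
  then obtain N where N: "\<And>n. n \<ge> N \<Longrightarrow> (\<lambda>t. G_approx \<alpha> n (\<i> * of_real t)) \<in> borel_measurable borel"
      "\<And>n t. n \<ge> N \<Longrightarrow> norm (G_approx \<alpha> n (\<i> * of_real t)) \<le> w t"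
    unfolding eventually_sequentially by auto
  have strip: "\<i> * of_real t \<in> laplace_strip f" for t :: real
    using zero_in_strip by (rule laplace_strip_Re_cong) simp
  have lim: "(\<lambda>n. G_approx \<alpha> (n + N) (\<i> * of_real t)) \<longlonglongrightarrow> exp (of_real \<alpha> * L (\<i> * of_real t))" for t :: real
    by (intro LIMSEQ_ignore_initial_segment G_approx_tendsto strip)
  have meas: "(\<lambda>t. exp (of_real \<alpha> * L (\<i> * of_real t))) \<in> borel_measurable borel"
    by (intro borel_measurable_continuous_onI continuous_intros
        continuous_on_compose2[OF holomorphic_on_imp_continuous_on[OF L_holomorphic]]) (use strip in auto)
  show "integrable lborel (\<lambda>t. exp (of_real \<alpha> * L (\<i> * of_real t)))"
    by (rule integrable_dominated_convergence[OF _ _ w(1) AE_I2[OF lim]]) (use meas N in auto)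
  have "(\<lambda>n. LINT t|lborel. iexp (t * x) * G_approx \<alpha> (n + N) (\<i> * of_real t)) \<longlonglongrightarrow>
      (LINT t|lborel. iexp (t * x) * exp (of_real \<alpha> * L (\<i> * of_real t)))"
  proof (rule integral_dominated_convergence[OF _ _ w(1)])
    show "AE t in lborel. (\<lambda>n. iexp (t * x) * G_approx \<alpha> (n + N) (\<i> * of_real t)) \<longlonglongrightarrow> iexp (t * x) * exp (of_real \<alpha> * L (\<i> * of_real t))"
      by (intro AE_I2 tendsto_intros lim)
  qed (use meas N in \<open>auto simp: norm_mult\<close>)
  then show "(\<lambda>n. LINT t|lborel. iexp (t * x) * G_approx \<alpha> n (\<i> * of_real t)) \<longlonglongrightarrow>
      (LINT t|lborel. iexp (t * x) * exp (of_real \<alpha> * L (\<i> * of_real t)))"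
    by (rule LIMSEQ_offset)
qed

text \<open>\<open>M\<close> is the inversion integral of the limit along the imaginary axis. The
  approximants converge to it almost everywhere, which transfers the minors because \<open>M\<close>
  is continuous; its transform is then identified at each \<open>s\<close> of the strip by dominated
  convergence.\<close>

lemma power_is_laplace_nonint:
  assumes \<alpha>: "\<alpha> > real p - 1" "\<alpha> > 1" and p: "p \<ge> 1"
  shows "\<exists>M. TN p M \<and> laplace_transform_of_on (laplace_strip f) (\<lambda>s. exp (of_real \<alpha> * L s)) M"
proof -
  obtain h where h: "\<forall>\<^sub>F n in sequentially. approximant p \<alpha> n (h n)"
    using eventually_mono[OF eventually_ex_approximant[OF \<alpha>] someI_ex] by metis
  define I where "I x = (LINT t|lborel. iexp (t * x) * exp (of_real \<alpha> * L (\<i> * of_real t)))" for x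
  \<comment> \<open>The approximants are real, so their limit is found by taking the real
    part.\<close>
  define M where "M x = Re (of_real (1 / (2 * pi)) * I x)" for x
  have cont: "isCont M x" for x
    unfolding M_def I_def
    by (intro isCont_Re isCont_mult continuous_const isCont_fourier_integral exp_L_vertical_integrable \<alpha>)
  have M_cont: "continuous_on UNIV M"
    using cont by (intro continuous_at_imp_continuous_on) blast
  have "\<forall>\<^sub>F n in sequentially. AE x in lborel. of_real (h n x) = of_real (1 / (2 * pi)) *
      (LINT t|lborel. iexp (t * x) * G_approx \<alpha> n (\<i> * of_real t))"
    using approximant_inversion[of 0 \<alpha> p, unfolded of_real_0, OF zero_in_strip \<alpha>(2) p] h
  proof eventually_elim
    case (elim n)
    have "AE x in lborel. complex_of_real (h n x) = of_real (exp (0 * x) / (2 * pi)) *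
        (LINT t|lborel. iexp (t * x) * G_approx \<alpha> n (0 + \<i> * of_real t))"
      by (rule elim(1)[THEN spec, THEN mp, OF elim(2)])
    then show ?case unfolding mult_zero_left exp_zero add_0 .
  qed
  then have "\<forall>\<^sub>F n in sequentially. approximant p \<alpha> n (h n) \<and> (AE x in lborel. of_real (h n x) = of_real (1 / (2 * pi)) *
      (LINT t|lborel. iexp (t * x) * G_approx \<alpha> n (\<i> * of_real t)))"
    using h by eventually_elim simp
  then obtain N where "\<forall>n\<ge>N. approximant p \<alpha> n (h n) \<and> (AE x in lborel. of_real (h n x) = of_real (1 / (2 * pi)) *
      (LINT t|lborel. iexp (t * x) * G_approx \<alpha> n (\<i> * of_real t)))"
    unfolding eventually_sequentially by (rule exE)
  then have N: "approximant p \<alpha> (n + N) (h (n + N))"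
      "AE x in lborel. of_real (h (n + N) x) = of_real (1 / (2 * pi)) *
        (LINT t|lborel. iexp (t * x) * G_approx \<alpha> (n + N) (\<i> * of_real t))" for n
    by (simp_all only: le_add2)
  have lim: "AE x in lborel. (\<lambda>n. h (n + N) x) \<longlonglongrightarrow> M x"
  proof -
    from N(2) have "AE x in lborel. \<forall>n. of_real (h (n + N) x) = of_real (1 / (2 * pi)) *
        (LINT t|lborel. iexp (t * x) * G_approx \<alpha> (n + N) (\<i> * of_real t))"
      unfolding AE_all_countable by (rule allI)
    then show ?thesis
    proof eventually_elim
      case (elim x)
      have "(\<lambda>n. of_real (1 / (2 * pi)) * (LINT t|lborel. iexp (t * x) * G_approx \<alpha> n (\<i> * of_real t))) \<longlonglongrightarrow>
          of_real (1 / (2 * pi)) * I x"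
        unfolding I_def by (intro tendsto_mult tendsto_const exp_L_vertical_integrable \<alpha>)
      from LIMSEQ_ignore_initial_segment[OF this, of N]
      have "(\<lambda>n. complex_of_real (h (n + N) x)) \<longlonglongrightarrow> of_real (1 / (2 * pi)) * I x"
        using elim by simp
      from tendsto_Re[OF this] show ?case by (simp add: M_def)
    qed
  qed
  have "TN p M"
    using N(1) by (intro TN_AE_limit[OF _ lim cont]) (auto simp: approximant_def)
  moreover have "laplace_converges M s \<and> bilateral_laplace M s = exp (of_real \<alpha> * L s)" if s: "s \<in> laplace_strip f" for s
  proof -
    obtain e where e: "e > 0" "\<And>w. \<bar>Re w - Re s\<bar> \<le> e \<Longrightarrow> laplace_converges f w"
      using laplace_strip_obtain[OF s] by blast
    \<comment> \<open>Half of the margin keeps the lines through \<open>Re s - d\<close> and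
      \<open>Re s + d\<close> inside the open strip.\<close>
    define d where "d = e / 2"
    have d: "d > 0" using e by (simp add: d_def)
    have strip: "of_real r \<in> laplace_strip f" if "\<bar>r - Re s\<bar> \<le> d" for r
    proof (rule laplace_stripI[OF d])
      fix w assume "\<bar>Re w - Re (complex_of_real r)\<bar> \<le> d"
      then have "\<bar>Re w - Re s\<bar> \<le> 2 * d" using that unfolding Re_complex_of_real by linarith
      then show "laplace_converges f w" by (intro e) (simp add: d_def)
    qed
    obtain C1 where C1: "\<forall>\<^sub>F n in sequentially. \<forall>h. approximant p \<alpha> n h \<longrightarrow> (AE x in lborel. h x \<le> C1 * exp ((Re s - d) * x))"
      using approximant_le_exp[OF strip \<alpha>(2) p, of "Re s - d"] d by auto
    obtain C2 where C2: "\<forall>\<^sub>F n in sequentially. \<forall>h. approximant p \<alpha> n h \<longrightarrow> (AE x in lborel. h x \<le> C2 * exp ((Re s + d) * x))"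
      using approximant_le_exp[OF strip \<alpha>(2) p, of "Re s + d"] d by auto
    define C where "C = max C1 C2"
    from C1 C2 eventually_factors_pos[OF s]
    have "\<forall>\<^sub>F n in sequentially. (\<forall>h. approximant p \<alpha> n h \<longrightarrow>
        (AE x in lborel. h x \<le> C1 * exp ((Re s - d) * x) \<and> h x \<le> C2 * exp ((Re s + d) * x))) \<and>
        (\<forall>j<n. 0 < 1 + \<beta> n j * Re s)"
      by eventually_elim simp
    then obtain N' where N': "\<And>n h. n \<ge> N' \<Longrightarrow> approximant p \<alpha> n h \<Longrightarrow>
        AE x in lborel. h x \<le> C1 * exp ((Re s - d) * x) \<and> h x \<le> C2 * exp ((Re s + d) * x)"
      "\<And>n. n \<ge> N' \<Longrightarrow> \<forall>j<n. 0 < 1 + \<beta> n j * Re s"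
      unfolding eventually_sequentially by meson
    define k where "k n = h (n + N' + N)" for n
    have k: "approximant p \<alpha> (n + N' + N) (k n)" for n
      using N(1)[of "n + N'"] by (simp add: k_def)
    have k_laplace: "laplace_converges (k n) s" "bilateral_laplace (k n) s = G_approx \<alpha> (n + N' + N) s" for n
      using k[of n] N'(2)[of "n + N' + N"] unfolding approximant_def by auto
    have k_nonneg: "0 \<le> k n x" for n x
      using k[of n] p by (auto simp: approximant_def intro: TN_nonneg)
    define F where "F n x = exp (- (complex_of_real x * s)) * complex_of_real (k n x)" for n x
    define F' where "F' x = exp (- (complex_of_real x * s)) * complex_of_real (M x)" for x
    have F'_meas: "F' \<in> borel_measurable lebesgue"
      unfolding F'_def by (intro borel_measurable_lebesgue_continuous continuous_intros M_cont)
    have F_meas: "F n \<in> borel_measurable lebesgue" for n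
      using k_laplace(1)[of n] unfolding laplace_converges_def F_def by (rule borel_measurable_integrable)
    have w: "integrable lebesgue (\<lambda>x. C * exp (- (d * \<bar>x\<bar>)))"
      using integrable_exp_minus_abs[OF d] by (intro integrable_mult_right) (simp add: integrable_completion)
    have F_lim: "AE x in lebesgue. (\<lambda>n. F n x) \<longlonglongrightarrow> F' x"
    proof -
      have "AE x in lborel. (\<lambda>n. F n x) \<longlonglongrightarrow> F' x"
        using lim
      proof eventually_elim
        case (elim x)
        have "(\<lambda>n. k n x) \<longlonglongrightarrow> M x"
          using LIMSEQ_ignore_initial_segment[OF elim, of N'] by (simp add: k_def)
        then show ?case unfolding F_def F'_def by (intro tendsto_intros)
      qed
      then show ?thesis by (simp add: AE_completion_iff)
    qed
    have F_bound: "AE x in lebesgue. norm (F n x) \<le> C * exp (- (d * \<bar>x\<bar>))" for n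
    proof -
      have "N' \<le> n + N' + N" by simp
      note N'(1)[OF this k[of n]]
      then have "AE x in lborel. norm (F n x) \<le> C * exp (- (d * \<bar>x\<bar>))"
      proof eventually_elim
        case (elim x)
        have norm: "norm (F n x) = exp (- (Re s * x)) * k n x"
          using k_nonneg[of n x] by (simp add: F_def norm_mult mult.commute)
        have "exp (- (Re s * x)) * k n x \<le> C * exp (- (d * \<bar>x\<bar>))"
        \<comment> \<open>For x \<ge> 0 the line to the left of \<open>s\<close> provides the decay,
          for x < 0 the line to the right.\<close>
        proof (cases "x \<ge> 0")
          case True
          have "exp (- (Re s * x)) * k n x \<le> exp (- (Re s * x)) * (C1 * exp ((Re s - d) * x))"
            using elim by (intro mult_left_mono) auto
          also have "\<dots> = C1 * (exp (- (Re s * x)) * exp ((Re s - d) * x))" by simp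
          also have "exp (- (Re s * x)) * exp ((Re s - d) * x) = exp (- (d * \<bar>x\<bar>))"
            unfolding exp_add[symmetric] using True by (simp add: algebra_simps)
          finally show ?thesis by (rule order_trans) (simp add: C_def)
        next
          case False
          have "exp (- (Re s * x)) * k n x \<le> exp (- (Re s * x)) * (C2 * exp ((Re s + d) * x))"
            using elim by (intro mult_left_mono) auto
          also have "\<dots> = C2 * (exp (- (Re s * x)) * exp ((Re s + d) * x))" by simp
          also have "exp (- (Re s * x)) * exp ((Re s + d) * x) = exp (- (d * \<bar>x\<bar>))"
            unfolding exp_add[symmetric] using False by (simp add: algebra_simps)
          finally show ?thesis by (rule order_trans) (simp add: C_def)
        qed
        then show ?case unfolding norm .
      qed
      then show ?thesis by (simp add: AE_completion_iff)
    qed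
    have "laplace_converges M s"
      unfolding laplace_converges_def F'_def[symmetric]
      by (rule integrable_dominated_convergence[OF F'_meas F_meas w F_lim F_bound])
    moreover have "(\<lambda>n. integral\<^sup>L lebesgue (F n)) \<longlonglongrightarrow> integral\<^sup>L lebesgue F'"
      by (rule integral_dominated_convergence[OF F'_meas F_meas w F_lim F_bound])
    then have "(\<lambda>n. G_approx \<alpha> (n + (N' + N)) s) \<longlonglongrightarrow> bilateral_laplace M s"
      using k_laplace(2) unfolding bilateral_laplace_def F_def F'_def by (simp add: add.assoc)
    moreover have "(\<lambda>n. G_approx \<alpha> (n + (N' + N)) s) \<longlonglongrightarrow> exp (of_real \<alpha> * L s)"
      by (rule LIMSEQ_ignore_initial_segment[OF G_approx_tendsto[OF s]])
    ultimately show ?thesis using LIMSEQ_unique by blast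
  qed
  ultimately show ?thesis unfolding laplace_transform_of_on_def by blast
qed

end

section \<open>Integer powers, scaling and the reduction to total mass 1\<close>

lemma convolution_power:
  assumes f: "TN p f" "integrable lebesgue f" "\<And>x. \<bar>f x\<bar> \<le> C" and n: "n > 0"
  shows "\<exists>h. TN p h \<and> integrable lebesgue h \<and> (\<exists>C. \<forall>x. \<bar>h x\<bar> \<le> C) \<and>
    (\<forall>s. laplace_converges f s \<longrightarrow> laplace_converges h s \<and> bilateral_laplace h s = bilateral_laplace f s ^ n)"
  using n
proof (induction n rule: nat_induct_non_zero)
  case 1
  then show ?case using f by (intro exI[of _ f]) auto
next
  case (Suc n)
  then obtain h D where h: "TN p h" "integrable lebesgue h" "\<And>x. \<bar>h x\<bar> \<le> D"
    "\<And>s. laplace_converges f s \<Longrightarrow> laplace_converges h s \<and> bilateral_laplace h s = bilateral_laplace f s ^ n"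
    by blast
  have laplace: "laplace_converges (convolve f h) s \<and> bilateral_laplace (convolve f h) s = bilateral_laplace f s ^ Suc n"
    if "laplace_converges f s" for s
    using laplace_convolve[OF that, of h] h(4)[OF that] by simp
  have "laplace_converges f 0" using f(2) by (simp add: laplace_converges_0_iff)
  from laplace[OF this] have "integrable lebesgue (convolve f h)"
    by (simp add: laplace_converges_0_iff)
  moreover have "TN p (convolve f h)" by (rule TN_convolve[OF f h(1,2)])
  moreover have "\<exists>C. \<forall>x. \<bar>convolve f h x\<bar> \<le> C" using convolve_bounded[OF f(3,2) h(2)] by blast
  ultimately show ?case using laplace by blast
qed

lemma (in normalized_polya) power_is_TN_laplace_normalized:
  assumes \<alpha>: "\<alpha> \<in> real ` {n. n > 0} \<union> {real p - 1<..}" and p: "p \<ge> 2" and f: "\<And>x. f x \<le> C"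
  shows "power_is_TN_laplace p \<alpha> f"
proof -
  have "\<exists>M. TN p M \<and> laplace_transform_of_on (laplace_strip f) (\<lambda>s. exp (of_real \<alpha> * L s)) M"
  \<comment> \<open>As p \<ge> 2, \<alpha> > p - 1 already gives \<alpha> > 1, so in the other case
    \<alpha> is a positive integer.\<close>
  proof (cases "\<alpha> > real p - 1 \<and> \<alpha> > 1")
    case True
    then show ?thesis using p by (intro power_is_laplace_nonint) auto
  next
    case False
    then obtain n where n: "n > 0" "\<alpha> = real n"
      using \<alpha> p by auto
    obtain h where h: "TN p h"
      "\<And>s. laplace_converges f s \<Longrightarrow> laplace_converges h s \<and> bilateral_laplace h s = bilateral_laplace f s ^ n"
      using convolution_power[OF TN integrable_f, of C n p] f nonneg n(1) by auto
    have "laplace_transform_of_on (laplace_strip f) (\<lambda>s. exp (of_real \<alpha> * L s)) h"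
      unfolding laplace_transform_of_on_def
    proof
      fix s assume s: "s \<in> laplace_strip f"
      have "exp (of_real \<alpha> * L s) = bilateral_laplace f s ^ n"
        unfolding n(2) of_real_of_nat_eq exp_of_nat_mult exp_L[OF s] ..
      then show "laplace_converges h s \<and> bilateral_laplace h s = exp (of_real \<alpha> * L s)"
        using h(2)[OF laplace_strip_converges[OF s]] by simp
    qed
    then show ?thesis using h(1) by blast
  qed
  then show ?thesis
    unfolding power_is_TN_laplace_def using positive_power_L by blast
qed

text \<open>The logarithm is shifted by \<open>ln c\<close>, and the power is multiplied by
  \<open>c powr \<alpha>\<close>; as this is positive, neither positivity on the real axis nor the
  signs of the minors are affected.\<close>

lemma power_is_TN_laplace_scale:
  assumes c: "c > 0" and f: "power_is_TN_laplace p \<alpha> f"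
  shows "power_is_TN_laplace p \<alpha> (\<lambda>x. c * f x)"
proof -
  obtain G M L where L: "L holomorphic_on laplace_strip f"
      "\<And>s. s \<in> laplace_strip f \<Longrightarrow> exp (L s) = bilateral_laplace f s \<and> G s = exp (of_real \<alpha> * L s)"
    and pos: "\<And>r::real. of_real r \<in> laplace_strip f \<Longrightarrow> \<exists>c::real. 0 < c \<and> G (of_real r) = of_real c"
    and M: "TN p M" "\<And>s. s \<in> laplace_strip f \<Longrightarrow> laplace_converges M s \<and> bilateral_laplace M s = G s"
    using f unfolding power_is_TN_laplace_def positive_power_on_def laplace_transform_of_on_def by blast
  have strip: "laplace_strip (\<lambda>x. c * f x) = laplace_strip f"
    unfolding laplace_strip_def
    by (rule arg_cong[of _ _ interior], rule Collect_cong, rule laplace_scale) (use c in simp)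
  define k where "k = c powr \<alpha>"
  have k: "k > 0" "exp (of_real \<alpha> * of_real (ln c)) = complex_of_real k"
    using c by (simp_all add: k_def powr_def exp_of_real[symmetric])
  have "positive_power_on (laplace_strip f) (bilateral_laplace (\<lambda>x. c * f x)) \<alpha> (\<lambda>s. of_real k * G s)"
    unfolding positive_power_on_def
  proof (intro conjI exI[of _ "\<lambda>s. L s + of_real (ln c)"] ballI allI impI)
    show "(\<lambda>s. L s + of_real (ln c)) holomorphic_on laplace_strip f" by (intro holomorphic_intros L)
    fix s assume s: "s \<in> laplace_strip f"
    have "exp (complex_of_real (ln c)) = of_real c" using c by (simp add: exp_of_real)
    then show "exp (L s + of_real (ln c)) = bilateral_laplace (\<lambda>x. c * f x) s"
      using L(2)[OF s] c by (simp add: laplace_scale exp_add mult.commute)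
    show "of_real k * G s = exp (of_real \<alpha> * (L s + of_real (ln c)))"
      unfolding distrib_left exp_add k(2) using L(2)[OF s] by (simp add: mult.commute)
  next
    fix r :: real assume "of_real r \<in> laplace_strip f"
    then obtain d where "0 < d" "G (of_real r) = of_real d" using pos by blast
    then have "0 < k * d" "of_real k * G (of_real r) = of_real (k * d)" using k by simp_all
    then show "\<exists>d::real. 0 < d \<and> of_real k * G (of_real r) = of_real d" by blast
  qed
  moreover have "TN p (\<lambda>x. k * M x)" using TN_rescale[OF M(1), of k 1] k(1) by simp
  moreover have "laplace_transform_of_on (laplace_strip f) (\<lambda>s. of_real k * G s) (\<lambda>x. k * M x)"
    unfolding laplace_transform_of_on_def using M(2) k(1) by (simp add: laplace_scale)
  ultimately show ?thesis unfolding power_is_TN_laplace_def strip by blast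
qed

text \<open>A zero between \<open>a\<close> and \<open>b\<close> would, by log-concavity, annihilate
  the product of the two nonzero values, so \<open>f\<close> is positive on the whole
  interval.\<close>

lemma polya_frequency_integral_pos:
  assumes TN: "TN p f" "p \<ge> 2" and int: "integrable lebesgue f" and ab: "a < b" "f a \<noteq> 0" "f b \<noteq> 0"
  shows "(LINT x|lebesgue. f x) > 0"
proof -
  have nonneg: "0 \<le> f x" for x using TN by (intro TN_nonneg[of p]) auto
  have pos: "f x \<noteq> 0" if "x \<in> {a..b}" for x
  proof
    assume "f x = 0"
    then have "f a * f b \<le> 0" using TN_2_interchange[OF TN, of "x - a" b a] that by simp
    moreover have "f a > 0" "f b > 0" using ab nonneg[of a] nonneg[of b] by auto
    ultimately show False by (simp add: mult_le_0_iff)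
  qed
  have "(LINT x|lebesgue. f x) \<noteq> 0"
  proof
    assume "(LINT x|lebesgue. f x) = 0"
    then have "AE x in lebesgue. f x = 0" using integral_nonneg_eq_0_iff_AE[OF int] nonneg by simp
    then have "AE x in lebesgue. x \<notin> {a..b}" by eventually_elim (use pos in blast)
    then have "emeasure lebesgue {a..b} = 0" by (subst (asm) AE_iff_null_sets[symmetric]) auto
    then show False using ab(1) by simp
  qed
  then show ?thesis using Bochner_Integration.integral_nonneg[of lebesgue f] nonneg by (simp add: order_less_le)
qed

lemma polya_frequency_power:
  assumes p: "p \<ge> 2" and \<alpha>: "\<alpha> \<in> real ` {n. n > 0} \<union> {real p - 1<..}" and \<Lambda>: "polya_frequency \<Lambda>"
  shows "power_is_TN_laplace p \<alpha> \<Lambda>"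
proof -
  have TN: "TN q \<Lambda>" for q
    using \<Lambda> TN_mono[of "Suc q" \<Lambda> q] unfolding polya_frequency_def totally_nonneg_def by simp
  have int: "integrable lebesgue \<Lambda>" using \<Lambda> by (simp add: polya_frequency_def)
  obtain a b where ab: "a < b" "\<Lambda> a \<noteq> 0" "\<Lambda> b \<noteq> 0"
    using \<Lambda> unfolding polya_frequency_def by (metis linorder_neqE_linordered_idom)
  have nonneg: "0 \<le> \<Lambda> x" for x by (rule TN_nonneg[OF TN[of 1]]) simp
  define c where "c = (LINT x|lebesgue. \<Lambda> x)"
  have c: "c > 0" unfolding c_def by (rule polya_frequency_integral_pos[OF TN[of 2] _ int ab]) simp
  obtain C where C: "\<And>x. \<Lambda> x \<le> C" using TN_integrable_bounded[OF TN[of 2] _ int _ ab(2,3)] ab(1) by auto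
  obtain \<epsilon> K where \<epsilon>: "\<epsilon> > 0" "\<And>x. \<Lambda> x \<le> K * exp (- (\<epsilon> * \<bar>x\<bar>))"
    using TN_exponential_decay[OF TN[of 2] _ int _ ab(2,3)] ab(1) by auto
  define f where "f x = inverse c * \<Lambda> x" for x
  \<comment> \<open>The decay rate \<epsilon> gives convergence in an open strip, whereas the locale
    asks for a closed one.\<close>
  interpret normalized_polya f "\<epsilon> / 2"
  proof
    show "TN q f" for q unfolding f_def using TN_rescale[OF TN[of q], of "inverse c" 1] c by simp
    show "(LINT x|lebesgue. f x) = 1" using c by (simp add: f_def c_def)
    fix w :: complex assume "\<bar>Re w\<bar> \<le> \<epsilon> / 2"
    then have "w \<in> laplace_strip \<Lambda>"
      using \<epsilon> nonneg borel_measurable_integrable[OF int]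
      by (intro exponential_decay_laplace_strip[where K = K and \<epsilon> = \<epsilon>]) auto
    then show "laplace_converges f w"
      unfolding f_def[abs_def] using c by (simp add: laplace_scale laplace_strip_converges)
  qed (use \<epsilon> in simp)
  have "f x \<le> inverse c * C" for x
    unfolding f_def using C c by (intro mult_left_mono) auto
  then have "power_is_TN_laplace p \<alpha> f" by (rule power_is_TN_laplace_normalized[OF \<alpha> p])
  then have "power_is_TN_laplace p \<alpha> (\<lambda>x. c * f x)" by (rule power_is_TN_laplace_scale[OF c])
  moreover have "(\<lambda>x. c * f x) = \<Lambda>" using c by (simp add: f_def mult.assoc[symmetric])
  ultimately show ?thesis by simp
qed

theorem proposition3p5:
  fixes p :: nat and \<alpha> :: real
  assumes "p \<ge> 2" and "\<alpha> \<ge> 1"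
  shows "((\<forall>\<Lambda>. polya_frequency \<Lambda> \<and> one_sided \<Lambda> \<longrightarrow> power_is_TN_laplace p \<alpha> \<Lambda>)
            \<longleftrightarrow> power_is_TN_laplace p \<alpha> lambda1)
       \<and> (power_is_TN_laplace p \<alpha> lambda1
            \<longleftrightarrow> \<alpha> \<in> real ` {n. n > 0} \<union> {real p - 1<..})"
  using polya_frequency_lambda1 one_sided_lambda1 power_lambda1_TN_imp[OF assms] polya_frequency_power[OF assms(1)]
  by blast

end
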